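(* Let $r\in(0,4/3)$. For real $T\geqslant 1$ and integers $N$ with $1\leqslant N\leqslant\sqrt T$, we have $$\frac1T\int_0^T\Big|\sum_{n\leqslant N}n^{it}\Big|^r\,\mathrm dt\gg\frac{N^{r/2}}{\mathcal E_N^{1-r/2}},$$ where the implied constant depends at most on $r$. In particular, $$\lim_{T\to+\infty}\frac1T\int_0^T\Big|\sum_{n\leqslant N}n^{it}\Big|\,\mathrm dt\gg\sqrt{\frac N{\mathcal E_N}},$$ and, when $N\geqslant 3$, $$\sqrt{\frac N{\mathcal E_N}}\gg\frac{\sqrt N}{(\log N)^{\delta/2}(\log\log N)^3},$$ with absolute implied constants.
   Context: For an integer $N\geqslant 1$, $$\mathcal E_N:=\inf_{\boldsymbol c\in(\mathbb R^+)^N,\ \|\boldsymbol c\|_1=1}N^2\sum_{1\leqslant n\leqslant N^2}\Bigg(\sum_{\substack{d\leqslant N,\ t\leqslant N\\ dt=n}}c_dc_t\Bigg)^2,$$ where $\mathbb R^+=[0,\infty)$ and $\|\boldsymbol c\|_1=\sum_{n\leqslant N}|c_n|$. The exponent is $\delta:=1-\dfrac{1+\log\log 2}{\log 2}\approx 0.08607$. The notation $A\gg B$ means $A\geqslant KB$ for some constant $K>0$. *)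

theory Defs
  imports "HOL-Analysis.Analysis"
begin

text \<open>A vector in \<open>(\<real>\<^sup>+)\<^sup>N\<close> is represented by a function on \<open>nat\<close>
  whose values outside \<open>{1..N}\<close> are irrelevant.\<close>

definition mult_energy :: "nat \<Rightarrow> (nat \<Rightarrow> real) \<Rightarrow> real" where
  "mult_energy N c =
     (\<Sum>n=1..N^2. (\<Sum>(d, t) \<in> {(d, t) \<in> {1..N} \<times> {1..N}. d * t = n}. c d * c t)^2)"

text \<open>The infimum is over a nonempty set bounded below by 0 as soon as \<open>N \<ge> 1\<close>;
  for \<open>N = 0\<close> the value is unspecified.\<close>

definition min_energy :: "nat \<Rightarrow> real" where
  "min_energy N =
     (INF c \<in> {c. c \<in> {1..N} \<rightarrow> {0..} \<and> (\<Sum>n=1..N. \<bar>c n\<bar>) = 1}.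
        (real N)^2 * mult_energy N c)"

definition zeta_sum :: "nat \<Rightarrow> real \<Rightarrow> complex" where
  "zeta_sum N t = (\<Sum>n=1..N. of_nat n powr (\<i> * of_real t))"

definition erdos_exponent :: real where
  "erdos_exponent = 1 - (1 + ln (ln 2)) / ln 2"

end

theory Submission
  imports Defs "HOL-Number_Theory.Prime_Powers" "HOL-Combinatorics.Permutations"
begin

text \<open>
  The moment bound is duality. Let \<open>A(t) = \<Sum> c\<^sub>n n\<^bsup>it\<^esup>\<close> with \<open>c \<ge> 0\<close> and \<open>\<Sum> c\<^sub>n = 1\<close>, and
  let \<open>D(t) = \<Sum> n\<^bsup>it\<^esup>\<close>. The mean of \<open>D * cnj A\<close> is at least 1, because against a weight whose
  Fourier transform is nonnegative every off-diagonal term helps. Hoelder's inequality bounds this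
  mean by the \<open>r\<close>-th moment of \<open>D\<close>, its mean square (about \<open>N\<close>) and the fourth moment of \<open>A\<close>,
  which is the multiplicative energy of \<open>c\<close>; the exponents are positive exactly when
  \<open>r < 4/3\<close>. The last two moments are controlled on \<open>[-T, T]\<close> because the frequencies \<open>ln n\<close>,
  \<open>n \<le> N\<^sup>2 \<le> T\<close>, are separated by \<open>1/T\<close> (\<open>weighted_mean_square_le\<close>, \<open>moment_lower_bound\<close>).
  The infimum over \<open>c\<close> then gives the first claim, and \<open>r = 1\<close> gives the second one, once the
  mean is known to exist: \<open>|D|\<close> is a uniform limit of polynomials in the trigonometric sum \<open>|D|\<^sup>2\<close>
  (\<open>ex_mean_norm_dpoly\<close>).

  For the third claim a good \<open>c\<close> is needed. Integers with about \<open>ln ln N / (2 ln 2)\<close> prime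
  factors have density \<open>(ln N)\<^bsup>-\<delta>/2\<^esup>\<close> up to powers of \<open>ln ln N\<close>, and a product \<open>b\<^sub>1 b\<^sub>2\<close> of two of
  them has about \<open>ln ln N / ln 2\<close> prime factors, so that \<open>4\<^bsup>i\<^esup>\<close> splittings of its prime factors
  below the scale \<open>ln p \<approx> 4\<^bsup>i\<^esup>\<close> compete with the probability \<open>4\<^bsup>-i\<^esup>\<close> that a splitting yields factors
  of the right size. The balance holds at all scales only if no \<open>b\<close> has too many small prime
  factors. So cut the primes into blocks \<open>D\<^sub>j\<close> with \<open>ln p \<approx> 4\<^bsup>j\<^esup>\<close> and reciprocal sum exactly
  \<open>2 ln 2\<close> (after weighting, \<open>ex_prime_groups\<close>), and let \<open>c\<close> live on the integers
  \<open>q p\<^sub>1 \<dots> p\<^sub>k\<close>, where at most \<open>i\<close> of the \<open>p\<^sub>m\<close> lie in the first \<open>i\<close> blocks and \<open>q\<close> is a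
  large prime that fills the size up to about \<open>N\<close>.

  Three facts make this work. A cycle lemma says that at least a proportion \<open>1/k\<close> of all block patterns
  satisfies the barrier condition (\<open>card_barrier_maps\<close>), so \<open>c\<close> has large mass. By unique
  factorisation, a coincidence \<open>b\<^sub>1 b\<^sub>2 = b\<^sub>3 b\<^sub>4\<close> permutes the \<open>2k\<close> small primes, and the sizes of
  \<open>b\<^sub>1\<close> and \<open>b\<^sub>3\<close> force two subproducts to agree up to a constant factor
  (\<open>card_equal_products_le\<close>). Finally, freezing all primes but one from the highest block
  \<open>i\<close> that is moved, that one lies in a window of bounded ratio, which costs a factor \<open>4\<^bsup>-i\<^esup>\<close>
  and compensates the at most \<open>2\<^bsup>2(i+1)\<^esup>\<close> choices of the moved positions
  (\<open>sum_balanced_subsets\<close>). With the Stirling bound for \<open>k!\<close> and \<open>k\<close> as large as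
  \<open>p\<^sub>1 \<dots> p\<^sub>k \<le> \<surd>N\<close> permits, the energy is at most
  \<open>(ln N)\<^sup>2 k\<^sup>4 (2 e ln 2)\<^bsup>-2k\<^esup>\<close> up to a constant, where \<open>(2 e ln 2)\<^sup>2 = 4\<^bsup>2 - \<delta>\<^esup>\<close>. The choice of \<open>k\<close> makes \<open>4\<^bsup>k\<^esup>\<close>
  at least of order \<open>ln N / ln ln N\<close>, which gives \<open>(ln N)\<^bsup>\<delta>\<^esup> (ln ln N)\<^bsup>6-\<delta>\<^esup>\<close>. All input on primes is
  Mertens' estimate for \<open>\<Sum> ln p / p\<close>.
\<close>

section \<open>Chebyshev and Mertens bounds from the factorial\<close>

text \<open>Legendre's formula; it is the source of all information about primes below.\<close>

lemma ln_fact_eq_sum_mangoldt: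
  "ln (fact n :: real) = (\<Sum>d=1..n. mangoldt d * real (n div d))"
proof (induction n)
  case (Suc n)
  have "(\<Sum>d=1..Suc n. mangoldt d * real (Suc n div d)) =
        (\<Sum>d=1..Suc n. mangoldt d * real (n div d) + (if d dvd Suc n then mangoldt d else 0))"
    by (intro sum.cong refl) (auto simp: div_Suc mod_eq_0_iff_dvd algebra_simps)
  also have "\<dots> = (\<Sum>d=1..Suc n. mangoldt d * real (n div d))
      + (\<Sum>d=1..Suc n. if d dvd Suc n then mangoldt d else 0)"
    by (rule sum.distrib)
  also have "(\<Sum>d=1..Suc n. mangoldt d * real (n div d)) = ln (fact n)"
    using Suc by simp
  also have "(\<Sum>d=1..Suc n. if d dvd Suc n then mangoldt d else 0) =
      (\<Sum>d | d dvd Suc n. mangoldt d :: real)"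
    by (subst sum.inter_filter [symmetric])
      (auto intro!: sum.cong dest: dvd_imp_le intro: Nat.gr0I simp: Suc_le_eq)
  also have "\<dots> = ln (real (Suc n))"
    by (subst mangoldt_sum) auto
  finally show ?case
    by (simp add: ln_mult)
qed auto

lemma ln_fact_lower: "real n * ln n - n \<le> ln (fact n)"
proof (induction n)
  case (Suc n)
  show ?case
  proof (cases "n = 0")
    case False
    have "ln (real (Suc n)) - ln (real n) = ln (1 + 1 / real n)"
    proof -
      have "1 + 1 / real n = real (Suc n) / real n" using False by (simp add: field_simps)
      then show ?thesis using False by (simp add: ln_div)
    qed
    also have "\<dots> \<le> 1 / real n"
      using False by (intro ln_add_one_self_le_self) auto
    finally have "real n * (ln (real (Suc n)) - ln (real n)) \<le> 1"
      using False by (simp add: field_simps)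
    moreover have "ln (fact (Suc n) :: real) = ln (real (Suc n)) + ln (fact n)"
      by (simp add: ln_mult del: of_nat_Suc)
    ultimately show ?thesis
      using Suc by (simp add: algebra_simps)
  qed auto
qed auto

lemma ln_fact_upper: "ln (fact n :: real) \<le> real n * ln n"
proof -
  have "ln (fact n :: real) \<le> ln (real n ^ n)"
    using fact_le_power[where ?'a = real, of n] by (subst ln_le_cancel_iff) (auto simp: Nat.gr0_conv_Suc intro: Nat.gr0I)
  then show ?thesis
    by (cases "n = 0") (auto simp: ln_realpow)
qed

text \<open>The factor \<open>\<surd>n\<close> has to be exact: \<open>k!\<close> enters the energy squared,
  and a further power of \<open>k\<close>, which is of size \<open>ln ln N\<close>, would exceed
  the sixth power claimed. The induction step is \<open>(n + 1/2) ln (1 + 1/n) \<ge> 1\<close>,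
  that is, \<open>ln ((1 + x) / (1 - x)) \<ge> 2x\<close> at \<open>x = 1 / (2n + 1)\<close>.\<close>

lemma ln_fact_stirling:
  assumes "n \<ge> 1"
  shows "ln (fact n :: real) \<le> 1 + ln n / 2 + real n * ln n - n"
  using assms
proof (induction n rule: nat_induct_at_least)
  case (Suc n)
  have n: "real n > 0" using Suc by simp
  define x where "x = 1 / (2 * real n + 1)"
  have x: "0 < x" "x < 1" using n by (auto simp: x_def)
  have "2 * x \<le> ln ((1 + x) / (1 - x))"
  proof -
    define f where "f = (\<lambda>y::real. ln (1 + y) - ln (1 - y) - 2 * y)"
    have "f 0 \<le> f x"
    proof (rule DERIV_nonneg_imp_nondecreasing[of 0 x])
      fix y assume y: "0 \<le> y" "y \<le> x"
      then have y1: "y < 1" using x by simp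
      have "(f has_real_derivative (1 / (1 + y) + 1 / (1 - y) - 2)) (at y)"
        unfolding f_def using y y1 by (auto intro!: derivative_eq_intros)
      moreover have "1 / (1 + y) + 1 / (1 - y) - 2 = 2 * y\<^sup>2 / ((1 + y) * (1 - y))"
        using y y1 by (simp add: divide_simps) (simp add: algebra_simps power2_eq_square)
      moreover have "2 * y\<^sup>2 / ((1 + y) * (1 - y)) \<ge> 0"
        using y y1 by auto
      ultimately show "\<exists>z. (f has_real_derivative z) (at y) \<and> 0 \<le> z"
        by metis
    qed (use x in auto)
    then show ?thesis
      using x by (simp add: f_def ln_div)
  qed
  also have "(1 + x) / (1 - x) = real (Suc n) / real n"
    using n unfolding x_def by (simp add: divide_simps) (simp add: algebra_simps)?
  also have "ln \<dots> = ln (real (Suc n)) - ln (real n)"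
    using n by (subst ln_div) auto
  finally have "2 \<le> (2 * real n + 1) * (ln (real (Suc n)) - ln (real n))"
    using n by (simp add: x_def field_simps)
  moreover have "ln (fact (Suc n) :: real) = ln (real (Suc n)) + ln (fact n)"
    by (simp add: ln_mult del: of_nat_Suc)
  ultimately show ?case
    using Suc by (simp add: algebra_simps)
qed auto

text \<open>Chebyshev's argument: \<open>\<lfloor>2n/d\<rfloor> - 2\<lfloor>n/d\<rfloor>\<close> is
  nonnegative and equals 1 for \<open>n < d \<le> 2n\<close>, so the sum is at most the logarithm
  of the central binomial coefficient.\<close>

lemma mangoldt_sum_dyadic:
  "(\<Sum>d=Suc n..2*n. mangoldt d :: real) \<le> real n * ln 4"
proof -
  have "(\<Sum>d=Suc n..2*n. mangoldt d :: real) =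
      (\<Sum>d=1..2*n. if d > n then mangoldt d else 0)"
    by (subst sum.inter_filter [symmetric]) (auto intro!: sum.cong)
  also have "\<dots> \<le> (\<Sum>d=1..2*n. mangoldt d * (real (2 * n div d) - 2 * real (n div d)))"
  proof (intro sum_mono)
    fix d assume d: "d \<in> {1..2*n}"
    have "2 * (n div d) \<le> 2 * n div d"
      using d by (subst less_eq_div_iff_mult_less_eq) auto
    then have "2 * real (n div d) \<le> real (2 * n div d)"
      by linarith
    moreover have "1 \<le> 2 * n div d"
      using d by (simp add: Suc_le_eq div_greater_zero_iff)
    ultimately have "(if d > n then 1 else 0) \<le> real (2 * n div d) - 2 * real (n div d)"
      by auto
    from mult_left_mono[OF this mangoldt_nonneg[of d]]
    show "(if d > n then mangoldt d else 0) \<le> mangoldt d * (real (2 * n div d) - 2 * real (n div d))"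
      by (auto split: if_splits)
  qed
  also have "\<dots> = ln (fact (2 * n)) - 2 * (\<Sum>d=1..2*n. mangoldt d * real (n div d))"
    unfolding ln_fact_eq_sum_mangoldt
    by (simp add: algebra_simps sum_subtractf sum_distrib_left)
  also have "(\<Sum>d=1..2*n. mangoldt d * real (n div d)) = (\<Sum>d=1..n. mangoldt d * real (n div d))"
    by (intro sum.mono_neutral_right) auto
  also have "\<dots> = ln (fact n)"
    by (rule ln_fact_eq_sum_mangoldt [symmetric])
  also have "ln (fact (2 * n)) - 2 * ln (fact n) = ln (real (2 * n choose n))"
    by (subst binomial_fact) (auto simp: ln_div ln_mult)
  also have "\<dots> \<le> ln (real (2 ^ (2 * n)))"
    using binomial_le_pow2[of "2*n" n] by (subst ln_le_cancel_iff) (auto simp del: of_nat_power)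
  also have "\<dots> = real n * ln 4"
    by (simp add: power_mult ln_realpow)
  finally show ?thesis .
qed

text \<open>Dyadic summation; the constant 4 leaves room for rounding \<open>n\<close> up to an even number.\<close>

lemma mangoldt_sum_le: "(\<Sum>d=1..n. mangoldt d :: real) \<le> 4 * n"
proof (induction n rule: less_induct)
  case (less n)
  consider "n \<le> 1" | "n = 2" | "n \<ge> 3" by linarith
  then show ?case
  proof cases
    case 1
    then have "n = 0 \<or> n = 1" by auto
    then show ?thesis by auto
  next
    case 2
    have "ln 2 < (1::real)" using ln2_le_25_over_36 by simp
    moreover have "mangoldt 2 = ln (2::real)"
      using mangoldt_prime[of 2, where ?'a = real] by simp
    moreover have "{1..2::nat} = {1,2}" by auto
    ultimately show ?thesis using 2 by simp
  next
    case 3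
    define m where "m = (n + 1) div 2"
    have m: "m < n" "n \<le> 2 * m" "2 * m \<le> n + 1" "m \<ge> 2" using 3 by (auto simp: m_def)
    have "(\<Sum>d=1..n. mangoldt d :: real) \<le> (\<Sum>d=1..2*m. mangoldt d)"
      using m by (intro sum_mono2) (auto simp: mangoldt_nonneg)
    also have "{1..2*m} = {1..m} \<union> {Suc m..2*m}" using m by auto
    also have "(\<Sum>d\<in>\<dots>. mangoldt d :: real) = (\<Sum>d=1..m. mangoldt d) + (\<Sum>d=Suc m..2*m. mangoldt d)"
      by (intro sum.union_disjoint) auto
    also have "\<dots> \<le> 4 * m + real m * ln 4"
      using less[OF m(1)] mangoldt_sum_dyadic[of m] by linarith
    also have "ln 4 = 2 * ln (2::real)"
      using ln_realpow[of 2 2] by simp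
    also have "real (4 * m) + real m * (2 * ln 2) \<le> real (4 * m) + real m * (2 * (25/36))"
      using ln2_le_25_over_36 by (intro add_mono mult_left_mono) auto
    also have "\<dots> \<le> 4 * n" using m by linarith
    finally show ?thesis .
  qed
qed

text \<open>Proper prime powers contribute at most \<open>\<Sum>\<^sub>p 2 ln p / p\<^sup>2\<close>, and
  \<open>ln p \<le> 2\<surd>p\<close>.\<close>

lemma ex_bound_mangoldt_proper_powers:
  "\<exists>C. \<forall>n. (\<Sum>d | d \<in> {1..n} \<and> \<not> prime d. mangoldt d / real d) \<le> C"
proof -
  have summ: "summable (\<lambda>m::nat. 4 * real m powr (-3/2))"
    by (intro summable_mult) (simp add: summable_real_powr_iff)
  show ?thesis
  proof (intro exI allI)
    fix n
    define X where "X = {p \<in> {1..n}. prime p} \<times> {2..n::nat}"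
    have fX: "finite X" by (auto simp: X_def)
    have "(\<Sum>d | d \<in> {1..n} \<and> \<not> prime d. mangoldt d / real d) =
        (\<Sum>d | d \<in> {1..n} \<and> \<not> prime d \<and> primepow d. mangoldt d / real d)"
      by (intro sum.mono_neutral_right) (auto simp: mangoldt_def)
    also have "\<dots> \<le> (\<Sum>d\<in>(\<lambda>(p,k). p ^ k) ` X. mangoldt d / real d)"
    proof (intro sum_mono2)
      show "{d. d \<in> {1..n} \<and> \<not> prime d \<and> primepow d} \<subseteq> (\<lambda>(p, k). p ^ k) ` X"
      proof
        fix d assume "d \<in> {d. d \<in> {1..n} \<and> \<not> prime d \<and> primepow d}"
        then have d: "1 \<le> d" "d \<le> n" "\<not> prime d" "primepow d" by auto
        then obtain p k where pk: "prime p" "k > 0" "d = p ^ k"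
          unfolding primepow_def by auto
        have "k \<noteq> 1" using pk d by auto
        have p2: "p \<ge> 2" using pk(1) by (rule prime_ge_2_nat)
        have "k < 2 ^ k" by (rule less_exp)
        also have "(2::nat) ^ k \<le> p ^ k" using p2 by (rule power_mono) auto
        finally have "k \<le> n" using d pk by auto
        have "p ^ 1 \<le> p ^ k" using pk p2 by (intro power_increasing) auto
        then have "(p, k) \<in> X" using pk d p2 \<open>k \<noteq> 1\<close> \<open>k \<le> n\<close> by (auto simp: X_def)
        then show "d \<in> (\<lambda>(p, k). p ^ k) ` X" using pk by force
      qed
    qed (use fX in \<open>auto simp: mangoldt_nonneg\<close>)
    also have "\<dots> \<le> (\<Sum>x\<in>X. mangoldt (case x of (p,k) \<Rightarrow> p ^ k) / real (case x of (p,k) \<Rightarrow> p ^ k))"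
      using sum_image_le[OF fX, of "\<lambda>d. mangoldt d / real d" "\<lambda>(p,k). p ^ k"]
      by (auto simp: mangoldt_nonneg)
    also have "\<dots> = (\<Sum>x\<in>X. ln (real (fst x)) / real (fst x) ^ (snd x))"
      by (intro sum.cong refl) (auto simp: X_def)
    also have "\<dots> = (\<Sum>p | p \<in> {1..n} \<and> prime p. \<Sum>k=2..n. ln (real p) / real p ^ k)"
      unfolding X_def by (subst sum.cartesian_product) (auto simp: case_prod_unfold)
    also have "\<dots> \<le> (\<Sum>p | p \<in> {1..n} \<and> prime p. 4 * real p powr (-3/2))"
    proof (intro sum_mono)
      fix p assume "p \<in> {p. p \<in> {1..n} \<and> prime p}"
      then have p2: "p \<ge> 2" using prime_ge_2_nat by auto
      have "(\<Sum>k=2..n. (1 / real p) ^ k) \<le> (\<Sum>k. (1 / real p) ^ (k + 2))"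
      proof -
        have "(\<Sum>k=2..n. (1 / real p) ^ k) \<le> (\<Sum>k=0+2..n+2. (1 / real p) ^ k)"
          by (intro sum_mono2) auto
        also have "\<dots> = (\<Sum>k=0..n. (1 / real p) ^ (k + 2))"
          by (rule sum.shift_bounds_cl_nat_ivl)
        also have "\<dots> \<le> (\<Sum>k. (1 / real p) ^ (k + 2))"
          using p2 by (intro sum_le_suminf) (auto simp: summable_iff_shift intro!: summable_geometric)
        finally show ?thesis .
      qed
      also have "\<dots> = (1 / real p)^2 * (1 / (1 - 1 / real p))"
        using p2 by (subst power_add, subst suminf_mult2 [symmetric])
          (auto simp: suminf_geometric intro!: summable_geometric)
      also have "\<dots> \<le> (1 / real p)^2 * 2"
        using p2 by (intro mult_left_mono) (auto simp: field_simps)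
      finally have 1: "(\<Sum>k=2..n. (1 / real p) ^ k) \<le> (1 / real p)^2 * 2" .
      have "ln (real p) = 2 * ln (sqrt (real p))" using p2 by (simp add: ln_sqrt)
      also have "\<dots> \<le> 2 * sqrt (real p)" using p2 less_imp_le[OF ln_less_self[of "sqrt (real p)"]] by (simp del: ln_sqrt ln_less_self)
      finally have 2: "ln (real p) \<le> 2 * real p powr (1/2)" by (simp add: powr_half_sqrt)
      have "(\<Sum>k=2..n. ln (real p) / real p ^ k) = ln (real p) * (\<Sum>k=2..n. (1 / real p) ^ k)"
        by (simp add: sum_distrib_left power_divide)
      also have "\<dots> \<le> (2 * real p powr (1/2)) * ((1 / real p)^2 * 2)"
        using 1 2 p2 by (intro mult_mono) (auto intro!: sum_nonneg)
      also have "(1 / real p)^2 = real p powr (-2)"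
        using p2 by (simp add: powr_minus powr_numeral power_divide inverse_eq_divide)
      also have "2 * real p powr (1/2) * (real p powr (-2) * 2) = 4 * (real p powr (1/2) * real p powr (-2))"
        by simp
      also have "real p powr (1/2) * real p powr (-2) = real p powr (-3/2)"
        by (simp add: powr_add [symmetric])
      finally show "(\<Sum>k=2..n. ln (real p) / real p ^ k) \<le> 4 * real p powr (-3/2)" .
    qed
    also have "\<dots> \<le> (\<Sum>p. 4 * real p powr (-3/2))"
      by (intro sum_le_suminf summ) auto
    finally show "(\<Sum>d | d \<in> {1..n} \<and> \<not> prime d. mangoldt d / real d) \<le> (\<Sum>p. 4 * real p powr (-3/2))" .
  qed
qed

text \<open>Dropping the floors in Legendre's formula costs at most the sum of the Mangoldt function, which
  is linear in \<open>n\<close>, just as the error in \<open>ln n! \<approx> n ln n\<close>;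
  proper prime powers contribute a bounded amount.\<close>

lemma mertens_nat:
  obtains C :: real where "C \<ge> 0"
    "\<And>n::nat. n \<ge> 1 \<Longrightarrow> \<bar>(\<Sum>p | p \<in> {1..n} \<and> prime p. ln (real p) / real p) - ln (real n)\<bar> \<le> C"
proof -
  obtain C0 where C0: "\<And>n. (\<Sum>d | d \<in> {1..n} \<and> \<not> prime d. mangoldt d / real d) \<le> C0"
    using ex_bound_mangoldt_proper_powers by auto
  define A where "A = (\<lambda>n. \<Sum>p | p \<in> {1..n} \<and> prime p. ln (real p) / real p)"
  have main: "\<bar>A n - ln (real n)\<bar> \<le> max 4 (1 + C0)" if n: "n \<ge> 1" for n :: nat
  proof -
    have split: "(\<Sum>d=1..n. g d) = (\<Sum>d | d \<in> {1..n} \<and> prime d. g d) + (\<Sum>d | d \<in> {1..n} \<and> \<not> prime d. g d)"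
      for g :: "nat \<Rightarrow> real"
      by (subst sum.union_disjoint [symmetric]) (auto intro!: sum.cong)
    have "real n * A n = (\<Sum>p | p \<in> {1..n} \<and> prime p. mangoldt p * (real n / real p))"
      by (simp add: A_def sum_distrib_left mult_ac)
    also have "\<dots> \<le> (\<Sum>p | p \<in> {1..n} \<and> prime p. mangoldt p * (real (n div p) + 1))"
    proof (intro sum_mono mult_left_mono mangoldt_nonneg)
      fix p assume "p \<in> {p. p \<in> {1..n} \<and> prime p}"
      then have p: "p > 0" by auto
      have "n \<le> p * (n div p + 1)"
        using dividend_less_times_div[OF p, of n] by simp
      then have "real n \<le> real p * (real (n div p) + 1)"
        by (metis of_nat_1 of_nat_add of_nat_le_iff of_nat_mult)
      then show "real n / real p \<le> real (n div p) + 1"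
        using p by (simp add: field_simps)
    qed
    also have "\<dots> \<le> (\<Sum>p=1..n. mangoldt p * (real (n div p) + 1))"
      by (intro sum_mono2) (auto simp: mangoldt_nonneg)
    also have "\<dots> = ln (fact n) + (\<Sum>p=1..n. mangoldt p)"
      by (simp add: ln_fact_eq_sum_mangoldt ring_distribs sum.distrib)
    also have "\<dots> \<le> real n * ln n + 4 * n"
      using ln_fact_upper[of n] mangoldt_sum_le[of n] by linarith
    finally have "real n * A n \<le> real n * (ln n + 4)" by (simp add: algebra_simps)
    then have 1: "A n \<le> ln n + 4" using n by simp
    have "real n * ln n - n \<le> ln (fact n)" by (rule ln_fact_lower)
    also have "\<dots> \<le> (\<Sum>d=1..n. mangoldt d * (real n / real d))"
      unfolding ln_fact_eq_sum_mangoldt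
      by (intro sum_mono mult_left_mono mangoldt_nonneg) (auto simp: of_nat_div_le_of_nat)
    also have "\<dots> = real n * (\<Sum>d=1..n. mangoldt d / real d)"
      by (simp add: sum_distrib_left mult_ac)
    also have "\<dots> = real n * (A n + (\<Sum>d | d \<in> {1..n} \<and> \<not> prime d. mangoldt d / real d))"
      unfolding split[of "\<lambda>d. mangoldt d / real d"] by (simp add: A_def)
    also have "\<dots> \<le> real n * (A n + C0)"
      using C0[of n] by (intro mult_left_mono) auto
    finally have "real n * (ln n - 1) \<le> real n * (A n + C0)" by (simp add: algebra_simps)
    then have "ln n - 1 \<le> A n + C0" using n by simp
    with 1 show ?thesis by linarith
  qed
  show ?thesis
    by (rule that[of "max 4 (1 + C0)"]) (use main in \<open>auto simp: A_def\<close>)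
qed

section \<open>Primes in intervals and blocks of equal reciprocal weight\<close>

definition primes_in :: "real \<Rightarrow> real \<Rightarrow> nat set" where
  "primes_in x y = {p. prime p \<and> x < real p \<and> real p \<le> y}"

lemma finite_primes_in [simp, intro]: "finite (primes_in x y)"
proof (rule finite_subset)
  show "primes_in x y \<subseteq> {..nat \<lceil>y\<rceil>}" by (auto simp: primes_in_def) linarith
qed auto

text \<open>Every later estimate on primes follows from this property of \<open>C\<close>, which is
  therefore carried through the argument in place of a chosen constant.\<close>

definition mertens_const :: "real \<Rightarrow> bool" where
  "mertens_const C \<longleftrightarrow> C \<ge> 1 \<and>
     (\<forall>x y. 1 \<le> x \<longrightarrow> x \<le> y \<longrightarrow> \<bar>(\<Sum>p\<in>primes_in x y. ln p / p) - ln (y / x)\<bar> \<le> C)"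

lemma ex_mertens_const: "\<exists>C. mertens_const C"
proof -
  obtain C :: real where C: "C \<ge> 0"
    "\<And>n::nat. n \<ge> 1 \<Longrightarrow> \<bar>(\<Sum>p | p \<in> {1..n} \<and> prime p. ln (real p) / real p) - ln (real n)\<bar> \<le> C"
    using mertens_nat by blast
  have "\<bar>(\<Sum>p\<in>primes_in x y. ln p / p) - ln (y / x)\<bar> \<le> 2 * C + 2" if xy: "1 \<le> x" "x \<le> y" for x y
  proof -
    define m n where "m = nat \<lfloor>x\<rfloor>" and "n = nat \<lfloor>y\<rfloor>"
    have mn: "m \<ge> 1" "m \<le> n" using xy by (auto simp: m_def n_def le_nat_iff floor_mono nat_mono)
    have near: "\<bar>ln z - ln (real (nat \<lfloor>z\<rfloor>))\<bar> \<le> 1" if z: "z \<ge> 1" for z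
    proof -
      have 1: "1 \<le> real (nat \<lfloor>z\<rfloor>)" "real (nat \<lfloor>z\<rfloor>) \<le> z" "z \<le> 2 * real (nat \<lfloor>z\<rfloor>)"
      proof -
        have "1 \<le> \<lfloor>z\<rfloor>" using z by simp
        then have *: "real (nat \<lfloor>z\<rfloor>) = of_int \<lfloor>z\<rfloor>" "1 \<le> real_of_int \<lfloor>z\<rfloor>" by simp_all
        show "1 \<le> real (nat \<lfloor>z\<rfloor>)" "real (nat \<lfloor>z\<rfloor>) \<le> z" "z \<le> 2 * real (nat \<lfloor>z\<rfloor>)"
          unfolding *(1) using *(2) by linarith+
      qed
      have "ln (real (nat \<lfloor>z\<rfloor>)) \<le> ln z" using 1 z by (subst ln_le_cancel_iff) auto
      moreover have "ln z \<le> ln (2 * real (nat \<lfloor>z\<rfloor>))" using 1 z by (subst ln_le_cancel_iff) auto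
      moreover have "ln (2 * real (nat \<lfloor>z\<rfloor>)) \<le> 1 + ln (real (nat \<lfloor>z\<rfloor>))"
        using 1 ln2_le_25_over_36 by (subst ln_mult) auto
      ultimately show ?thesis by linarith
    qed
    have eq: "{p. p \<in> {1..n} \<and> prime p} = {p. p \<in> {1..m} \<and> prime p} \<union> primes_in x y"
      using xy unfolding primes_in_def m_def n_def by (auto simp: le_nat_iff le_floor_iff prime_gt_0_nat Suc_le_eq)
    have disj: "{p. p \<in> {1..m} \<and> prime p} \<inter> primes_in x y = {}"
      using xy unfolding primes_in_def m_def by (auto simp: le_nat_iff le_floor_iff)
    have "(\<Sum>p | p \<in> {1..n} \<and> prime p. ln (real p) / real p) =
      (\<Sum>p | p \<in> {1..m} \<and> prime p. ln (real p) / real p) + (\<Sum>p\<in>primes_in x y. ln p / p)"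
      unfolding eq by (intro sum.union_disjoint disj) auto
    moreover have "ln (y / x) = ln y - ln x" using xy by (simp add: ln_div)
    moreover have "1 \<le> n" "1 \<le> y" using mn xy by linarith+
    moreover note C(2)[OF mn(1)] C(2)[OF \<open>1 \<le> n\<close>] near[OF xy(1), folded m_def]
      near[OF \<open>1 \<le> y\<close>, folded n_def]
    ultimately show ?thesis
      unfolding abs_le_iff by linarith
  qed
  then show ?thesis
    unfolding mertens_const_def using C(1) by (intro exI[of _ "2 * C + 2"]) auto
qed

lemma mertens_constD:
  assumes "mertens_const C" "1 \<le> x" "x \<le> y"
  shows "(\<Sum>p\<in>primes_in x y. ln p / p) \<le> ln y - ln x + C"
        "(\<Sum>p\<in>primes_in x y. ln p / p) \<ge> ln y - ln x - C"
proof -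
  have "\<bar>(\<Sum>p\<in>primes_in x y. ln p / p) - ln (y / x)\<bar> \<le> C"
    using assms unfolding mertens_const_def by auto
  moreover have "ln (y / x) = ln y - ln x" using assms by (simp add: ln_div)
  ultimately show "(\<Sum>p\<in>primes_in x y. ln p / p) \<le> ln y - ln x + C"
        "(\<Sum>p\<in>primes_in x y. ln p / p) \<ge> ln y - ln x - C" by linarith+
qed

text \<open>The bound does not depend on \<open>Y\<close>: a window of fixed ratio carries bounded weight
  wherever it lies. The lower end may be below 1, as is the case for quotients of products.\<close>

lemma sum_ln_over_primes_ratio:
  assumes C: "mertens_const C" and Y: "Y > 0" and c: "c \<ge> 1"
  shows "(\<Sum>p\<in>primes_in Y (c * Y). ln p / p) \<le> ln c + C"
proof (cases "Y \<ge> 1")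
  case True
  then show ?thesis
    using mertens_constD(1)[OF C, of Y "c * Y"] c by (auto simp: ln_mult)
next
  case False
  have "(\<Sum>p\<in>primes_in Y (c * Y). ln p / p) \<le> (\<Sum>p\<in>primes_in 1 c. ln p / p)"
  proof (intro sum_mono2)
    show "primes_in Y (c * Y) \<subseteq> primes_in 1 c"
    proof
      fix p assume p: "p \<in> primes_in Y (c * Y)"
      have "c * Y \<le> c * 1" using False c by (intro mult_left_mono) auto
      then show "p \<in> primes_in 1 c" using p using prime_gt_1_nat[of p] by (auto simp: primes_in_def)
    qed
  next
    show "0 \<le> ln (real p) / real p" if "p \<in> primes_in 1 c - primes_in Y (c * Y)" for p
      using that by (auto simp: primes_in_def prime_gt_0_nat Suc_le_eq)
  qed simp
  also have "\<dots> \<le> ln c - ln 1 + C"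
    using c by (intro mertens_constD(1)[OF C]) auto
  finally show ?thesis by simp
qed

text \<open>For this \<open>\<kappa>\<close> the main term \<open>ln (1/\<kappa>)\<close> exceeds the
  Mertens error \<open>C\<close> by 1, so the window contains primes in the expected quantity.\<close>

lemma card_primes_in_lower:
  assumes C: "mertens_const C" and \<kappa>: "\<kappa> = exp (-(C+1))" and x: "\<kappa> * x \<ge> 1"
  shows "real (card (primes_in (\<kappa> * x) x)) \<ge> \<kappa> * x / ln x"
proof -
  have C1: "C \<ge> 1" using C by (simp add: mertens_const_def)
  have k: "0 < \<kappa>" "\<kappa> < 1" using C1 by (auto simp: \<kappa>)
  have x1: "x > 1"
  proof (rule ccontr)
    assume "\<not> x > 1"
    then have "\<kappa> * x \<le> \<kappa> * 1" using k by (intro mult_left_mono) auto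
    then show False using x k by linarith
  qed
  have "1 = ln x - ln (\<kappa> * x) - C" using k x1 by (simp add: ln_mult \<kappa>)
  also have "\<dots> \<le> (\<Sum>p\<in>primes_in (\<kappa> * x) x. ln p / p)"
    using x k x1 by (intro mertens_constD(2)[OF C]) (auto simp: mult_le_cancel_right1)
  also have "\<dots> \<le> (\<Sum>p\<in>primes_in (\<kappa> * x) x. ln x / (\<kappa> * x))"
    using x1 x by (intro sum_mono frac_le) (auto simp: primes_in_def prime_gt_0_nat)
  finally have "1 \<le> real (card (primes_in (\<kappa> * x) x)) * (ln x / (\<kappa> * x))"
    by simp
  then show ?thesis using x x1 k by (simp add: field_simps)
qed

lemma card_primes_in_upper:
  assumes C: "mertens_const C" and \<kappa>: "\<kappa> = exp (-(C+1))" and x: "\<kappa> * x > 1"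
  shows "real (card (primes_in (\<kappa> * x) x)) \<le> (2 * C + 1) * x / ln (\<kappa> * x)"
proof -
  have C1: "C \<ge> 1" using C by (simp add: mertens_const_def)
  have k: "0 < \<kappa>" "\<kappa> < 1" using C1 by (auto simp: \<kappa>)
  have x1: "x > 1"
  proof (rule ccontr)
    assume "\<not> x > 1"
    then have "\<kappa> * x \<le> \<kappa> * 1" using k by (intro mult_left_mono) auto
    then show False using x k by linarith
  qed
  have "real (card (primes_in (\<kappa> * x) x)) * (ln (\<kappa> * x) / x) = (\<Sum>p\<in>primes_in (\<kappa> * x) x. ln (\<kappa> * x) / x)"
    by simp
  also have "\<dots> \<le> (\<Sum>p\<in>primes_in (\<kappa> * x) x. ln p / p)"
    using x1 x by (intro sum_mono frac_le) (auto simp: primes_in_def prime_gt_0_nat intro!: ln_ge_zero)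
  also have "\<dots> \<le> ln x - ln (\<kappa> * x) + C"
    using x k x1 by (intro mertens_constD(1)[OF C]) (auto simp: mult_le_cancel_right1)
  also have "\<dots> = 2 * C + 1" using k x1 by (simp add: ln_mult \<kappa>)
  finally show ?thesis using x x1 by (simp add: field_simps)
qed

text \<open>Partial summation in integral form. Write \<open>1 / ln p = 1 / ln y +
  \<integral>\<^sub>p\<^sup>y dt / (t ln\<^sup>2 t)\<close>, exchange sum and integral, and insert
  the Mertens lower bound for the primes between \<open>x\<close> and \<open>t\<close>; the
  resulting integral has an elementary primitive.\<close>

lemma sum_inverse_primes_lower:
  assumes C: "mertens_const C" and x: "x > 1" "x \<le> y"
  shows "(\<Sum>p\<in>primes_in x y. 1 / real p) \<ge> ln (ln y) - ln (ln x) - C / ln x"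
proof -
  define g where "g = (\<lambda>t::real. 1 / (t * (ln t)\<^sup>2))"
  have lnpos: "ln t > 0" if "t \<ge> x" for t using that x by simp
  have g_int: "(g has_integral (1 / ln a - 1 / ln b)) {a..b}" if "x \<le> a" "a \<le> b" for a b
  proof -
    have "((\<lambda>t. g t) has_integral ((- (1 / ln b)) - (- (1 / ln a)))) {a..b}"
    proof (rule fundamental_theorem_of_calculus[OF that(2)])
      fix t assume t: "t \<in> {a..b}"
      then have "t > 1" "ln t > 0" using that x lnpos[of t] by auto
      then have "((\<lambda>t. - (1 / ln t)) has_real_derivative g t) (at t)"
        unfolding g_def by (auto intro!: derivative_eq_intros simp: power2_eq_square)
      then show "((\<lambda>t. - (1 / ln t)) has_vector_derivative g t) (at t within {a..b})"
        by (auto simp: has_real_derivative_iff_has_vector_derivative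
            intro: has_vector_derivative_at_within)
    qed
    then show ?thesis by simp
  qed
  define h where "h = (\<lambda>t. \<Sum>p\<in>primes_in x y. ln p / p * (if t \<in> {real p..y} then g t else 0))"
  have h_int: "(h has_integral (\<Sum>p\<in>primes_in x y. ln p / p * (1 / ln p - 1 / ln y))) {x..y}"
    unfolding h_def
  proof (intro has_integral_sum has_integral_mult_right)
    fix p assume p: "p \<in> primes_in x y"
    then show "((\<lambda>t. if t \<in> {real p..y} then g t else 0) has_integral 1 / ln p - 1 / ln y) {x..y}"
      using g_int[of p y]
      by (subst has_integral_restrict) (auto simp: primes_in_def)
  qed auto
  have low: "((\<lambda>t. (ln t - ln x - C) * g t) has_integral
      ((ln (ln y) + (ln x + C) / ln y) - (ln (ln x) + (ln x + C) / ln x))) {x..y}"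
  proof (rule fundamental_theorem_of_calculus[OF x(2)])
    fix t assume t: "t \<in> {x..y}"
    then have t1: "t > 1" "ln t > 0" using x lnpos[of t] by auto
    then have "((\<lambda>t. ln (ln t) + (ln x + C) / ln t) has_real_derivative
        (1 / t / ln t - (ln x + C) / (t * (ln t)\<^sup>2))) (at t)"
      by (auto intro!: derivative_eq_intros simp: power2_eq_square)
    also have "1 / t / ln t - (ln x + C) / (t * (ln t)\<^sup>2) = (ln t - ln x - C) * g t"
      using t1 unfolding g_def by (simp add: field_simps power2_eq_square)
    finally show "((\<lambda>t. ln (ln t) + (ln x + C) / ln t) has_vector_derivative (ln t - ln x - C) * g t)
        (at t within {x..y})"
      by (auto simp: has_real_derivative_iff_has_vector_derivative
            intro: has_vector_derivative_at_within)
  qed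
  have "(ln t - ln x - C) * g t \<le> h t" if t: "t \<in> {x..y}" for t
  proof -
    have "h t = (\<Sum>p\<in>primes_in x y. if real p \<le> t then ln p / p * g t else 0)"
      unfolding h_def using t by (intro sum.cong) auto
    also have "\<dots> = (\<Sum>p\<in>primes_in x t. ln p / p * g t)"
      using t finite_primes_in[of x y]
      by (subst sum.inter_filter [symmetric]) (auto intro!: sum.cong simp: primes_in_def)
    also have "\<dots> = (\<Sum>p\<in>primes_in x t. ln p / p) * g t"
      by (simp add: sum_distrib_right)
    also have "\<dots> \<ge> (ln t - ln x - C) * g t"
      using t x by (intro mult_right_mono mertens_constD(2)[OF C]) (auto simp: g_def)
    finally show ?thesis .
  qed
  from has_integral_le[OF low h_int this]
  have 1: "(ln (ln y) + (ln x + C) / ln y) - (ln (ln x) + (ln x + C) / ln x)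
    \<le> (\<Sum>p\<in>primes_in x y. ln p / p * (1 / ln p - 1 / ln y))" by blast
  have "(\<Sum>p\<in>primes_in x y. ln p / p * (1 / ln p - 1 / ln y)) =
      (\<Sum>p\<in>primes_in x y. 1 / p) - (\<Sum>p\<in>primes_in x y. ln p / p) / ln y"
  proof -
    have "ln p / p * (1 / ln p - 1 / ln y) = 1 / p - ln p / p / ln y" if "p \<in> primes_in x y" for p
    proof -
      have "ln (real p) > 0" using that prime_gt_1_nat[of p] by (auto simp: primes_in_def)
      then show ?thesis by (simp add: right_diff_distrib)
    qed
    then show ?thesis by (simp add: sum_subtractf sum_divide_distrib)
  qed
  also have "\<dots> \<le> (\<Sum>p\<in>primes_in x y. 1 / p) - (ln y - ln x - C) / ln y"
    using mertens_constD(2)[OF C, of x y] x lnpos[of y]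
    by (intro diff_left_mono divide_right_mono) auto
  finally have 2: "(ln (ln y) + (ln x + C) / ln y) - (ln (ln x) + (ln x + C) / ln x)
    \<le> (\<Sum>p\<in>primes_in x y. 1 / p) - (ln y - ln x - C) / ln y" using 1 by linarith
  have "(ln x + C) / ln x = 1 + C / ln x" "(ln y - ln x - C) / ln y = 1 - (ln x + C) / ln y"
    using lnpos[of x] lnpos[of y] x by (auto simp: field_simps)
  with 2 show ?thesis by linarith
qed

text \<open>The endpoints are \<open>exp (exp t\<^sub>j)\<close> with \<open>t\<^sub>j = s + 2 j ln 2 -
  2\<^bsup>-j\<^esup>\<close>. The summable correction \<open>2\<^bsup>-j\<^esup>\<close> makes
  every block slightly too heavy, which absorbs the error \<open>C / ln x\<^sub>j\<close> of size
  \<open>4\<^bsup>-j\<^esup>\<close>; the weights \<open>w \<le> 1\<close> then bring the sum down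
  to \<open>2 ln 2\<close> exactly. An exact value matters because it is raised to the power
  \<open>k\<close>.\<close>

lemma ex_prime_groups:
  obtains D :: "nat \<Rightarrow> nat set" and w :: "nat \<Rightarrow> real" and A :: real
  where "A \<ge> 1" "\<And>j. finite (D j)"
    "\<And>j p. p \<in> D j \<Longrightarrow> prime p"
    "\<And>j p. p \<in> D j \<Longrightarrow> 4 ^ j \<le> ln (real p)"
    "\<And>j p. p \<in> D j \<Longrightarrow> ln (real p) \<le> A * 4 ^ j"
    "\<And>i j. i \<noteq> j \<Longrightarrow> D i \<inter> D j = {}"
    "\<And>p. 0 \<le> w p" "\<And>p. w p \<le> 1"
    "\<And>j. (\<Sum>p\<in>D j. w p / real p) = 2 * ln 2"
proof -
  obtain C where C: "mertens_const C" using ex_mertens_const by blast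
  have C1: "C \<ge> 1" using C by (simp add: mertens_const_def)
  \<comment> \<open>this start makes \<open>C / exp (t j) \<le> 4\<^sup>-\<^sup>j / 2\<close> below\<close>
  define s where "s = 1 + ln (2 * C)"
  have s1: "s \<ge> 1" using C1 by (simp add: s_def)
  define t where "t = (\<lambda>j::nat. s + real j * (2 * ln 2) - 1 / 2 ^ j)"
  have tstep: "t (Suc j) = t j + 2 * ln 2 + 1 / 2 ^ Suc j" for j
    by (simp add: t_def algebra_simps)
  have tstep_le: "t j \<le> t (Suc j)" for j
  proof -
    have "0 \<le> 2 * ln (2::real)" "0 \<le> 1 / (2::real) ^ Suc j" by auto
    then show ?thesis unfolding tstep by linarith
  qed
  have tmono: "t i \<le> t j" if "i \<le> j" for i j
    using lift_Suc_mono_le[of t, OF tstep_le that] .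
  have exp4: "exp (real j * (2 * ln 2)) = 4 ^ j" for j
    by (simp add: exp_of_nat_mult exp_double)
  have tlow: "exp (t j) \<ge> 2 * C * 4 ^ j" for j
  proof -
    have "2 * C * 4 ^ j = exp (ln (2 * C) + real j * (2 * ln 2))"
      using C1 by (simp add: exp_add exp4)
    also have "\<dots> \<le> exp (t j)"
      by (simp add: t_def s_def)
    finally show ?thesis .
  qed
  have tup: "exp (t (Suc j)) \<le> 4 * exp s * 4 ^ j" for j
  proof -
    have "exp (t (Suc j)) \<le> exp (s + real (Suc j) * (2 * ln 2))" by (simp add: t_def)
    also have "\<dots> = 4 * exp s * 4 ^ j" by (simp only: exp_add exp4) simp
    finally show ?thesis .
  qed
  define x where "x = (\<lambda>j. exp (exp (t j)))"
  define D where "D = (\<lambda>j. primes_in (x j) (x (Suc j)))"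
  define \<sigma> where "\<sigma> = (\<lambda>j. \<Sum>p\<in>D j. 1 / real p)"
  have \<sigma>: "\<sigma> j \<ge> 2 * ln 2" for j
  proof -
    have "\<sigma> j \<ge> ln (ln (x (Suc j))) - ln (ln (x j)) - C / ln (x j)"
      unfolding \<sigma>_def D_def using tstep_le[of j]
      by (intro sum_inverse_primes_lower C) (auto simp: x_def)
    also have "ln (ln (x (Suc j))) - ln (ln (x j)) - C / ln (x j) = 2 * ln 2 + 1 / 2 ^ Suc j - C / exp (t j)"
      by (simp add: x_def tstep)
    finally have 1: "\<sigma> j \<ge> 2 * ln 2 + 1 / 2 ^ Suc j - C / exp (t j)" .
    have "C / exp (t j) \<le> C / (2 * C * 4 ^ j)"
      using C1 tlow[of j] by (intro divide_left_mono) auto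
    also have "\<dots> = 1 / (2 * 4 ^ j)" using C1 by simp
    also have "\<dots> \<le> 1 / 2 ^ Suc j"
      using power_mono[of "2::real" 4 j] by (simp add: field_simps)
    finally show ?thesis using 1 by linarith
  qed
  have disj: "D i \<inter> D j = {}" if "i < j" for i j
  proof -
    have "x (Suc i) \<le> x j" using tmono[of "Suc i" j] that by (simp add: x_def)
    then show ?thesis by (auto simp: D_def primes_in_def)
  qed
  have disj': "D i \<inter> D j = {}" if "i \<noteq> j" for i j
    using disj[of i j] disj[of j i] that by (cases "i < j") auto
  define w where "w = (\<lambda>p. if \<exists>j. p \<in> D j then 2 * ln 2 / \<sigma> (THE j. p \<in> D j) else 0)"
  have w: "w p = 2 * ln 2 / \<sigma> j" if "p \<in> D j" for p j
  proof -
    have "(THE j. p \<in> D j) = j" using that disj' by (intro the_equality) auto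
    then show ?thesis using that by (auto simp: w_def)
  qed
  have \<sigma>pos: "\<sigma> j > 0" for j
  proof -
    have "0 < 2 * ln (2::real)" by simp
    then show ?thesis using \<sigma>[of j] by linarith
  qed
  show ?thesis
  proof (rule that[of "4 * exp s" D w])
    show "4 * exp s \<ge> 1" proof -
      have "1 \<le> exp s" using s1 by simp
      then show ?thesis by linarith
    qed
    show "finite (D j)" for j by (auto simp: D_def)
    show "prime p" if "p \<in> D j" for p j using that by (auto simp: D_def primes_in_def)
    show "4 ^ j \<le> ln (real p)" if "p \<in> D j" for p j
    proof -
      have "(4::real) ^ j \<le> 2 * C * 4 ^ j" using C1 by simp
      also have "\<dots> \<le> ln (x j)" using tlow[of j] by (simp add: x_def)
      also have "\<dots> \<le> ln (real p)"
        using that by (subst ln_le_cancel_iff) (auto simp: D_def primes_in_def x_def prime_gt_0_nat)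
      finally show ?thesis .
    qed
    show "ln (real p) \<le> 4 * exp s * 4 ^ j" if "p \<in> D j" for p j
    proof -
      have "ln (real p) \<le> ln (x (Suc j))"
        using that by (subst ln_le_cancel_iff) (auto simp: D_def primes_in_def x_def prime_gt_0_nat)
      also have "\<dots> \<le> 4 * exp s * 4 ^ j" using tup[of j] by (simp add: x_def)
      finally show ?thesis .
    qed
    show "D i \<inter> D j = {}" if "i \<noteq> j" for i j by (rule disj'[OF that])
    show "0 \<le> w p" "w p \<le> 1" for p
    proof -
      show "0 \<le> w p"
      proof (cases "\<exists>j. p \<in> D j")
        case True
        then obtain j where j: "p \<in> D j" by blast
        show ?thesis using \<sigma>pos[of j] by (simp add: w[OF j])
      qed (auto simp: w_def)
      show "w p \<le> 1"
      proof (cases "\<exists>j. p \<in> D j")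
        case True
        then obtain j where j: "p \<in> D j" by blast
        show ?thesis using \<sigma>pos[of j] \<sigma>[of j] by (simp add: w[OF j])
      qed (auto simp: w_def)
    qed
    show "(\<Sum>p\<in>D j. w p / real p) = 2 * ln 2" for j
    proof -
      have "(\<Sum>p\<in>D j. w p / real p) = (\<Sum>p\<in>D j. 2 * ln 2 / \<sigma> j * (1 / real p))"
        by (intro sum.cong) (auto simp: w)
      also have "\<dots> = 2 * ln 2 / \<sigma> j * \<sigma> j"
        unfolding \<sigma>_def by (rule sum_distrib_left [symmetric])
      also have "\<dots> = 2 * ln 2" using \<sigma>pos[of j] by simp
      finally show ?thesis .
    qed
  qed
qed

section \<open>Barrier maps and near-balanced subproducts\<close>

text \<open>Block patterns of \<open>k\<close> labelled primes with at most \<open>i\<close> of them in the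
  first \<open>i\<close> blocks, for every \<open>i\<close>. Under the reflection \<open>j
  \<mapsto> k - 1 - j\<close> these are the parking functions.\<close>

definition barrier_maps :: "nat \<Rightarrow> (nat \<Rightarrow> nat) set" where
  "barrier_maps k = {f \<in> {..<k} \<rightarrow>\<^sub>E {..<k}. \<forall>i. card {m \<in> {..<k}. f m < i} \<le> i}"

lemma finite_barrier_maps: "finite (barrier_maps k)"
proof -
  have "finite ({..<k} \<rightarrow>\<^sub>E {..<k})" by (intro finite_PiE) auto
  then show ?thesis unfolding barrier_maps_def by simp
qed

lemma rotation_mod_eq:
  fixes x s k :: nat
  assumes "x < k" "s < k"
  shows "(x + (k - s)) mod k = (if s \<le> x then x - s else x + k - s)"
proof (cases "s \<le> x")
  case True
  then have "x + (k - s) = (x - s) + k" using assms by simp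
  then have "(x + (k - s)) mod k = (x - s) mod k" by (metis mod_add_self2)
  then show ?thesis using True assms by simp
next
  case False
  then show ?thesis using assms by simp
qed

text \<open>A cycle lemma: reading the blocks cyclically from the point where the excess \<open>c i -
  i\<close> of the counting function is largest, every later excess is at most 0.\<close>

lemma ex_rotation_barrier:
  assumes f: "f \<in> {..<k} \<rightarrow>\<^sub>E {..<k}" and k: "k > 0"
  shows "\<exists>s<k. (\<lambda>m\<in>{..<k}. (f m + (k - s)) mod k) \<in> barrier_maps k"
proof -
  define c where "c = (\<lambda>i. card {m \<in> {..<k}. f m < i})"
  have fk: "f m < k" if "m < k" for m using f that by (auto simp: PiE_iff)
  have c0: "c 0 = 0" by (simp add: c_def)
  have ck: "c k = k"
  proof -
    have "{m \<in> {..<k}. f m < k} = {..<k}" using fk by auto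
    then show ?thesis by (simp add: c_def)
  qed
  have split: "card {m \<in> {..<k}. a \<le> f m \<and> f m < b} = c b - c a" "c a \<le> c b" if "a \<le> b" for a b
  proof -
    have eq: "{m \<in> {..<k}. a \<le> f m \<and> f m < b} = {m \<in> {..<k}. f m < b} - {m \<in> {..<k}. f m < a}"
      by auto
    show "card {m \<in> {..<k}. a \<le> f m \<and> f m < b} = c b - c a"
      unfolding c_def eq using that by (intro card_Diff_subset) auto
    show "c a \<le> c b"
      unfolding c_def using that by (intro card_mono) auto
  qed
  define G where "G = (\<lambda>i. int (c i) - int i)"
  obtain s where s: "s \<in> {..<k}" "\<And>i. i \<in> {..<k} \<Longrightarrow> G i \<le> G s"
  proof -
    have ne: "G ` {..<k} \<noteq> {}" using k by (auto simp: lessThan_empty_iff)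
    have "Max (G ` {..<k}) \<in> G ` {..<k}" by (intro Max_in) (use ne in auto)
    then obtain s where "s \<in> {..<k}" "G s = Max (G ` {..<k})" by auto
    then show ?thesis by (intro that[of s]) auto
  qed
  have Gs: "G i \<le> G s" if "i \<le> k" for i
  proof (cases "i = k")
    case True
    then have "G i = G 0" using c0 ck by (simp add: G_def)
    then show ?thesis using s(2)[of 0] k by auto
  qed (use s(2)[of i] that in auto)
  define g where "g = (\<lambda>m\<in>{..<k}. (f m + (k - s)) mod k)"
  have g: "g m = (if s \<le> f m then f m - s else f m + k - s)" if "m < k" for m
    using that fk[OF that] s(1) rotation_mod_eq[of "f m" k s] by (auto simp: g_def)
  have "card {m \<in> {..<k}. g m < i} \<le> i" for i
  proof -
    consider "s + i \<le> k" | "s + i > k" "i \<le> k" | "i > k" by linarith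
    then show ?thesis
    proof cases
      case 1
      have "g m < i \<longleftrightarrow> s \<le> f m \<and> f m < s + i" if "m < k" for m
      proof (cases "s \<le> f m")
        case False
        then have "g m = f m + k - s" using g[OF that] by simp
        then show ?thesis using 1 False by linarith
      qed (use g[OF that] in auto)
      then have "{m \<in> {..<k}. g m < i} = {m \<in> {..<k}. s \<le> f m \<and> f m < s + i}"
        by blast
      then have "card {m \<in> {..<k}. g m < i} = c (s + i) - c s" using split[of s "s + i"] by simp
      moreover have "G (s + i) \<le> G s" using Gs 1 by auto
      ultimately show ?thesis using split(2)[of s "s+i"] by (simp add: G_def)
    next
      case 2
      have "{m \<in> {..<k}. g m < i} \<subseteq> {m \<in> {..<k}. s \<le> f m \<and> f m < k} \<union> {m \<in> {..<k}. 0 \<le> f m \<and> f m < s + i - k}"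
      proof
        fix m assume "m \<in> {m \<in> {..<k}. g m < i}"
        then have m: "m < k" "g m < i" by auto
        show "m \<in> {m \<in> {..<k}. s \<le> f m \<and> f m < k} \<union> {m \<in> {..<k}. 0 \<le> f m \<and> f m < s + i - k}"
        proof (cases "s \<le> f m")
          case False
          then have "f m + k - s < i" using g[OF m(1)] m(2) by simp
          then have "f m < s + i - k" using 2 s(1) by simp
          then show ?thesis using m by simp
        qed (use m fk[OF m(1)] in simp)
      qed
      then have "card {m \<in> {..<k}. g m < i} \<le>
        card ({m \<in> {..<k}. s \<le> f m \<and> f m < k} \<union> {m \<in> {..<k}. 0 \<le> f m \<and> f m < s + i - k})"
        by (intro card_mono) auto
      also have "\<dots> \<le> card {m \<in> {..<k}. s \<le> f m \<and> f m < k} + card {m \<in> {..<k}. 0 \<le> f m \<and> f m < s + i - k}"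
        by (rule card_Un_le)
      also have "\<dots> = (c k - c s) + (c (s + i - k) - c 0)"
        using split(1)[of s k] split(1)[of 0 "s + i - k"] s(1) by simp
      finally have "card {m \<in> {..<k}. g m < i} \<le> (c k - c s) + (c (s + i - k) - c 0)" .
      moreover have "G (s + i - k) \<le> G s" using Gs 2 s(1) by auto
      ultimately show ?thesis using split(2)[of s k] s(1) 2 c0 ck by (simp add: G_def)
    next
      case 3
      have "card {m \<in> {..<k}. g m < i} \<le> card {..<k}" by (intro card_mono) auto
      then show ?thesis using 3 by simp
    qed
  qed
  moreover have "g \<in> {..<k} \<rightarrow>\<^sub>E {..<k}" using k by (auto simp: g_def)
  ultimately have "g \<in> barrier_maps k" by (simp add: barrier_maps_def)
  then show ?thesis using s(1) unfolding g_def by auto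
qed

text \<open>Each of the \<open>k\<^bsup>k\<^esup>\<close> maps is carried into the barrier set by one of
  \<open>k\<close> rotations, and each rotation is injective.\<close>

lemma card_barrier_maps:
  assumes k: "k > 0"
  shows "k ^ k \<le> k * card (barrier_maps k)"
proof -
  define All where "All = {..<k} \<rightarrow>\<^sub>E {..<k}"
  define rot where "rot = (\<lambda>s f. \<lambda>m\<in>{..<k}. (f m + (k - s)) mod k :: nat)"
  have inj: "inj_on (rot s) All" if "s < k" for s
  proof (rule inj_onI)
    fix f g assume fg: "f \<in> All" "g \<in> All" "rot s f = rot s g"
    show "f = g"
    proof (rule PiE_ext[OF fg(1,2)[unfolded All_def]])
      fix m assume m: "m \<in> {..<k}"
      have "f m < k" "g m < k" using fg(1,2) m by (auto simp: All_def PiE_iff)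
      moreover have "(f m + (k - s)) mod k = (g m + (k - s)) mod k"
        using fun_cong[OF fg(3), of m] m by (simp add: rot_def)
      ultimately have "(if s \<le> f m then f m - s else f m + k - s) = (if s \<le> g m then g m - s else g m + k - s)"
        by (simp only: rotation_mod_eq [OF _ that])
      then show "f m = g m"
        using that \<open>f m < k\<close> \<open>g m < k\<close> by (simp split: if_splits)
    qed
  qed
  have fin: "finite All" unfolding All_def by (intro finite_PiE) auto
  have "All \<subseteq> (\<Union>s\<in>{..<k}. {f \<in> All. rot s f \<in> barrier_maps k})"
    using ex_rotation_barrier[OF _ k] unfolding All_def rot_def by blast
  then have "card All \<le> card (\<Union>s\<in>{..<k}. {f \<in> All. rot s f \<in> barrier_maps k})"
    using fin by (intro card_mono) auto
  also have "\<dots> \<le> (\<Sum>s\<in>{..<k}. card {f \<in> All. rot s f \<in> barrier_maps k})"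
    by (rule card_UN_le) auto
  also have "\<dots> \<le> (\<Sum>s\<in>{..<k}. card (barrier_maps k))"
  proof (intro sum_mono)
    fix s assume "s \<in> {..<k}"
    then show "card {f \<in> All. rot s f \<in> barrier_maps k} \<le> card (barrier_maps k)"
      by (intro card_inj_on_le[of "rot s"] finite_barrier_maps inj_on_subset[OF inj]) auto
  qed
  also have "card All = k ^ k" by (simp add: All_def card_funcsetE)
  finally show ?thesis by simp
qed

lemma sum_PiE_insert:
  assumes "x \<notin> A"
  shows "(\<Sum>g\<in>PiE (insert x A) B. h g) = (\<Sum>g\<in>PiE A B. \<Sum>y\<in>B x. h (g(x := y)))"
proof -
  have "(\<Sum>g\<in>PiE (insert x A) B. h g) = (\<Sum>(y, g)\<in>B x \<times> PiE A B. h (g(x := y)))"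
    unfolding PiE_insert_eq using assms
    by (subst sum.reindex) (auto intro!: sum.cong inj_combinator)
  also have "\<dots> = (\<Sum>y\<in>B x. \<Sum>g\<in>PiE A B. h (g(x := y)))"
    by (rule sum.cartesian_product [symmetric])
  also have "\<dots> = (\<Sum>g\<in>PiE A B. \<Sum>y\<in>B x. h (g(x := y)))"
    by (rule sum.swap)
  finally show ?thesis .
qed

text \<open>\<open>P\<close> lists \<open>2k\<close> primes, of which the first \<open>k\<close> form the
  small part of one integer; exchanging them for those indexed by \<open>J\<close> must not change
  the size by more than the factor \<open>1/\<kappa>\<close>.\<close>

definition balanced :: "real \<Rightarrow> nat \<Rightarrow> (nat \<Rightarrow> nat) \<Rightarrow> nat set \<Rightarrow> bool" where
  "balanced \<kappa> k P J \<longleftrightarrow>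
     \<kappa> * (\<Prod>m<k. real (P m)) < (\<Prod>m\<in>J. real (P m)) \<and>
     \<kappa> * (\<Prod>m\<in>J. real (P m)) < (\<Prod>m<k. real (P m))"

text \<open>Once all other coordinates are frozen, the size condition confines the prime at a moved position
  \<open>x\<close> to a window of ratio \<open>1/\<kappa>\<^sup>2\<close>. The factor
  \<open>\<sigma>\<close> of that coordinate is thus replaced by the window bound
  \<open>B\<close>.\<close>

lemma sum_balanced_single:
  fixes v :: "nat \<Rightarrow> real"
  assumes I: "finite I" "J \<subseteq> I" "{..<k} \<subseteq> I"
    and fin: "\<And>m. m \<in> I \<Longrightarrow> finite (E m)"
    and pos: "\<And>m p. m \<in> I \<Longrightarrow> p \<in> E m \<Longrightarrow> p > 0"
    and v: "\<And>p. v p \<ge> 0"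
    and \<sigma>: "\<And>m. m \<in> I \<Longrightarrow> (\<Sum>p\<in>E m. v p) = \<sigma>"
    and \<kappa>: "\<kappa> > 0"
    and x: "x \<in> J - {..<k} \<or> x \<in> {..<k} - J"
    and win: "\<And>Y. Y > 0 \<Longrightarrow> (\<Sum>p | p \<in> E x \<and> Y < real p \<and> real p < Y / \<kappa>\<^sup>2. v p) \<le> B"
  shows "(\<Sum>P\<in>PiE I E. if balanced \<kappa> k P J then \<Prod>m\<in>I. v (P m) else 0) \<le> B * \<sigma> ^ (card I - 1)"
proof -
  define I' where "I' = I - {x}"
  have xI: "x \<in> I" using x I by auto
  have II': "I = insert x I'" "x \<notin> I'" "finite I'" using xI I by (auto simp: I'_def)
  have finx: "finite (E x)" using fin xI by auto
  have "(\<Sum>P\<in>PiE I E. if balanced \<kappa> k P J then \<Prod>m\<in>I. v (P m) else 0) =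
     (\<Sum>P\<in>PiE I' E. \<Sum>p\<in>E x. if balanced \<kappa> k (P(x := p)) J then v p * (\<Prod>m\<in>I'. v (P m)) else 0)"
    unfolding II'(1) sum_PiE_insert[OF II'(2)]
  proof (intro sum.cong refl if_cong)
    fix P p
    have "(\<Prod>m\<in>I'. v ((P(x := p)) m)) = (\<Prod>m\<in>I'. v (P m))"
      using II'(2) by (intro prod.cong) auto
    then show "(\<Prod>m\<in>insert x I'. v ((P(x := p)) m)) = v p * (\<Prod>m\<in>I'. v (P m))"
      using II' by simp
  qed
  also have "\<dots> \<le> (\<Sum>P\<in>PiE I' E. B * (\<Prod>m\<in>I'. v (P m)))"
  proof (intro sum_mono)
    fix P assume P: "P \<in> PiE I' E"
    have Ppos: "real (P m) > 0" if "m \<in> I'" for m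
      using P that pos[of m "P m"] II'(1) by (auto simp: PiE_iff)
    have prodpos: "(\<Prod>m\<in>S. real (P m)) > 0" if "S \<subseteq> I'" for S
      using that Ppos by (intro prod_pos) auto
    have upd: "(\<Prod>m\<in>S. real ((P(x := p)) m)) = (if x \<in> S then p * (\<Prod>m\<in>S - {x}. real (P m)) else (\<Prod>m\<in>S. real (P m)))"
      if "S \<subseteq> I" for S p
    proof (cases "x \<in> S")
      case True
      have fS: "finite S" using that I finite_subset by blast
      have "(\<Prod>m\<in>S. real ((P(x := p)) m)) = real p * (\<Prod>m\<in>S - {x}. real ((P(x := p)) m))"
        using True fS by (subst prod.remove[of _ x]) auto
      also have "(\<Prod>m\<in>S - {x}. real ((P(x := p)) m)) = (\<Prod>m\<in>S - {x}. real (P m))"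
        by (intro prod.cong) auto
      finally show ?thesis using True by simp
    next
      case False
      then show ?thesis by (auto intro!: prod.cong)
    qed
    have "\<exists>Y>0. \<forall>p. balanced \<kappa> k (P(x := p)) J \<longrightarrow> Y < real p \<and> real p < Y / \<kappa>\<^sup>2"
    proof (cases "x \<in> J")
      case True
      define X Z where "X = (\<Prod>m\<in>J - {x}. real (P m))" and "Z = (\<Prod>m<k. real (P m))"
      have "X > 0" "Z > 0" using x True I unfolding X_def Z_def by (auto intro!: prodpos simp: I'_def)
      moreover have "balanced \<kappa> k (P(x := p)) J \<longleftrightarrow> \<kappa> * Z < p * X \<and> \<kappa> * (p * X) < Z" for p
        unfolding balanced_def upd[OF I(2)] upd[OF I(3)] using True x by (auto simp: X_def Z_def)
      ultimately show ?thesis using \<kappa>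
        by (intro exI[of _ "\<kappa> * Z / X"]) (auto simp: field_simps power2_eq_square)
    next
      case False
      define X Z where "X = (\<Prod>m\<in>J. real (P m))" and "Z = (\<Prod>m\<in>{..<k} - {x}. real (P m))"
      have "X > 0" "Z > 0" using x False I unfolding X_def Z_def by (auto intro!: prodpos simp: I'_def)
      moreover have "balanced \<kappa> k (P(x := p)) J \<longleftrightarrow> \<kappa> * (p * Z) < X \<and> \<kappa> * X < p * Z" for p
        unfolding balanced_def upd[OF I(2)] upd[OF I(3)] using False x by (auto simp: X_def Z_def)
      ultimately show ?thesis using \<kappa>
        by (intro exI[of _ "\<kappa> * X / Z"]) (auto simp: field_simps power2_eq_square)
    qed
    then obtain Y where Y: "Y > 0" "\<And>p. balanced \<kappa> k (P(x := p)) J \<Longrightarrow> Y < real p \<and> real p < Y / \<kappa>\<^sup>2"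
      by blast
    have "(\<Sum>p\<in>E x. if balanced \<kappa> k (P(x := p)) J then v p * (\<Prod>m\<in>I'. v (P m)) else 0) \<le>
      (\<Sum>p\<in>E x. if Y < real p \<and> real p < Y / \<kappa>\<^sup>2 then v p * (\<Prod>m\<in>I'. v (P m)) else 0)"
      using Y(2) v by (intro sum_mono) (auto intro!: mult_nonneg_nonneg prod_nonneg)
    also have "\<dots> = (\<Sum>p | p \<in> E x \<and> Y < real p \<and> real p < Y / \<kappa>\<^sup>2. v p) * (\<Prod>m\<in>I'. v (P m))"
      using finx by (simp add: sum.inter_filter [symmetric] sum_distrib_right)
    also have "\<dots> \<le> B * (\<Prod>m\<in>I'. v (P m))"
      using win[OF Y(1)] v by (intro mult_right_mono prod_nonneg) auto
    finally show "(\<Sum>p\<in>E x. if balanced \<kappa> k (P(x := p)) J then v p * (\<Prod>m\<in>I'. v (P m)) else 0)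
       \<le> B * (\<Prod>m\<in>I'. v (P m))" .
  qed
  also have "\<dots> = B * (\<Prod>m\<in>I'. \<Sum>p\<in>E m. v p)"
    using fin II' by (subst prod_sum_PiE) (auto simp: sum_distrib_left)
  also have "(\<Prod>m\<in>I'. \<Sum>p\<in>E m. v p) = \<sigma> ^ card I'"
    using \<sigma> II' by simp
  also have "card I' = card I - 1" using xI I by (simp add: I'_def)
  finally show ?thesis .
qed

text \<open>For \<open>J \<noteq> {..<k}\<close> let \<open>x\<close> be a position in the symmetric
  difference with the highest block \<open>f x\<close>. The window at \<open>x\<close> contributes
  \<open>4\<^bsup>-f x\<^esup>\<close>, while the symmetric difference is one of the subsets of
  \<open>{m. f m \<le> f x}\<close>, of which there are at most \<open>2\<^bsup>2(f x +
  1)\<^esup>\<close> by the barrier condition. The product is bounded, so only the choice of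
  \<open>x\<close> costs a factor \<open>2k\<close>.\<close>

lemma sum_balanced_subsets:
  fixes v :: "nat \<Rightarrow> real"
  assumes finD: "\<And>j. finite (D j)"
    and pos: "\<And>j p. p \<in> D j \<Longrightarrow> p > 0"
    and v: "\<And>p. v p \<ge> 0"
    and \<sigma>: "\<And>j. (\<Sum>p\<in>D j. v p) = \<sigma>"
    and \<kappa>: "\<kappa> > 0"
    and B: "B \<ge> 0"
    and win: "\<And>j Y. Y > 0 \<Longrightarrow> (\<Sum>p | p \<in> D j \<and> Y < real p \<and> real p < Y / \<kappa>\<^sup>2. v p) \<le> B / 4 ^ j"
    and f: "\<And>i. card {m \<in> {..<2*k}. f m \<le> i} \<le> 2 * (i + 1)"
  shows "(\<Sum>P\<in>PiE {..<2*k} (\<lambda>m. D (f m)). real (card {J. J \<subseteq> {..<2*k} \<and> card J = k \<and> balanced \<kappa> k P J})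
            * (\<Prod>m<2*k. v (P m))) \<le> \<sigma> ^ (2*k) + 8 * real k * B * \<sigma> ^ (2*k - 1)"
proof -
  define I where "I = {..<2*k}"
  define A where "A = {..<k}"
  define \<J> where "\<J> = {J. J \<subseteq> I \<and> card J = k}"
  define E where "E = (\<lambda>m. D (f m))"
  have finI: "finite I" and AI: "A \<subseteq> I" and cI: "card I = 2 * k" by (auto simp: I_def A_def)
  have fin\<J>: "finite \<J>" using finI unfolding \<J>_def by auto
  have AJ: "A \<in> \<J>" using AI by (auto simp: \<J>_def A_def)
  have \<sigma>0: "\<sigma> \<ge> 0" using \<sigma>[of 0] v by (metis sum_nonneg)
  define w where "w = (\<lambda>P. \<Prod>m\<in>I. v (P m))"
  define T where "T = (\<lambda>J. \<Sum>P\<in>PiE I E. if balanced \<kappa> k P J then w P else 0)"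
  have w0: "w P \<ge> 0" for P unfolding w_def using v by (intro prod_nonneg) auto
  have "(\<Sum>P\<in>PiE I E. real (card {J. J \<subseteq> I \<and> card J = k \<and> balanced \<kappa> k P J}) * w P) =
        (\<Sum>P\<in>PiE I E. \<Sum>J\<in>\<J>. if balanced \<kappa> k P J then w P else 0)"
  proof (intro sum.cong refl)
    fix P
    have "{J. J \<subseteq> I \<and> card J = k \<and> balanced \<kappa> k P J} = {J \<in> \<J>. balanced \<kappa> k P J}"
      by (auto simp: \<J>_def)
    then show "real (card {J. J \<subseteq> I \<and> card J = k \<and> balanced \<kappa> k P J}) * w P =
      (\<Sum>J\<in>\<J>. if balanced \<kappa> k P J then w P else 0)"
      using fin\<J> by (simp add: sum.inter_filter [symmetric])
  qed
  also have "\<dots> = (\<Sum>J\<in>\<J>. T J)" unfolding T_def by (rule sum.swap)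
  also have "\<dots> = T A + (\<Sum>J\<in>\<J> - {A}. T J)" using fin\<J> AJ by (rule sum.remove)
  also have "T A \<le> \<sigma> ^ (2*k)"
  proof -
    have "T A \<le> (\<Sum>P\<in>PiE I E. w P)"
      unfolding T_def using w0 by (intro sum_mono) auto
    also have "\<dots> = (\<Prod>m\<in>I. \<Sum>p\<in>E m. v p)"
      unfolding w_def using finI finD by (subst prod_sum_PiE) (auto simp: E_def)
    also have "\<dots> = \<sigma> ^ (2 * k)" using \<sigma> cI by (simp add: E_def)
    finally show ?thesis .
  qed
  also have "(\<Sum>J\<in>\<J> - {A}. T J) \<le> (\<Sum>J\<in>\<J> - {A}. \<Sum>x\<in>I.
      if x \<in> sym_diff J A \<and> sym_diff J A \<subseteq> {m\<in>I. f m \<le> f x} then B / 4 ^ f x * \<sigma> ^ (2*k - 1) else 0)"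
  proof (intro sum_mono)
    fix J assume J: "J \<in> \<J> - {A}"
    define S where "S = sym_diff J A"
    have S: "S \<noteq> {}" "S \<subseteq> I" "finite S" using J AI finI finite_subset[of S I]
      by (auto simp: S_def \<J>_def)
    obtain x where x: "x \<in> S" "\<And>y. y \<in> S \<Longrightarrow> f y \<le> f x"
    proof -
      have "Max (f ` S) \<in> f ` S" using S by (intro Max_in) auto
      then obtain x where "x \<in> S" "f x = Max (f ` S)" by auto
      then show ?thesis using S by (intro that[of x]) auto
    qed
    have "T J \<le> B / 4 ^ f x * \<sigma> ^ (card I - 1)"
      unfolding T_def w_def
    proof (rule sum_balanced_single)
      show "x \<in> J - {..<k} \<or> x \<in> {..<k} - J" using x(1) by (auto simp: S_def A_def)
      show "J \<subseteq> I" using J by (auto simp: \<J>_def)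
      show "{..<k} \<subseteq> I" using AI by (simp add: A_def)
    qed (use finI finD pos v \<sigma> \<kappa> win in \<open>auto simp: E_def\<close>)
    also have "\<dots> = (if x \<in> sym_diff J A \<and> sym_diff J A \<subseteq> {m\<in>I. f m \<le> f x} then B / 4 ^ f x * \<sigma> ^ (2*k - 1) else 0)"
      using x S by (auto simp: S_def cI)
    also have "\<dots> \<le> (\<Sum>x\<in>I. if x \<in> sym_diff J A \<and> sym_diff J A \<subseteq> {m\<in>I. f m \<le> f x} then B / 4 ^ f x * \<sigma> ^ (2*k - 1) else 0)"
      using x(1) S finI B \<sigma>0 by (intro member_le_sum) auto
    finally show "T J \<le> (\<Sum>x\<in>I. if x \<in> sym_diff J A \<and> sym_diff J A \<subseteq> {m\<in>I. f m \<le> f x} then B / 4 ^ f x * \<sigma> ^ (2*k - 1) else 0)" .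
  qed
  also have "\<dots> = (\<Sum>x\<in>I. \<Sum>J\<in>\<J> - {A}.
      if x \<in> sym_diff J A \<and> sym_diff J A \<subseteq> {m\<in>I. f m \<le> f x} then B / 4 ^ f x * \<sigma> ^ (2*k - 1) else 0)"
    by (rule sum.swap)
  also have "\<dots> \<le> (\<Sum>x\<in>I. 4 * B * \<sigma> ^ (2*k - 1))"
  proof (intro sum_mono)
    fix x assume x: "x \<in> I"
    define U where "U = {m\<in>I. f m \<le> f x}"
    have finU: "finite U" using finI by (auto simp: U_def)
    have "card {J \<in> \<J> - {A}. x \<in> sym_diff J A \<and> sym_diff J A \<subseteq> U} \<le> card (Pow U)"
    proof (rule card_inj_on_le[of "\<lambda>J. sym_diff J A"])
      show "inj_on (\<lambda>J. sym_diff J A) {J \<in> \<J> - {A}. x \<in> sym_diff J A \<and> sym_diff J A \<subseteq> U}"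
        by (rule inj_onI) blast
    qed (use finU in auto)
    also have "\<dots> = 2 ^ card U" using finU by (rule card_Pow)
    also have "\<dots> \<le> 2 ^ (2 * (f x + 1))"
      using f[of "f x"] unfolding U_def I_def by (intro power_increasing) auto
    also have "\<dots> = 4 * 4 ^ f x" by (simp add: power_mult power_add)
    finally have c: "real (card {J \<in> \<J> - {A}. x \<in> sym_diff J A \<and> sym_diff J A \<subseteq> U}) \<le> real (4 * 4 ^ f x)"
      by (subst of_nat_le_iff)
    have "(\<Sum>J\<in>\<J> - {A}. if x \<in> sym_diff J A \<and> sym_diff J A \<subseteq> U then B / 4 ^ f x * \<sigma> ^ (2*k - 1) else 0) =
       real (card {J \<in> \<J> - {A}. x \<in> sym_diff J A \<and> sym_diff J A \<subseteq> U}) * (B / 4 ^ f x * \<sigma> ^ (2*k - 1))"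
      using fin\<J> by (simp add: sum.inter_filter [symmetric])
    also have "\<dots> \<le> real (4 * 4 ^ f x) * (B / 4 ^ f x * \<sigma> ^ (2*k - 1))"
      using B \<sigma>0 by (intro mult_right_mono c) auto
    also have "\<dots> = 4 * B * \<sigma> ^ (2*k - 1)" by simp
    finally show "(\<Sum>J\<in>\<J> - {A}. if x \<in> sym_diff J A \<and> sym_diff J A \<subseteq> {m\<in>I. f m \<le> f x} then B / 4 ^ f x * \<sigma> ^ (2*k - 1) else 0)
      \<le> 4 * B * \<sigma> ^ (2*k - 1)" unfolding U_def .
  qed
  also have "\<dots> = 8 * real k * B * \<sigma> ^ (2*k - 1)" by (simp add: cI)
  finally show ?thesis unfolding I_def E_def w_def by simp
qed

text \<open>Such a permutation is determined by its restrictions to \<open>A\<close> and to the complement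
  of \<open>A\<close>.\<close>

lemma card_permutes_image_le:
  assumes "finite I" "A \<subseteq> I" "card I = 2 * k" "card A = k"
  shows "card {\<pi>. \<pi> permutes I \<and> \<pi> ` A = J} \<le> (fact k)\<^sup>2"
proof (cases "card J = k \<and> J \<subseteq> I")
  case False
  have "{\<pi>. \<pi> permutes I \<and> \<pi> ` A = J} = {}"
  proof -
    have "card (\<pi> ` A) = k \<and> \<pi> ` A \<subseteq> I" if "\<pi> permutes I" for \<pi>
      using that assms permutes_inj_on[OF that, of A] permutes_image[OF that] by (auto simp: card_image)
    then show ?thesis using False by auto
  qed
  then show ?thesis by (metis card.empty le0)
next
  case True
  have finA: "finite A" "finite J" using assms True finite_subset by auto
  define M where "M = (\<lambda>X Y. {g \<in> X \<rightarrow>\<^sub>E Y. inj_on g X} :: ('a \<Rightarrow> 'a) set)"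
  have cM: "card (M X Y) = fact k" "finite (M X Y)" if "finite X" "finite Y" "card X = k" "card Y = k" for X Y
  proof -
    have "card (M X Y) = prod ((-) k) {0..<k}"
      unfolding M_def using card_inj_on_subset_funcset[of X Y X] that by simp
    then show "card (M X Y) = fact k" by (simp add: fact_prod_rev)
    show "finite (M X Y)" unfolding M_def using that finite_PiE[of X "\<lambda>_. Y"] by simp
  qed
  have c1: "card (M A J) = fact k" "finite (M A J)" using cM finA True assms by auto
  have c2: "card (M (I - A) (I - J)) = fact k" "finite (M (I - A) (I - J))"
    using cM[of "I - A" "I - J"] finA True assms by (auto simp: card_Diff_subset)
  have "card {\<pi>. \<pi> permutes I \<and> \<pi> ` A = J} \<le> card (M A J \<times> M (I - A) (I - J))"
  proof (rule card_inj_on_le[of "\<lambda>\<pi>. (restrict \<pi> A, restrict \<pi> (I - A))"])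
    show "inj_on (\<lambda>\<pi>. (restrict \<pi> A, restrict \<pi> (I - A))) {\<pi>. \<pi> permutes I \<and> \<pi> ` A = J}"
    proof (rule inj_onI)
      fix \<pi> \<rho> assume \<pi>: "\<pi> \<in> {\<pi>. \<pi> permutes I \<and> \<pi> ` A = J}" and \<rho>: "\<rho> \<in> {\<pi>. \<pi> permutes I \<and> \<pi> ` A = J}"
        and eq: "(restrict \<pi> A, restrict \<pi> (I - A)) = (restrict \<rho> A, restrict \<rho> (I - A))"
      have "\<pi> x = \<rho> x" for x
      proof -
        have "restrict \<pi> A x = restrict \<rho> A x" "restrict \<pi> (I - A) x = restrict \<rho> (I - A) x" using eq by auto
        then show ?thesis using \<pi> \<rho>
          by (cases "x \<in> A"; cases "x \<in> I") (auto simp: permutes_not_in)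
      qed
      then show "\<pi> = \<rho>" by auto
    qed
    show "(\<lambda>\<pi>. (restrict \<pi> A, restrict \<pi> (I - A))) ` {\<pi>. \<pi> permutes I \<and> \<pi> ` A = J} \<subseteq> M A J \<times> M (I - A) (I - J)"
    proof safe
      fix \<pi> assume \<pi>: "\<pi> permutes I" "J = \<pi> ` A"
      have inj: "inj \<pi>" using \<pi> by (simp add: permutes_inj)
      show "restrict \<pi> A \<in> M A (\<pi> ` A)" using inj by (auto simp: M_def inj_on_def)
      show "restrict \<pi> (I - A) \<in> M (I - A) (I - \<pi> ` A)"
        using inj permutes_in_image[OF \<pi>(1)] by (auto simp: M_def inj_on_def inj_def)
    qed
  qed (use c1 c2 in auto)
  also have "\<dots> = (fact k)\<^sup>2" by (simp add: card_cartesian_product c1 c2 power2_eq_square)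
  finally show ?thesis .
qed

section \<open>Energy of push-forward weights and unique factorisation\<close>

lemma mult_energy_nonneg: "mult_energy N c \<ge> 0"
  unfolding mult_energy_def by (intro sum_nonneg) auto

lemma min_energy_le:
  assumes "c \<in> {1..N} \<rightarrow> {0..}" "(\<Sum>n=1..N. c n) = 1"
  shows "min_energy N \<le> (real N)\<^sup>2 * mult_energy N c"
  unfolding min_energy_def
proof (rule cINF_lower)
  show "bdd_below ((\<lambda>c. (real N)\<^sup>2 * mult_energy N c) ` {c. c \<in> {1..N} \<rightarrow> {0..} \<and> (\<Sum>n = 1..N. \<bar>c n\<bar>) = 1})"
    by (intro bdd_belowI[of _ 0]) (auto simp: mult_energy_nonneg)
  have "(\<Sum>n = 1..N. \<bar>c n\<bar>) = (\<Sum>n = 1..N. c n)"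
    using assms(1) by (intro sum.cong) (auto simp: Pi_iff)
  then show "c \<in> {c. c \<in> {1..N} \<rightarrow> {0..} \<and> (\<Sum>n = 1..N. \<bar>c n\<bar>) = 1}" using assms by auto
qed

text \<open>Working with weights on a set \<open>X\<close> of representations allows one integer to be
  represented by many tuples. The energy counts pairs of pairs with equal products.\<close>

lemma mult_energy_pushforward:
  fixes wt :: "'a \<Rightarrow> real" and val :: "'a \<Rightarrow> nat"
  assumes X: "finite X" "\<And>x. x \<in> X \<Longrightarrow> val x \<in> {1..N}"
  shows "mult_energy N (\<lambda>n. \<Sum>x | x \<in> X \<and> val x = n. wt x) =
    (\<Sum>u\<in>X\<times>X. \<Sum>v | v \<in> X \<times> X \<and> val (fst v) * val (snd v) = val (fst u) * val (snd u).
        (wt (fst u) * wt (snd u)) * (wt (fst v) * wt (snd v)))"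
proof -
  define c where "c = (\<lambda>n. \<Sum>x | x \<in> X \<and> val x = n. wt x)"
  define M where "M = (\<lambda>u. val (fst u) * val (snd u))"
  define W where "W = (\<lambda>u. wt (fst u) * wt (snd u))"
  define r where "r = (\<lambda>n. \<Sum>u | u \<in> X \<times> X \<and> M u = n. W u)"
  have finXX: "finite (X \<times> X)" using X by auto
  have MN: "M u \<in> {1..N^2}" if "u \<in> X \<times> X" for u
    using X(2)[of "fst u"] X(2)[of "snd u"] that
    by (auto simp: M_def power2_eq_square intro!: mult_le_mono)
  have inner: "(\<Sum>(d, t) \<in> {(d, t) \<in> {1..N} \<times> {1..N}. d * t = n}. c d * c t) = r n" for n
  proof -
    define DT where "DT = {(d, t) \<in> {1..N} \<times> {1..N}. d * t = n}"
    have finDT: "finite DT" by (rule finite_subset[of _ "{1..N} \<times> {1..N}"]) (auto simp: DT_def)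
    define g where "g = (\<lambda>u. (val (fst u), val (snd u)))"
    have "(\<Sum>(d, t) \<in> DT. c d * c t) = (\<Sum>y\<in>DT. \<Sum>u | u \<in> {u \<in> X \<times> X. M u = n} \<and> g u = y. W u)"
    proof (intro sum.cong refl)
      fix y assume y: "y \<in> DT"
      obtain d t where [simp]: "y = (d, t)" by (cases y)
      have "{u. u \<in> {u \<in> X \<times> X. M u = n} \<and> g u = y} = {x \<in> X. val x = d} \<times> {x \<in> X. val x = t}"
        using y by (auto simp: DT_def M_def g_def)
      moreover have "c d * c t = (\<Sum>u\<in>{x \<in> X. val x = d} \<times> {x \<in> X. val x = t}. W u)"
        by (simp add: c_def W_def sum_product sum.cartesian_product case_prod_unfold)
      ultimately show "(case y of (d, t) \<Rightarrow> c d * c t) = (\<Sum>u | u \<in> {u \<in> X \<times> X. M u = n} \<and> g u = y. W u)"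
        by simp
    qed
    also have "\<dots> = (\<Sum>u\<in>{u \<in> X \<times> X. M u = n}. W u)"
      by (intro sum.group) (use finXX finDT X(2) in \<open>auto simp: DT_def g_def M_def\<close>)
    finally show ?thesis by (simp add: DT_def r_def)
  qed
  have "mult_energy N c = (\<Sum>n=1..N^2. (r n)\<^sup>2)"
    unfolding mult_energy_def inner ..
  also have "\<dots> = (\<Sum>n=1..N^2. \<Sum>u | u \<in> X \<times> X \<and> M u = n. W u * r (M u))"
    by (intro sum.cong refl) (auto simp: r_def power2_eq_square sum_distrib_right)
  also have "\<dots> = (\<Sum>u\<in>X\<times>X. W u * r (M u))"
    by (intro sum.group) (use finXX MN in auto)
  also have "\<dots> = (\<Sum>u\<in>X\<times>X. \<Sum>v | v \<in> X \<times> X \<and> M v = M u. W u * W v)"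
    by (simp add: r_def sum_distrib_left)
  finally show ?thesis by (simp add: c_def M_def W_def)
qed

text \<open>Normalising the mass to 1 produces the fourth power. Since \<open>wt \<le> 1\<close>, the weight
  of the second pair is discarded and only the number of coincidences matters.\<close>

lemma min_energy_le_count:
  fixes wt :: "'a \<Rightarrow> real" and val :: "'a \<Rightarrow> nat"
  assumes X: "finite X" "\<And>x. x \<in> X \<Longrightarrow> val x \<in> {1..N}"
    and wt: "\<And>x. x \<in> X \<Longrightarrow> 0 \<le> wt x" "\<And>x. x \<in> X \<Longrightarrow> wt x \<le> 1"
    and Z: "0 < (\<Sum>x\<in>X. wt x)"
    and B: "\<And>x y. x \<in> X \<Longrightarrow> y \<in> X \<Longrightarrow>
       real (card {v \<in> X \<times> X. val (fst v) * val (snd v) = val x * val y}) \<le> B x y"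
  shows "min_energy N * (\<Sum>x\<in>X. wt x) ^ 4 \<le> (real N)\<^sup>2 * (\<Sum>x\<in>X. \<Sum>y\<in>X. wt x * wt y * B x y)"
proof -
  define Z where "Z = (\<Sum>x\<in>X. wt x)"
  have Zpos: "Z > 0" using Z by (simp add: Z_def)
  define c where "c = (\<lambda>n. \<Sum>x | x \<in> X \<and> val x = n. wt x)"
  define c' where "c' = (\<lambda>n. \<Sum>x | x \<in> X \<and> val x = n. wt x / Z)"
  have "(\<Sum>n=1..N. c' n) = (\<Sum>x\<in>X. wt x / Z)"
    unfolding c'_def using X by (intro sum.group) auto
  also have "\<dots> = 1" using Zpos by (simp add: sum_divide_distrib [symmetric] Z_def)
  finally have "min_energy N \<le> (real N)\<^sup>2 * mult_energy N c'"
    using wt Zpos by (intro min_energy_le) (auto simp: c'_def intro!: sum_nonneg divide_nonneg_pos)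
  also have "mult_energy N c' = (\<Sum>u\<in>X\<times>X. \<Sum>v | v \<in> X \<times> X \<and> val (fst v) * val (snd v) = val (fst u) * val (snd u).
        (wt (fst u) * wt (snd u)) * (wt (fst v) * wt (snd v))) / Z ^ 4"
    unfolding c'_def by (subst mult_energy_pushforward[OF X]) 
      (auto simp: sum_divide_distrib power4_eq_xxxx algebra_simps)
  also have "(\<Sum>u\<in>X\<times>X. \<Sum>v | v \<in> X \<times> X \<and> val (fst v) * val (snd v) = val (fst u) * val (snd u).
        (wt (fst u) * wt (snd u)) * (wt (fst v) * wt (snd v)))
    \<le> (\<Sum>u\<in>X\<times>X. wt (fst u) * wt (snd u) * B (fst u) (snd u))"
  proof (intro sum_mono)
    fix u assume u: "u \<in> X \<times> X"
    define V where "V = {v. v \<in> X \<times> X \<and> val (fst v) * val (snd v) = val (fst u) * val (snd u)}"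
    have wu: "wt (fst u) * wt (snd u) \<ge> 0" using u wt by auto
    have "(\<Sum>v\<in>V. (wt (fst u) * wt (snd u)) * (wt (fst v) * wt (snd v))) \<le> (\<Sum>v\<in>V. (wt (fst u) * wt (snd u)) * (1 * 1))"
      using wt wu by (intro sum_mono mult_left_mono mult_mono) (auto simp: V_def)
    also have "\<dots> = (wt (fst u) * wt (snd u)) * real (card V)" by simp
    also have "\<dots> \<le> wt (fst u) * wt (snd u) * B (fst u) (snd u)"
      using wu B[of "fst u" "snd u"] u unfolding V_def by (intro mult_left_mono) auto
    finally show "(\<Sum>v\<in>V. (wt (fst u) * wt (snd u)) * (wt (fst v) * wt (snd v))) \<le> wt (fst u) * wt (snd u) * B (fst u) (snd u)" .
  qed
  also have "\<dots> = (\<Sum>x\<in>X. \<Sum>y\<in>X. wt x * wt y * B x y)"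
    by (simp add: sum.cartesian_product case_prod_unfold)
  finally have "min_energy N \<le> (real N)\<^sup>2 * ((\<Sum>x\<in>X. \<Sum>y\<in>X. wt x * wt y * B x y) / Z ^ 4)"
    by (simp add: mult_left_mono divide_right_mono)
  then show ?thesis using Zpos by (simp add: field_simps Z_def)
qed

text \<open>Pairs of \<open>k\<close>-tuples are treated as \<open>2k\<close>-tuples, on which permutations
  act. The value outside \<open>{..<2*k}\<close> keeps the result extensional.\<close>

definition cat :: "nat \<Rightarrow> (nat \<Rightarrow> 'a) \<Rightarrow> (nat \<Rightarrow> 'a) \<Rightarrow> nat \<Rightarrow> 'a" where
  "cat k P Q = (\<lambda>m. if m < k then P m else if m < 2 * k then Q (m - k) else undefined)"

lemma cat_simps: "m < k \<Longrightarrow> cat k P Q m = P m" "m < k \<Longrightarrow> cat k P Q (m + k) = Q m"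
  by (auto simp: cat_def)

lemma lessThan_double: "{..<2*k} = {..<k} \<union> (\<lambda>m. m + k) ` {..<k}" for k :: nat
proof -
  have "x \<in> (\<lambda>m. m + k) ` {..<k}" if "\<not> x < k" "x < 2 * k" for x
    using that by (intro image_eqI[of _ _ "x - k"]) auto
  then show ?thesis by auto
qed

lemma prod_cat:
  fixes h :: "'a \<Rightarrow> 'b :: comm_monoid_mult"
  shows "(\<Prod>m<2*k. h (cat k P Q m)) = (\<Prod>m<k. h (P m)) * (\<Prod>m<k. h (Q m))"
proof -
  have "(\<Prod>m<2*k. h (cat k P Q m)) = (\<Prod>m<k. h (cat k P Q m)) * (\<Prod>m\<in>(\<lambda>m. m + k) ` {..<k}. h (cat k P Q m))"
    unfolding lessThan_double by (intro prod.union_disjoint) auto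
  also have "(\<Prod>m\<in>(\<lambda>m. m + k) ` {..<k}. h (cat k P Q m)) = (\<Prod>m<k. h (cat k P Q (m + k)))"
    by (subst prod.reindex) auto
  finally show ?thesis by (simp add: cat_simps)
qed

lemma sum_cat_le:
  fixes h :: "(nat \<Rightarrow> 'a) \<Rightarrow> real"
  assumes fin: "\<And>m. m < 2*k \<Longrightarrow> finite (cat k E1 E2 m)" and h: "\<And>P. h P \<ge> 0"
  shows "(\<Sum>P\<in>PiE {..<k} E1. \<Sum>Q\<in>PiE {..<k} E2. h (cat k P Q)) \<le> (\<Sum>R\<in>PiE {..<2*k} (cat k E1 E2). h R)"
proof -
  have "(\<Sum>P\<in>PiE {..<k} E1. \<Sum>Q\<in>PiE {..<k} E2. h (cat k P Q)) =
    (\<Sum>x\<in>PiE {..<k} E1 \<times> PiE {..<k} E2. h (cat k (fst x) (snd x)))"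
    by (simp add: sum.cartesian_product case_prod_unfold)
  also have "\<dots> = (\<Sum>R\<in>(\<lambda>x. cat k (fst x) (snd x)) ` (PiE {..<k} E1 \<times> PiE {..<k} E2). h R)"
  proof (subst sum.reindex)
    show "inj_on (\<lambda>x. cat k (fst x) (snd x)) (PiE {..<k} E1 \<times> PiE {..<k} E2)"
    proof (rule inj_onI, clarify)
      fix P Q P' Q' assume PQ: "P \<in> PiE {..<k} E1" "Q \<in> PiE {..<k} E2" "P' \<in> PiE {..<k} E1" "Q' \<in> PiE {..<k} E2"
        and eq: "cat k (fst (P, Q)) (snd (P, Q)) = cat k (fst (P', Q')) (snd (P', Q'))"
      have "P m = P' m" "Q m = Q' m" if "m < k" for m
        using fun_cong[OF eq, of m] fun_cong[OF eq, of "m + k"] that by (auto simp: cat_simps)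
      then show "P = P' \<and> Q = Q'"
        using PiE_ext[OF PQ(1,3)] PiE_ext[OF PQ(2,4)] by auto
    qed
  qed auto
  also have "\<dots> \<le> (\<Sum>R\<in>PiE {..<2*k} (cat k E1 E2). h R)"
  proof (rule sum_mono2)
    show "finite (PiE {..<2*k} (cat k E1 E2))" using fin by (intro finite_PiE) auto
    show "(\<lambda>x. cat k (fst x) (snd x)) ` (PiE {..<k} E1 \<times> PiE {..<k} E2) \<subseteq> PiE {..<2*k} (cat k E1 E2)"
    proof
      fix R assume "R \<in> (\<lambda>x. cat k (fst x) (snd x)) ` (PiE {..<k} E1 \<times> PiE {..<k} E2)"
      then obtain P Q where PQ: "R = cat k P Q" "P \<in> PiE {..<k} E1" "Q \<in> PiE {..<k} E2"
        by (elim imageE) (metis SigmaE fst_conv snd_conv)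
      show "R \<in> PiE {..<2*k} (cat k E1 E2)"
      proof (rule PiE_I)
        fix m assume "m \<in> {..<2*k}"
        then have "m < k \<or> m - k < k \<and> \<not> m < k \<and> m < 2 * k" by auto
        then show "R m \<in> cat k E1 E2 m"
          using PiE_mem[OF PQ(2), of m] PiE_mem[OF PQ(3), of "m - k"] unfolding PQ(1) cat_def by auto
      next
        fix m assume "m \<notin> {..<2*k}"
        then show "R m = undefined" unfolding PQ(1) cat_def by simp
      qed
    qed
  next
    show "h R \<ge> 0" for R by (rule h)
  qed
  finally show ?thesis .
qed

lemma prime_factorization_prod_primes:
  assumes "finite I" "\<And>m. m \<in> I \<Longrightarrow> prime (P m :: nat)"
  shows "prime_factorization (\<Prod>m\<in>I. P m) = image_mset P (mset_set I)"
proof -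
  have "(\<Prod>m\<in>I. P m) = prod_mset (image_mset P (mset_set I))"
    by (rule prod_unfold_prod_mset)
  then show ?thesis using assms
    by (simp only:) (rule prime_factorization_prod_mset_primes, auto)
qed

text \<open>By unique factorisation the pair \<open>(P3, P4)\<close> is a rearrangement of the
  \<open>2k\<close> primes of \<open>(P1, P2)\<close> by some permutation \<open>\<pi>\<close>.
  The primes used by \<open>P3\<close> are those indexed by \<open>J = \<pi> ` {..<k}\<close>, and
  at most \<open>(k!)\<^sup>2\<close> permutations lead to the same \<open>J\<close>.\<close>

lemma card_equal_products_le:
  fixes P1 P2 :: "nat \<Rightarrow> nat"
  assumes PP: "\<And>P m. P \<in> PP \<Longrightarrow> m < k \<Longrightarrow> prime (P m)" "PP \<subseteq> extensional {..<k}"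
    and P: "P1 \<in> PP" "P2 \<in> PP"
  shows "card {(P3, P4). P3 \<in> PP \<and> P4 \<in> PP \<and> (\<Prod>m<k. P3 m) * (\<Prod>m<k. P4 m) = (\<Prod>m<k. P1 m) * (\<Prod>m<k. P2 m)
      \<and> \<kappa> * real (\<Prod>m<k. P1 m) < real (\<Prod>m<k. P3 m) \<and> \<kappa> * real (\<Prod>m<k. P3 m) < real (\<Prod>m<k. P1 m)}
    \<le> (fact k)\<^sup>2 * card {J. J \<subseteq> {..<2*k} \<and> card J = k \<and> balanced \<kappa> k (cat k P1 P2) J}"
    (is "card ?S \<le> _ * card ?JJ")
proof -
  define P where "P = cat k P1 P2"
  define H where "H = (\<lambda>J. {\<pi>. \<pi> permutes {..<2*k} \<and> \<pi> ` {..<k} = J})"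
  define h where "h = (\<lambda>\<pi>. (\<lambda>m\<in>{..<k}. P (\<pi> m), \<lambda>m\<in>{..<k}. P (\<pi> (m + k))))"
  have finH: "finite (H J)" for J
    unfolding H_def using finite_permutations[of "{..<2*k}"] by simp
  have finJJ: "finite ?JJ" by simp
  have pcat: "prime (cat k Q R m)" if "Q \<in> PP" "R \<in> PP" "m < 2 * k" for Q R m
    using that PP(1) by (auto simp: cat_def)
  have "?S \<subseteq> (\<Union>J\<in>?JJ. h ` H J)"
  proof (safe)
    fix P3 P4 assume PP34: "P3 \<in> PP" "P4 \<in> PP"
      and eq: "(\<Prod>m<k. P3 m) * (\<Prod>m<k. P4 m) = (\<Prod>m<k. P1 m) * (\<Prod>m<k. P2 m)"
      and rat: "\<kappa> * real (\<Prod>m<k. P1 m) < real (\<Prod>m<k. P3 m)" "\<kappa> * real (\<Prod>m<k. P3 m) < real (\<Prod>m<k. P1 m)"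
    define Q where "Q = cat k P3 P4"
    have "image_mset Q (mset_set {..<2*k}) = prime_factorization (\<Prod>m<2*k. Q m)"
      using pcat[OF PP34] by (subst prime_factorization_prod_primes) (auto simp: Q_def)
    also have "(\<Prod>m<2*k. Q m) = (\<Prod>m<2*k. P m)"
      using eq prod_cat[of "\<lambda>x. x" k P3 P4] prod_cat[of "\<lambda>x. x" k P1 P2] by (simp add: P_def Q_def)
    also have "prime_factorization \<dots> = image_mset P (mset_set {..<2*k})"
      using pcat[OF P] by (subst prime_factorization_prod_primes) (auto simp: P_def)
    finally obtain \<pi> where \<pi>: "\<pi> permutes {..<2*k}" "\<forall>x\<in>{..<2*k}. Q x = P (\<pi> x)"
      using image_mset_eq_implies_permutes[of "{..<2*k}" Q P] by auto
    have P3: "P3 m = P (\<pi> m)" and P4: "P4 m = P (\<pi> (m + k))" if "m < k" for m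
      using \<pi>(2)[rule_format, of m] \<pi>(2)[rule_format, of "m + k"] that by (auto simp: Q_def cat_simps)
    have "h \<pi> = (P3, P4)"
    proof -
      have "P3 \<in> extensional {..<k}" "P4 \<in> extensional {..<k}" using PP34 PP(2) by auto
      then show ?thesis using P3 P4
        by (auto simp: h_def intro!: extensionalityI[where A = "{..<k}"])
    qed
    moreover have "\<pi> \<in> H (\<pi> ` {..<k})" using \<pi> by (simp add: H_def)
    moreover have "\<pi> ` {..<k} \<in> ?JJ"
    proof -
      have inj: "inj_on \<pi> {..<k}" using permutes_inj_on[OF \<pi>(1)] .
      have "\<pi> ` {..<k} \<subseteq> \<pi> ` {..<2*k}" by auto
      then have sub: "\<pi> ` {..<k} \<subseteq> {..<2*k}" using permutes_image[OF \<pi>(1)] by simp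
      have "(\<Prod>m\<in>\<pi> ` {..<k}. real (P m)) = (\<Prod>m<k. real (P (\<pi> m)))"
        using inj by (subst prod.reindex) auto
      also have "\<dots> = real (\<Prod>m<k. P3 m)" by (simp add: P3)
      finally have e3: "(\<Prod>m\<in>\<pi> ` {..<k}. real (P m)) = real (\<Prod>m<k. P3 m)" .
      have e1: "(\<Prod>m<k. real (P m)) = real (\<Prod>m<k. P1 m)" by (simp add: P_def cat_simps)
      have "balanced \<kappa> k P (\<pi> ` {..<k})"
        unfolding balanced_def e3 e1 using rat by auto
      then show ?thesis using sub inj by (simp add: card_image P_def)
    qed
    ultimately show "(P3, P4) \<in> (\<Union>J\<in>?JJ. h ` H J)"
      by (intro UN_I[of "\<pi> ` {..<k}"] image_eqI[of _ _ \<pi>]) simp_all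
  qed
  then have "card ?S \<le> card (\<Union>J\<in>?JJ. h ` H J)"
    using finJJ finH by (intro card_mono) auto
  also have "\<dots> \<le> (\<Sum>J\<in>?JJ. card (h ` H J))"
    by (rule card_UN_le[OF finJJ])
  also have "\<dots> \<le> (\<Sum>J\<in>?JJ. (fact k)\<^sup>2)"
  proof (intro sum_mono)
    fix J
    have "card (h ` H J) \<le> card (H J)" by (rule card_image_le[OF finH])
    also have "\<dots> \<le> (fact k)\<^sup>2"
      unfolding H_def by (rule card_permutes_image_le) auto
    finally show "card (h ` H J) \<le> (fact k)\<^sup>2" .
  qed
  finally show ?thesis by (simp add: mult.commute)
qed

text \<open>This cancels the large primes from a coincidence and leaves one between the small parts
  \<open>X\<close> and \<open>Y\<close>: as \<open>q3\<close> and \<open>q4\<close> do not divide \<open>X\<close>, they must occur among \<open>q1\<close>, \<open>q2\<close>.\<close>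

lemma large_primes_match:
  fixes q1 q2 q3 q4 X Y :: nat
  assumes "prime q1" "prime q2" "prime q3" "prime q4"
    and "\<not> q3 dvd X" "\<not> q4 dvd X" and eq: "q3 * q4 * Y = q1 * q2 * X"
  shows "X = Y \<and> (q3 = q1 \<and> q4 = q2 \<or> q3 = q2 \<and> q4 = q1)"
proof -
  have *: "X = Y \<and> q4 = b" if "q3 = a" "a * b = q1 * q2" "prime b" for a b
  proof -
    have "q3 * (q4 * Y) = q3 * (b * X)"
      using eq unfolding that(2)[symmetric] that(1)[symmetric] by (simp only: mult.assoc)
    then have 1: "q4 * Y = b * X" using assms(3) by (simp add: prime_gt_0_nat)
    then have "q4 dvd b * X" by (metis dvd_triv_left)
    then have "q4 = b" using assms(4,6) that(3) by (metis prime_dvd_mult_iff primes_dvd_imp_eq)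
    then show ?thesis using 1 assms(4) by (auto simp: prime_gt_0_nat)
  qed
  have "q3 dvd q1 * q2 * X" using eq by (metis dvd_triv_left mult.assoc)
  then have "q3 dvd q1 \<or> q3 dvd q2" using assms(3,5) by (simp add: prime_dvd_mult_iff)
  then have "q3 = q1 \<or> q3 = q2" using assms by (metis primes_dvd_imp_eq)
  then show ?thesis
  proof
    assume "q3 = q1"
    then show ?thesis using *[of q1 q2] assms(2) by blast
  next
    assume "q3 = q2"
    then show ?thesis using *[of q2 q1] assms(1) mult.commute[of q2 q1] by blast
  qed
qed

section \<open>Energy of integers built from barrier tuples\<close>

text \<open>The data provided by Mertens' estimate and by the block construction.\<close>

locale prime_groups =
  fixes C \<kappa> A :: real and D :: "nat \<Rightarrow> nat set" and w :: "nat \<Rightarrow> real"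
  assumes mert: "mertens_const C" and \<kappa>_def: "\<kappa> = exp (-(C + 1))" and A1: "A \<ge> 1"
    and finD: "\<And>j. finite (D j)"
    and primeD: "\<And>j p. p \<in> D j \<Longrightarrow> prime p"
    and lowD: "\<And>j p. p \<in> D j \<Longrightarrow> 4 ^ j \<le> ln (real p)"
    and highD: "\<And>j p. p \<in> D j \<Longrightarrow> ln (real p) \<le> A * 4 ^ j"
    and disjD: "\<And>i j. i \<noteq> j \<Longrightarrow> D i \<inter> D j = {}"
    and w0: "\<And>p. 0 \<le> w p" and w1: "\<And>p. w p \<le> 1"
    and sumD: "\<And>j. (\<Sum>p\<in>D j. w p / real p) = 2 * ln 2"
begin

lemma C1: "C \<ge> 1" using mert by (simp add: mertens_const_def)

lemma \<kappa>01: "0 < \<kappa>" "\<kappa> < 1" using C1 by (auto simp: \<kappa>_def)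

text \<open>In the block \<open>D j\<close> one has \<open>1 / p \<le> 4\<^bsup>-j\<^esup> ln p / p\<close>,
  and \<open>ln p / p\<close> has bounded sum over a window of fixed ratio.\<close>

lemma window_sum:
  assumes Y: "Y > 0"
  shows "(\<Sum>p | p \<in> D j \<and> Y < real p \<and> real p < Y / \<kappa>\<^sup>2. w p / real p) \<le> (3 * C + 2) / 4 ^ j"
proof -
  let ?S = "{p. p \<in> D j \<and> Y < real p \<and> real p < Y / \<kappa>\<^sup>2}"
  have "4 ^ j * (\<Sum>p\<in>?S. w p / real p) = (\<Sum>p\<in>?S. 4 ^ j * w p / real p)"
    by (simp add: sum_distrib_left)
  also have "\<dots> \<le> (\<Sum>p\<in>?S. ln p / real p)"
  proof (intro sum_mono divide_right_mono)
    fix p assume "p \<in> ?S"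
    then have "4 ^ j \<le> ln (real p)" using lowD by auto
    moreover have "4 ^ j * w p \<le> 4 ^ j * (1::real)" using w1[of p] by (intro mult_left_mono) auto
    ultimately show "4 ^ j * w p \<le> ln (real p)" by linarith
  qed auto
  also have "\<dots> \<le> (\<Sum>p\<in>primes_in Y (1 / \<kappa>\<^sup>2 * Y). ln p / real p)"
  proof (intro sum_mono2)
    show "0 \<le> ln (real p) / real p" if "p \<in> primes_in Y (1 / \<kappa>\<^sup>2 * Y) - ?S" for p
      using that by (auto simp: primes_in_def prime_gt_0_nat Suc_le_eq)
    show "?S \<subseteq> primes_in Y (1 / \<kappa>\<^sup>2 * Y)" using primeD by (auto simp: primes_in_def)
  qed simp
  also have "\<dots> \<le> ln (1 / \<kappa>\<^sup>2) + C"
    using \<kappa>01 by (intro sum_ln_over_primes_ratio mert Y) (auto simp: power_le_one)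
  also have "ln (1 / \<kappa>\<^sup>2) = 2 * C + 2"
    by (simp add: ln_div \<kappa>_def ln_realpow)
  finally show ?thesis by (simp add: field_simps)
qed

definition tuples :: "nat \<Rightarrow> (nat \<Rightarrow> nat) set" where
  "tuples k = (\<Union>f\<in>barrier_maps k. PiE {..<k} (\<lambda>m. D (f m)))"

lemma tuplesE:
  assumes "P \<in> tuples k"
  obtains f where "f \<in> barrier_maps k" "P \<in> PiE {..<k} (\<lambda>m. D (f m))"
  using assms by (auto simp: tuples_def)

lemma tuples_extensional: "tuples k \<subseteq> extensional {..<k}"
proof
  fix P assume "P \<in> tuples k"
  then obtain f where "P \<in> PiE {..<k} (\<lambda>m. D (f m))" by (rule tuplesE)
  then show "P \<in> extensional {..<k}" unfolding PiE_def by (rule IntD2)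
qed

lemma finite_tuples: "finite (tuples k)"
  unfolding tuples_def using finite_barrier_maps finD by (auto intro!: finite_PiE)

lemma sum_tuples: "(\<Sum>P\<in>tuples k. h P) = (\<Sum>f\<in>barrier_maps k. \<Sum>P\<in>PiE {..<k} (\<lambda>m. D (f m)). h P)"
  for h :: "_ \<Rightarrow> real"
  unfolding tuples_def
proof (rule sum.UNION_disjoint)
  show "\<forall>f\<in>barrier_maps k. \<forall>g\<in>barrier_maps k. f \<noteq> g \<longrightarrow>
      PiE {..<k} (\<lambda>m. D (f m)) \<inter> PiE {..<k} (\<lambda>m. D (g m)) = {}"
  proof (intro ballI impI)
    fix f g assume fg: "f \<in> barrier_maps k" "g \<in> barrier_maps k" "f \<noteq> g"
    have "f \<in> {..<k} \<rightarrow>\<^sub>E {..<k}" "g \<in> {..<k} \<rightarrow>\<^sub>E {..<k}" using fg by (auto simp: barrier_maps_def)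
    then obtain m where m: "m < k" "f m \<noteq> g m" using fg(3) PiE_ext[of f "{..<k}" _ g] by blast
    show "PiE {..<k} (\<lambda>m. D (f m)) \<inter> PiE {..<k} (\<lambda>m. D (g m)) = {}"
    proof (rule ccontr)
      assume "\<not> ?thesis"
      then obtain P where "P \<in> PiE {..<k} (\<lambda>m. D (f m))" "P \<in> PiE {..<k} (\<lambda>m. D (g m))" by auto
      then have "P m \<in> D (f m)" "P m \<in> D (g m)" using m by (auto simp: PiE_iff)
      then show False using disjD[OF m(2)] by auto
    qed
  qed
qed (use finite_barrier_maps finD in \<open>auto intro!: finite_PiE\<close>)

abbreviation \<sigma> :: real where "\<sigma> \<equiv> 2 * ln 2"

lemma \<sigma>1: "\<sigma> \<ge> 1" using ln2_ge_two_thirds by simp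

text \<open>Each block contributes the same factor, so the total weight only sees the number of block
  patterns.\<close>

lemma sum_tuples_weight: "(\<Sum>P\<in>tuples k. \<Prod>m<k. w (P m) / real (P m)) = real (card (barrier_maps k)) * \<sigma> ^ k"
proof -
  have "(\<Sum>P\<in>PiE {..<k} (\<lambda>m. D (f m)). \<Prod>m<k. w (P m) / real (P m)) = \<sigma> ^ k" for f
    by (subst prod_sum_PiE [symmetric]) (auto simp: finD sumD)
  then show ?thesis by (simp add: sum_tuples)
qed

text \<open>The barrier condition of the two patterns \<open>f\<close> and \<open>g\<close> adds up to the
  condition \<open>2(i + 1)\<close> needed for their concatenation.\<close>

lemma sum_tuple_pairs:
  assumes k: "k \<ge> 1"
  shows "(\<Sum>P\<in>tuples k. \<Sum>Q\<in>tuples k. (\<Prod>m<k. w (P m) / real (P m)) * (\<Prod>m<k. w (Q m) / real (Q m)) *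
       real (card {J. J \<subseteq> {..<2*k} \<and> card J = k \<and> balanced \<kappa> k (cat k P Q) J}))
    \<le> (real (card (barrier_maps k)))\<^sup>2 * (\<sigma> ^ (2*k) * real k * (24 * C + 17))"
proof -
  define v where "v = (\<lambda>p::nat. w p / real p)"
  define cJ where "cJ = (\<lambda>P. real (card {J. J \<subseteq> {..<2*k} \<and> card J = k \<and> balanced \<kappa> k P J}))"
  have v0: "v p \<ge> 0" for p using w0 by (simp add: v_def)
  have "(\<Sum>P\<in>tuples k. \<Sum>Q\<in>tuples k. (\<Prod>m<k. v (P m)) * (\<Prod>m<k. v (Q m)) * cJ (cat k P Q)) =
    (\<Sum>f\<in>barrier_maps k. \<Sum>g\<in>barrier_maps k.
      \<Sum>P\<in>PiE {..<k} (\<lambda>m. D (f m)). \<Sum>Q\<in>PiE {..<k} (\<lambda>m. D (g m)).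
         (\<Prod>m<k. v (P m)) * (\<Prod>m<k. v (Q m)) * cJ (cat k P Q))"
    unfolding sum_tuples by (intro sum.cong refl sum.swap)
  also have "\<dots> \<le> (\<Sum>f\<in>barrier_maps k. \<Sum>g\<in>barrier_maps k. \<sigma> ^ (2*k) * real k * (24 * C + 17))"
  proof (intro sum_mono)
    fix f g assume fg: "f \<in> barrier_maps k" "g \<in> barrier_maps k"
    have catD: "cat k (\<lambda>m. D (f m)) (\<lambda>m. D (g m)) m = D (cat k f g m)" if "m < 2 * k" for m
      using that by (auto simp: cat_def)
    have "(\<Sum>P\<in>PiE {..<k} (\<lambda>m. D (f m)). \<Sum>Q\<in>PiE {..<k} (\<lambda>m. D (g m)).
         (\<Prod>m<k. v (P m)) * (\<Prod>m<k. v (Q m)) * cJ (cat k P Q)) =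
       (\<Sum>P\<in>PiE {..<k} (\<lambda>m. D (f m)). \<Sum>Q\<in>PiE {..<k} (\<lambda>m. D (g m)).
         cJ (cat k P Q) * (\<Prod>m<2*k. v (cat k P Q m)))"
      unfolding prod_cat by (simp add: mult_ac)
    also have "\<dots> \<le> (\<Sum>R\<in>PiE {..<2*k} (cat k (\<lambda>m. D (f m)) (\<lambda>m. D (g m))). cJ R * (\<Prod>m<2*k. v (R m)))"
      by (rule sum_cat_le) (auto simp: catD finD cJ_def v0 intro!: prod_nonneg mult_nonneg_nonneg)
    also have "PiE {..<2*k} (cat k (\<lambda>m. D (f m)) (\<lambda>m. D (g m))) = PiE {..<2*k} (\<lambda>m. D (cat k f g m))"
      by (intro PiE_cong) (auto simp: catD)
    also have "(\<Sum>R\<in>\<dots>. cJ R * (\<Prod>m<2*k. v (R m))) \<le> \<sigma> ^ (2*k) + 8 * real k * (3 * C + 2) * \<sigma> ^ (2*k - 1)"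
      unfolding cJ_def
    proof (rule sum_balanced_subsets)
      show "p > 0" if "p \<in> D j" for p j using primeD[OF that] by (simp add: prime_gt_0_nat)
      show "(\<Sum>p | p \<in> D j \<and> Y < real p \<and> real p < Y / \<kappa>\<^sup>2. v p) \<le> (3 * C + 2) / 4 ^ j" if "Y > 0" for j Y
        unfolding v_def by (rule window_sum[OF that])
      show "card {m \<in> {..<2 * k}. cat k f g m \<le> i} \<le> 2 * (i + 1)" for i
      proof -
        have "{m \<in> {..<2 * k}. cat k f g m \<le> i} \<subseteq> {m \<in> {..<k}. f m < Suc i} \<union> (\<lambda>m. m + k) ` {m \<in> {..<k}. g m < Suc i}"
          unfolding lessThan_double by (auto simp: cat_simps)
        then have "card {m \<in> {..<2 * k}. cat k f g m \<le> i} \<le> card ({m \<in> {..<k}. f m < Suc i} \<union> (\<lambda>m. m + k) ` {m \<in> {..<k}. g m < Suc i})"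
          by (intro card_mono) auto
        also have "\<dots> \<le> card {m \<in> {..<k}. f m < Suc i} + card ((\<lambda>m. m + k) ` {m \<in> {..<k}. g m < Suc i})"
          by (rule card_Un_le)
        also have "\<dots> \<le> card {m \<in> {..<k}. f m < Suc i} + card {m \<in> {..<k}. g m < Suc i}"
          by (intro add_left_mono card_image_le) auto
        also have "\<dots> \<le> Suc i + Suc i"
          using fg unfolding barrier_maps_def by (intro add_mono) blast+
        finally show ?thesis by simp
      qed
    qed (use finD \<kappa>01 C1 v0 sumD in \<open>auto simp: v_def\<close>)
    also have "\<sigma> ^ (2*k - 1) \<le> \<sigma> ^ (2*k)"
      using \<sigma>1 by (intro power_increasing) auto
    also have "\<sigma> ^ (2*k) + 8 * real k * (3 * C + 2) * \<sigma> ^ (2*k) \<le> \<sigma> ^ (2*k) * real k * (24 * C + 17)"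
    proof -
      have "\<sigma> ^ (2*k) * 1 \<le> \<sigma> ^ (2*k) * real k"
        using k \<sigma>1 by (intro mult_left_mono) auto
      then show ?thesis by (simp add: algebra_simps)
    qed
    finally show "(\<Sum>P\<in>PiE {..<k} (\<lambda>m. D (f m)). \<Sum>Q\<in>PiE {..<k} (\<lambda>m. D (g m)).
         (\<Prod>m<k. v (P m)) * (\<Prod>m<k. v (Q m)) * cJ (cat k P Q)) \<le> \<sigma> ^ (2*k) * real k * (24 * C + 17)"
      using C1 by (simp add: mult_left_mono)
  qed
  also have "\<dots> = (real (card (barrier_maps k)))\<^sup>2 * (\<sigma> ^ (2*k) * real k * (24 * C + 17))"
    by (simp add: power2_eq_square)
  finally show ?thesis by (simp add: v_def cJ_def)
qed

lemma ln_tuple_entry: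
  assumes "P \<in> tuples k" "m < k"
  shows "prime (P m)" "ln (real (P m)) \<le> A * 4 ^ (k - 1)"
proof -
  from assms(1) obtain f where f: "f \<in> barrier_maps k" "P \<in> PiE {..<k} (\<lambda>m. D (f m))"
    by (rule tuplesE)
  have Pm: "P m \<in> D (f m)" using f assms by (auto simp: PiE_iff)
  have "f m < k" using f assms by (auto simp: barrier_maps_def PiE_iff)
  show "prime (P m)" by (rule primeD[OF Pm])
  have "ln (real (P m)) \<le> A * 4 ^ f m" by (rule highD[OF Pm])
  also have "\<dots> \<le> A * 4 ^ (k - 1)"
    using \<open>f m < k\<close> A1 by (intro mult_left_mono power_increasing) auto
  finally show "ln (real (P m)) \<le> A * 4 ^ (k - 1)" .
qed

text \<open>The test weights live on the integers \<open>q * pr P\<close>, where \<open>P\<close> is a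
  barrier tuple and \<open>q\<close> a prime in \<open>(\<kappa> N / pr P, N / pr P]\<close>. The
  smallness condition on \<open>k\<close> gives \<open>pr P \<le> \<surd>N\<close>, hence
  \<open>q\<close> exceeds all small primes, and each \<open>P\<close> has about \<open>N / (pr P
  ln N)\<close> companions \<open>q\<close>. In a coincidence the primes \<open>q\<close> match up
  to order, and a common \<open>q\<close> forces the two small parts to be comparable in size.\<close>

lemma min_energy_bound:
  assumes k: "k \<ge> 1" and small: "real k * (A * 4 ^ k) \<le> ln (real N) / 2" and N: "ln (real N) \<ge> 4 * (C + 1)"
  shows "min_energy N \<le> (2 * (4 * (2 * C + 1))\<^sup>2 * (24 * C + 17) / \<kappa> ^ 4) *
    ((ln (real N))\<^sup>2 * real k * (fact k)\<^sup>2 / ((real (card (barrier_maps k)))\<^sup>2 * \<sigma> ^ (2*k)))"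
proof -
  define l where "l = ln (real N)"
  have l: "l \<ge> 8" using N C1 by (simp add: l_def)
  have Npos: "real N > 0" using l by (cases "N = 0") (auto simp: l_def)
  define pr where "pr = (\<lambda>P::nat \<Rightarrow> nat. \<Prod>m<k. P m)"
  define y where "y = (\<lambda>P. real N / real (pr P))"
  define Q where "Q = (\<lambda>P. primes_in (\<kappa> * y P) (y P))"
  have A4: "A * 4 ^ (k - 1) \<le> l / 8"
  proof -
    have "4 * (A * 4 ^ (k - 1)) = 1 * (A * 4 ^ k)" using k by (cases k) auto
    also have "\<dots> \<le> real k * (A * 4 ^ k)" using k A1 by (intro mult_right_mono) auto
    finally show ?thesis using small by (simp add: l_def)
  qed
  have prpos: "real (pr P) > 0" if "P \<in> tuples k" for P
    using ln_tuple_entry(1)[OF that] by (auto simp: pr_def prime_gt_0_nat intro!: prod_pos)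
  have lnpr: "ln (real (pr P)) \<le> l / 2" if P: "P \<in> tuples k" for P
  proof -
    have "ln (real (pr P)) = (\<Sum>m<k. ln (real (P m)))"
      unfolding pr_def of_nat_prod using ln_tuple_entry(1)[OF P] by (intro ln_prod) (auto simp: prime_gt_0_nat)
    also have "\<dots> \<le> (\<Sum>m<k. A * 4 ^ (k - 1))"
      using ln_tuple_entry(2)[OF P] by (intro sum_mono) auto
    also have "\<dots> \<le> real k * (A * 4 ^ k)"
      using A1 by (auto intro!: mult_left_mono power_increasing)
    finally show ?thesis using small by (simp add: l_def)
  qed
  have lny: "y P > 0" "l / 2 \<le> ln (y P)" "ln (y P) \<le> l" "ln (\<kappa> * y P) \<ge> l / 4" "\<kappa> * y P > 1" if P: "P \<in> tuples k" for P
  proof -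
    show yp: "y P > 0" using prpos[OF P] Npos by (simp add: y_def)
    have e: "ln (y P) = l - ln (real (pr P))" using prpos[OF P] Npos by (simp add: y_def ln_div l_def)
    show 1: "l / 2 \<le> ln (y P)" using e lnpr[OF P] by linarith
    have "ln (real (pr P)) \<ge> 0" using prpos[OF P] by (intro ln_ge_zero) auto
    then show "ln (y P) \<le> l" using e by linarith
    have "ln (\<kappa> * y P) = ln (y P) - (C + 1)" using yp by (subst ln_mult) (auto simp: \<kappa>_def)
    then show 2: "ln (\<kappa> * y P) \<ge> l / 4" using 1 N by (simp add: l_def)
    have "\<kappa> * y P > 0" using yp \<kappa>01 by simp
    then show "\<kappa> * y P > 1" using 2 l by (metis ln_gt_zero_iff less_le_trans divide_pos_pos zero_less_numeral)
  qed
  define X where "X = Sigma (tuples k) Q"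
  define val where "val = (\<lambda>x. snd x * pr (fst x))"
  define wt where "wt = (\<lambda>x::(nat \<Rightarrow> nat) \<times> nat. \<Prod>m<k. w (fst x m))"
  define S where "S = (\<lambda>P1 P2. {(P3, P4). P3 \<in> tuples k \<and> P4 \<in> tuples k \<and> pr P3 * pr P4 = pr P1 * pr P2
      \<and> \<kappa> * real (pr P1) < real (pr P3) \<and> \<kappa> * real (pr P3) < real (pr P1)})"
  have finX: "finite X" unfolding X_def Q_def using finite_tuples by auto
  have Qprime: "prime q" if "q \<in> Q P" for q P using that by (simp add: Q_def primes_in_def)
  \<comment> \<open>tuple entries have logarithm at most \<open>l / 8\<close>, while \<open>q > \<kappa> * y P\<close> has logarithm at least \<open>l / 4\<close>\<close>
  have qlarge: "\<not> q dvd pr P'" if P: "P \<in> tuples k" "q \<in> Q P" "P' \<in> tuples k" for q P P'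
  proof
    assume "q dvd pr P'"
    then obtain m where m: "m < k" "q dvd P' m"
      using Qprime[OF P(2)] by (auto simp: pr_def prime_dvd_prod_iff)
    then have "q = P' m" using Qprime[OF P(2)] ln_tuple_entry(1)[OF P(3)] primes_dvd_imp_eq by blast
    then have "ln (real q) \<le> l / 8" using ln_tuple_entry(2)[OF P(3) m(1)] A4 by simp
    moreover have "ln (\<kappa> * y P) \<le> ln (real q)"
      using P(2) lny[OF P(1)] \<kappa>01 by (subst ln_le_cancel_iff) (auto simp: Q_def primes_in_def)
    ultimately show False using lny(4)[OF P(1)] l by linarith
  qed
  have ratio: "\<kappa> * real (pr P1) < real (pr P3)" if P: "P1 \<in> tuples k" "P3 \<in> tuples k" "q \<in> Q P1" "q \<in> Q P3" for P1 P3 q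
  proof -
    have "\<kappa> * y P3 < y P1" using P(3,4) by (auto simp: Q_def primes_in_def)
    then show ?thesis using prpos[OF P(1)] prpos[OF P(2)] Npos
      by (simp add: y_def field_simps)
  qed
  define W where "W = (\<lambda>P::nat \<Rightarrow> nat. \<Prod>m<k. w (P m))"
  define V where "V = (\<lambda>P::nat \<Rightarrow> nat. \<Prod>m<k. w (P m) / real (P m))"
  define cJ where "cJ = (\<lambda>P P'. real (card {J. J \<subseteq> {..<2*k} \<and> card J = k \<and> balanced \<kappa> k (cat k P P') J}))"
  define F where "F = real (card (barrier_maps k))"
  define M where "M = 4 * (2 * C + 1)"
  define U where "U = real k * (24 * C + 17)"
  have W0: "W P \<ge> 0" and V0: "V P \<ge> 0" for P
    using w0 by (auto simp: W_def V_def intro!: prod_nonneg)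
  have WV: "W P * (c * y P / d) = c * real N / d * V P" for P c d
    by (simp add: W_def V_def y_def pr_def prod_dividef mult_ac)
  have Fpos: "F > 0"
    using card_barrier_maps[of k] k by (auto simp: F_def intro!: Nat.gr0I)
  have pos: "l > 0" "\<sigma> > 0" "M > 0" "U > 0" using l \<sigma>1 C1 k by (auto simp: M_def U_def)
  have sumX: "(\<Sum>x\<in>X. h x) = (\<Sum>P\<in>tuples k. \<Sum>q\<in>Q P. h (P, q))" for h :: "_ \<Rightarrow> real"
    unfolding X_def by (subst sum.Sigma) (auto simp: finite_tuples Q_def)
  have Z: "(\<Sum>x\<in>X. wt x) = (\<Sum>P\<in>tuples k. W P * real (card (Q P)))"
    unfolding sumX by (simp add: wt_def W_def mult.commute)
  have "\<kappa> * real N / l * (F * \<sigma> ^ k) = (\<Sum>P\<in>tuples k. \<kappa> * real N / l * V P)"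
    unfolding F_def V_def sum_tuples_weight [symmetric] by (simp add: sum_distrib_left)
  also have "\<dots> \<le> (\<Sum>x\<in>X. wt x)"
    unfolding Z
  proof (intro sum_mono)
    fix P assume P: "P \<in> tuples k"
    have "ln (y P) > 0" using lny(2)[OF P] l by linarith
    then have "\<kappa> * y P / l \<le> \<kappa> * y P / ln (y P)"
      using lny(1,3)[OF P] pos \<kappa>01 by (intro divide_left_mono mult_pos_pos) auto
    also have "\<dots> \<le> real (card (Q P))"
      unfolding Q_def using lny[OF P] by (intro card_primes_in_lower[OF mert \<kappa>_def]) auto
    finally have "W P * (\<kappa> * y P / l) \<le> W P * real (card (Q P))"
      using W0 by (intro mult_left_mono) auto
    then show "\<kappa> * real N / l * V P \<le> W P * real (card (Q P))" by (simp only: WV)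
  qed
  finally have Zlow: "\<kappa> * real N / l * (F * \<sigma> ^ k) \<le> (\<Sum>x\<in>X. wt x)" .
  have Zlow0: "0 < \<kappa> * real N / l * (F * \<sigma> ^ k)" using \<kappa>01 Npos pos Fpos by simp
  have cardQ: "W P * real (card (Q P)) \<le> M * real N / l * V P" if P: "P \<in> tuples k" for P
  proof -
    have "real (card (Q P)) \<le> (2 * C + 1) * y P / ln (\<kappa> * y P)"
      unfolding Q_def using lny[OF P] by (intro card_primes_in_upper[OF mert \<kappa>_def]) auto
    also have "\<dots> \<le> (2 * C + 1) * y P / (l / 4)"
    proof -
      have "ln (\<kappa> * y P) > 0" using lny(4)[OF P] l by linarith
      then show ?thesis using lny(1,4)[OF P] pos C1 by (intro divide_left_mono mult_pos_pos) auto
    qed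
    also have "\<dots> = M * y P / l" by (simp add: M_def)
    finally have "W P * real (card (Q P)) \<le> W P * (M * y P / l)"
      using W0 by (intro mult_left_mono) auto
    then show ?thesis by (simp only: WV)
  qed
  have "min_energy N * (\<Sum>x\<in>X. wt x) ^ 4 \<le> (real N)\<^sup>2 * (\<Sum>x\<in>X. \<Sum>z\<in>X. wt x * wt z * (2 * real (card (S (fst x) (fst z)))))"
  proof (rule min_energy_le_count)
    show "finite X" by (rule finX)
    show "val x \<in> {1..N}" if "x \<in> X" for x
    proof -
      obtain P q where x: "x = (P, q)" "P \<in> tuples k" "q \<in> Q P" using \<open>x \<in> X\<close> by (auto simp: X_def)
      have "real q \<le> y P" "q > 0" using x(3) by (auto simp: Q_def primes_in_def prime_gt_0_nat)
      then have "real (q * pr P) \<le> real N" using prpos[OF x(2)] by (simp add: y_def field_simps)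
      then have "q * pr P \<le> N" by (simp only: of_nat_le_iff)
      moreover have "q * pr P > 0" using prpos[OF x(2)] \<open>q > 0\<close> by simp
      ultimately show ?thesis by (simp add: val_def x Suc_le_eq)
    qed
    show "0 \<le> wt x" "wt x \<le> 1" for x
      using w0 w1 by (auto simp: wt_def intro!: prod_nonneg prod_le_1)
    show "real (card {v \<in> X \<times> X. val (fst v) * val (snd v) = val x * val z}) \<le> 2 * real (card (S (fst x) (fst z)))"
      if xz: "x \<in> X" "z \<in> X" for x z
    proof -
      obtain P1 q1 where x: "x = (P1, q1)" "P1 \<in> tuples k" "q1 \<in> Q P1" using xz by (auto simp: X_def)
      obtain P2 q2 where z: "z = (P2, q2)" "P2 \<in> tuples k" "q2 \<in> Q P2" using xz by (auto simp: X_def)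
      have finS: "finite (S P1 P2)"
        by (rule finite_subset[of _ "tuples k \<times> tuples k"]) (auto simp: S_def finite_tuples)
      \<comment> \<open>the large primes of \<open>v\<close> are \<open>q1, q2\<close> in one of the two orders\<close>
      have "{v \<in> X \<times> X. val (fst v) * val (snd v) = val x * val z} \<subseteq>
        (\<lambda>(P3, P4). ((P3, q1), (P4, q2))) ` S P1 P2 \<union> (\<lambda>(P3, P4). ((P4, q2), (P3, q1))) ` S P1 P2"
      proof
        fix v assume "v \<in> {v \<in> X \<times> X. val (fst v) * val (snd v) = val x * val z}"
        then obtain P3 q3 P4 q4 where v: "v = ((P3, q3), (P4, q4))" "P3 \<in> tuples k" "q3 \<in> Q P3" "P4 \<in> tuples k" "q4 \<in> Q P4"
          and eq: "q3 * pr P3 * (q4 * pr P4) = q1 * pr P1 * (q2 * pr P2)"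
          by (auto simp: X_def val_def x z)
        have "pr P1 * pr P2 = pr P3 * pr P4 \<and> (q3 = q1 \<and> q4 = q2 \<or> q3 = q2 \<and> q4 = q1)"
        proof (rule large_primes_match)
          show "prime q1" "prime q2" "prime q3" "prime q4" using Qprime x z v by blast+
          show "\<not> q3 dvd pr P1 * pr P2" "\<not> q4 dvd pr P1 * pr P2"
            using qlarge v x z \<open>prime q3\<close> \<open>prime q4\<close> prime_dvd_mult_iff by blast+
          show "q3 * q4 * (pr P3 * pr P4) = q1 * q2 * (pr P1 * pr P2)" using eq by (simp only: mult_ac)
        qed
        then consider "pr P1 * pr P2 = pr P3 * pr P4" "q3 = q1" "q4 = q2"
          | "pr P1 * pr P2 = pr P3 * pr P4" "q3 = q2" "q4 = q1" by blast
        then show "v \<in> (\<lambda>(P3, P4). ((P3, q1), (P4, q2))) ` S P1 P2 \<union> (\<lambda>(P3, P4). ((P4, q2), (P3, q1))) ` S P1 P2"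
        proof cases
          case 1
          then have "(P3, P4) \<in> S P1 P2"
            using ratio[of P1 P3 q1] ratio[of P3 P1 q1] x v by (auto simp: S_def)
          then show ?thesis using 1 v(1) by (intro UnI1 image_eqI[of _ _ "(P3, P4)"]) auto
        next
          case 2
          then have "(P4, P3) \<in> S P1 P2"
            using ratio[of P1 P4 q1] ratio[of P4 P1 q1] x v by (auto simp: S_def mult.commute)
          then show ?thesis using 2 v(1) by (intro UnI2 image_eqI[of _ _ "(P4, P3)"]) auto
        qed
      qed
      then have "card {v \<in> X \<times> X. val (fst v) * val (snd v) = val x * val z} \<le>
        card ((\<lambda>(P3, P4). ((P3, q1), (P4, q2))) ` S P1 P2 \<union> (\<lambda>(P3, P4). ((P4, q2), (P3, q1))) ` S P1 P2)"
        using finS by (intro card_mono) auto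
      also have "\<dots> \<le> card ((\<lambda>(P3, P4). ((P3, q1), (P4, q2))) ` S P1 P2) + card ((\<lambda>(P3, P4). ((P4, q2), (P3, q1))) ` S P1 P2)"
        by (rule card_Un_le)
      also have "\<dots> \<le> card (S P1 P2) + card (S P1 P2)"
        by (intro add_mono card_image_le finS)
      finally show ?thesis by (simp add: x z)
    qed
    show "0 < (\<Sum>x\<in>X. wt x)" using Zlow Zlow0 by linarith
  qed
  note energy = this
  have "(\<Sum>x\<in>X. \<Sum>z\<in>X. wt x * wt z * (2 * real (card (S (fst x) (fst z))))) =
     (\<Sum>P\<in>tuples k. real (card (Q P)) * (\<Sum>P'\<in>tuples k. real (card (Q P')) * (W P * W P' * (2 * real (card (S P P'))))))"
    unfolding sumX by (simp only: wt_def W_def fst_conv sum_constant)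
  also have "\<dots> = (\<Sum>P\<in>tuples k. \<Sum>P'\<in>tuples k. (W P * real (card (Q P))) * (W P' * real (card (Q P'))) * (2 * real (card (S P P'))))"
    unfolding sum_distrib_left by (intro sum.cong refl) (simp only: mult_ac)
  also have "\<dots> \<le> (\<Sum>P\<in>tuples k. \<Sum>P'\<in>tuples k. (M * real N / l * V P) * (M * real N / l * V P') * (2 * ((fact k)\<^sup>2 * cJ P P')))"
  proof (intro sum_mono)
    fix P P' assume P: "P \<in> tuples k" "P' \<in> tuples k"
    have "card (S P P') \<le> (fact k)\<^sup>2 * card {J. J \<subseteq> {..<2*k} \<and> card J = k \<and> balanced \<kappa> k (cat k P P') J}"
      unfolding S_def pr_def
      using card_equal_products_le[where PP = "tuples k" and k = k and ?P1.0 = P and ?P2.0 = P' and \<kappa> = \<kappa>]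
        ln_tuple_entry(1)[of _ k] tuples_extensional P by blast
    then have "real (card (S P P')) \<le> real ((fact k)\<^sup>2 * card {J. J \<subseteq> {..<2*k} \<and> card J = k \<and> balanced \<kappa> k (cat k P P') J})"
      by (simp only: of_nat_le_iff)
    then have S: "2 * real (card (S P P')) \<le> 2 * ((fact k)\<^sup>2 * cJ P P')"
      by (simp add: cJ_def)
    have nn: "0 \<le> M * real N / l * V P" "0 \<le> W P' * real (card (Q P'))" for P P'
      using W0[of P'] V0[of P] pos Npos by auto
    show "(W P * real (card (Q P))) * (W P' * real (card (Q P'))) * (2 * real (card (S P P')))
      \<le> (M * real N / l * V P) * (M * real N / l * V P') * (2 * ((fact k)\<^sup>2 * cJ P P'))"
    proof (rule mult_mono[OF mult_mono[OF cardQ[OF P(1)] cardQ[OF P(2)]] S])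
      show "0 \<le> (M * real N / l * V P) * (M * real N / l * V P')" by (rule mult_nonneg_nonneg[OF nn(1) nn(1)])
    qed (use nn in auto)
  qed
  also have "\<dots> = 2 * (fact k)\<^sup>2 * (M * real N / l)\<^sup>2 * (\<Sum>P\<in>tuples k. \<Sum>P'\<in>tuples k. V P * V P' * cJ P P')"
    unfolding sum_distrib_left power2_eq_square by (intro sum.cong refl) (simp add: mult_ac)
  also have "\<dots> \<le> 2 * (fact k)\<^sup>2 * (M * real N / l)\<^sup>2 * (F\<^sup>2 * (\<sigma> ^ (2*k) * U))"
    using sum_tuple_pairs[OF k] unfolding V_def cJ_def F_def U_def
    by (intro mult_left_mono) (auto simp: mult.assoc)
  finally have "(\<Sum>x\<in>X. \<Sum>z\<in>X. wt x * wt z * (2 * real (card (S (fst x) (fst z)))))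
     \<le> 2 * (fact k)\<^sup>2 * (M * real N / l)\<^sup>2 * (F\<^sup>2 * (\<sigma> ^ (2*k) * U))" .
  from order_trans[OF energy mult_left_mono[OF this]] have main: "min_energy N * (\<Sum>x\<in>X. wt x) ^ 4 \<le>
     (real N)\<^sup>2 * (2 * (fact k)\<^sup>2 * (M * real N / l)\<^sup>2 * (F\<^sup>2 * (\<sigma> ^ (2*k) * U)))"
    by simp
  define s where "s = \<sigma> ^ k"
  have s: "s > 0" "\<sigma> ^ (2*k) = s\<^sup>2" using pos by (simp_all only: s_def power_mult [symmetric] mult.commute[of k] zero_less_power)
  show ?thesis
  proof (cases "min_energy N \<ge> 0")
    case True
    have "min_energy N * (\<kappa> * real N / l * (F * s)) ^ 4 \<le> min_energy N * (\<Sum>x\<in>X. wt x) ^ 4"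
      using True Zlow Zlow0 unfolding s_def by (intro mult_left_mono power_mono) auto
    also note main
    finally have "min_energy N \<le> (real N)\<^sup>2 * (2 * (fact k)\<^sup>2 * (M * real N / l)\<^sup>2 * (F\<^sup>2 * (s\<^sup>2 * U))) /
       (\<kappa> * real N / l * (F * s)) ^ 4"
      using zero_less_power[OF Zlow0, of 4] unfolding s_def [symmetric] s(2)
      by (simp only: pos_le_divide_eq)
    also have "\<dots> = (2 * M\<^sup>2 * (24 * C + 17) / \<kappa> ^ 4) * (l\<^sup>2 * real k * (fact k)\<^sup>2 / (F\<^sup>2 * s\<^sup>2))"
      using pos(1) Fpos s(1) \<kappa>01(1) Npos unfolding U_def
      by (simp add: divide_simps power_mult_distrib) (simp add: power2_eq_square power4_eq_xxxx)
    finally show ?thesis by (simp only: M_def l_def F_def s(2))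
  next
    case False
    have "0 \<le> (2 * M\<^sup>2 * (24 * C + 17) / \<kappa> ^ 4) * (l\<^sup>2 * real k * (fact k)\<^sup>2 / (F\<^sup>2 * s\<^sup>2))"
      using C1 \<kappa>01 by (intro mult_nonneg_nonneg divide_nonneg_nonneg) auto
    then show ?thesis using False unfolding M_def l_def F_def s(2) by linarith
  qed
qed

end

section \<open>The upper bound for the minimal energy\<close>

text \<open>Both bounds come from \<open>ln y \<le> y - 1\<close>, at \<open>y = ln 2\<close> and at
  \<open>y = 1 / ln 2\<close>.\<close>

lemma erdos_exponent_bounds: "0 \<le> erdos_exponent" "erdos_exponent \<le> 2"
proof -
  have l2: "ln (2::real) \<ge> 2/3" by (rule ln2_ge_two_thirds)
  have "ln (ln (2::real)) \<le> ln 2 - 1" using l2 by (intro ln_le_minus_one) auto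
  then show "0 \<le> erdos_exponent" using l2 by (simp add: erdos_exponent_def)
  have "ln (1 / ln (2::real)) \<le> 1 / ln 2 - 1" using l2 by (intro ln_le_minus_one) auto
  moreover have "1 / ln (2::real) \<le> 3/2" using l2 by (simp add: field_simps)
  ultimately have "ln (ln (2::real)) \<ge> -1" using l2 by (simp add: ln_div)
  then have "0 \<le> (1 + ln (ln (2::real))) / ln 2" using l2 by (intro divide_nonneg_pos) auto
  then show "erdos_exponent \<le> 2" unfolding erdos_exponent_def by linarith
qed

text \<open>The exponent \<open>\<delta>\<close> arises here: the logarithm of the left side is \<open>k ln
  4\<close> times \<open>(1 + ln 2 + ln (ln 2)) / ln 2\<close>, and this quotient is \<open>2 -
  \<delta>\<close>.\<close>

lemma entropy_identity: "(exp 1 * (2 * ln 2)) ^ (2 * k) = (4 ^ k) powr (2 - erdos_exponent)"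
proof -
  have l2: "ln (2::real) > 0" by simp
  have ln4: "ln (4::real) = 2 * ln 2" using ln_realpow[of 2 2] by simp
  have "(exp 1 * (2 * ln 2)) ^ (2 * k) = exp (real (2 * k) * ln (exp 1 * (2 * ln (2::real))))"
    using l2 by (subst exp_of_nat_mult) auto
  also have "ln (exp 1 * (2 * ln (2::real))) = 1 + ln 2 + ln (ln 2)"
    using l2 by (simp add: ln_mult)
  also have "real (2 * k) * (1 + ln 2 + ln (ln 2)) = (2 - erdos_exponent) * (real k * ln 4)"
    using l2 unfolding erdos_exponent_def ln4 by (simp add: field_simps)
  also have "exp \<dots> = (4 ^ k) powr (2 - erdos_exponent)"
    by (simp add: powr_def ln_realpow)
  finally show ?thesis .
qed

text \<open>Combines the cycle lemma, \<open>card (barrier_maps k) \<ge> k\<^bsup>k-1\<^esup>\<close>, with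
  Stirling's bound.\<close>

lemma combinatorial_factor_le:
  assumes k: "k \<ge> 1"
  shows "real k * (fact k)\<^sup>2 / ((real (card (barrier_maps k)))\<^sup>2 * (2 * ln 2) ^ (2*k))
    \<le> exp 2 * real k ^ 4 / (4 ^ k) powr (2 - erdos_exponent)"
proof -
  define F where "F = real (card (barrier_maps k))"
  define \<sigma> :: real where "\<sigma> = 2 * ln 2"
  have \<sigma>: "\<sigma> > 0" by (simp add: \<sigma>_def)
  have kp: "real k > 0" using k by simp
  have "real (k ^ k) \<le> real (k * card (barrier_maps k))"
    using card_barrier_maps[of k] k by (subst of_nat_le_iff) auto
  then have F1: "real k ^ k \<le> real k * F" by (simp add: F_def)
  have Fpos: "F > 0"
  proof -
    have "0 < real k ^ k" using kp by simp
    then have "0 < real k * F" using F1 by linarith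
    then show ?thesis using kp by (simp add: zero_less_mult_iff)
  qed
  have "ln ((fact k :: real)\<^sup>2) \<le> 2 * (1 + ln k / 2 + real k * ln k - k)"
    using ln_fact_stirling[OF k] by (simp add: ln_realpow)
  also have "\<dots> = ln (exp 2 * real k * real k ^ (2 * k) / exp 1 ^ (2 * k))"
    using kp by (simp add: ln_mult ln_div ln_realpow algebra_simps)
  finally have fact: "(fact k :: real)\<^sup>2 \<le> exp 2 * real k * real k ^ (2 * k) / exp 1 ^ (2 * k)"
    using kp by (subst (asm) ln_le_cancel_iff) auto
  have F2: "real k ^ (2 * k) \<le> (real k)\<^sup>2 * F\<^sup>2"
    using power_mono[OF F1, of 2] by (simp add: power_mult_distrib power_mult [symmetric] mult.commute)
  have "real k * (fact k)\<^sup>2 / (F\<^sup>2 * \<sigma> ^ (2*k)) \<le>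
     real k * (exp 2 * real k * ((real k)\<^sup>2 * F\<^sup>2) / exp 1 ^ (2 * k)) / (F\<^sup>2 * \<sigma> ^ (2*k))"
    using kp \<sigma> Fpos by (intro divide_right_mono mult_left_mono order_trans[OF fact] F2) auto
  also have "\<dots> = exp 2 * real k ^ 4 / (exp 1 * \<sigma>) ^ (2 * k)"
    using \<sigma> Fpos by (simp add: field_simps power_mult_distrib power4_eq_xxxx power2_eq_square)
  also have "(exp 1 * \<sigma>) ^ (2 * k) = (4 ^ k) powr (2 - erdos_exponent)"
    unfolding \<sigma>_def by (rule entropy_identity)
  finally show ?thesis by (simp add: F_def \<sigma>_def)
qed

text \<open>Take the largest \<open>k\<close> with \<open>A k 4\<^bsup>k\<^esup> \<le> (ln N) / 2\<close>.
  With \<open>L = ln (ln N)\<close>, maximality gives \<open>4\<^bsup>k\<^esup> \<ge> ln N / (16 A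
  L)\<close> and hence the factor \<open>L\<^bsup>2-\<delta>\<^esup>\<close>, which together with
  \<open>k\<^sup>4 \<le> L\<^sup>4\<close> stays below \<open>L\<^sup>6\<close>.\<close>

lemma min_energy_upper_large:
  "\<exists>K N0. K > 0 \<and> (\<forall>N\<ge>N0. min_energy N \<le> K * (ln (real N) powr erdos_exponent * (ln (ln (real N))) ^ 6))"
proof -
  obtain C where C: "mertens_const C" using ex_mertens_const by blast
  obtain D w A where AD: "A \<ge> 1" "\<And>j. finite (D j)"
    "\<And>j p. p \<in> D j \<Longrightarrow> prime p"
    "\<And>j p. p \<in> D j \<Longrightarrow> 4 ^ j \<le> ln (real p)"
    "\<And>j p. p \<in> D j \<Longrightarrow> ln (real p) \<le> A * 4 ^ j"
    "\<And>i j. i \<noteq> j \<Longrightarrow> D i \<inter> D j = {}"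
    "\<And>p. 0 \<le> w p" "\<And>p. w p \<le> 1"
    "\<And>j. (\<Sum>p\<in>D j. w p / real p) = 2 * ln 2"
    by (rule ex_prime_groups, rule that) assumption+
  interpret prime_groups C "exp (-(C+1))" A D w
    by unfold_locales (use C AD in auto)
  define K1 where "K1 = 2 * (4 * (2 * C + 1))\<^sup>2 * (24 * C + 17) / exp (-(C+1)) ^ 4"
  have K1: "K1 > 0" using C1 by (simp add: K1_def)
  define \<beta> where "\<beta> = 2 - erdos_exponent"
  have \<beta>0: "\<beta> \<ge> 0" using erdos_exponent_bounds by (simp add: \<beta>_def)
  define K where "K = K1 * exp 2 * (16 * A) powr \<beta>"
  have Kpos: "K > 0" using K1 A1 by (simp add: K_def)
  \<comment> \<open>large enough for the block construction, for \<open>k = 1\<close> to be admissible, and for \<open>L \<ge> 1\<close>\<close>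
  define l0 where "l0 = max (4 * (C + 1)) (max (8 * A) (exp 1))"
  have bound: "min_energy N \<le> K * (ln (real N) powr erdos_exponent * (ln (ln (real N))) ^ 6)"
    if lN: "ln (real N) \<ge> l0" for N
  proof -
    define l where "l = ln (real N)"
    have l: "l \<ge> 4 * (C + 1)" "l \<ge> 8 * A" "l \<ge> exp 1" using lN by (auto simp: l_def l0_def)
    have lpos: "l > 0" using l(2) A1 by linarith
    define L where "L = ln l"
    have "ln (exp 1) \<le> L" unfolding L_def using l(3) lpos by (subst ln_le_cancel_iff) auto
    then have L1: "L \<ge> 1" by simp
    define good where "good = (\<lambda>k::nat. real k * (A * 4 ^ k) \<le> l / 2)"
    have g01: "good 0" "good 1" using l lpos A1 by (auto simp: good_def)
    have "\<exists>n. \<not> good n"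
    proof -
      obtain n :: nat where n: "real n > l / 2" using reals_Archimedean2 by blast
      have "real n * 1 \<le> real n * (A * 4 ^ n)"
        using A1 one_le_power[of "4::real" n] mult_mono[of 1 A 1 "4 ^ n"] by (intro mult_left_mono) auto
      then show ?thesis using n by (auto simp: good_def intro!: exI[of _ n])
    qed
    then obtain n where n: "\<not> good n" "\<And>m. m < n \<Longrightarrow> good m"
      using exists_least_iff[of "\<lambda>n. \<not> good n"] by blast
    define k where "k = n - 1"
    have n2: "n \<ge> 2" using n(1) g01 by (metis less_2_cases not_le One_nat_def)
    have k: "k \<ge> 1" "good k" "\<not> good (Suc k)" "n = Suc k" using n n2 by (auto simp: k_def)
    have kp: "real k > 0" using k by simp
    have "1 * 1 \<le> real k * A" using k A1 by (intro mult_mono) auto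
    then have "1 * 4 ^ k \<le> (real k * A) * 4 ^ k" by (intro mult_right_mono) auto
    then have "4 ^ k \<le> real k * (A * 4 ^ k)" by simp
    then have "4 ^ k \<le> l" using k(2)[unfolded good_def] lpos by linarith
    then have "ln (4 ^ k) \<le> L" unfolding L_def using lpos by (subst ln_le_cancel_iff) auto
    then have "real k * ln 4 \<le> L" by (simp add: ln_realpow)
    moreover have "ln (4::real) \<ge> 1"
      using ln_realpow[of 2 2] ln2_ge_two_thirds by simp
    then have "real k * 1 \<le> real k * ln 4" by (intro mult_left_mono) auto
    ultimately have kL: "real k \<le> L" by simp
    have "l / 2 < real (Suc k) * (A * 4 ^ Suc k)" using k(3) by (simp add: good_def)
    also have "\<dots> \<le> (2 * L) * (A * 4 ^ Suc k)"
      using kL L1 A1 by (intro mult_right_mono) auto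
    finally have low: "l / (16 * A * L) \<le> 4 ^ k" using A1 L1 by (simp add: field_simps)
    have "min_energy N \<le> K1 * (l\<^sup>2 * real k * (fact k)\<^sup>2 / ((real (card (barrier_maps k)))\<^sup>2 * \<sigma> ^ (2*k)))"
      unfolding K1_def l_def
      by (rule min_energy_bound) (use k l in \<open>auto simp: good_def l_def\<close>)
    also have "\<dots> = K1 * l\<^sup>2 * (real k * (fact k)\<^sup>2 / ((real (card (barrier_maps k)))\<^sup>2 * \<sigma> ^ (2*k)))"
      by simp
    also have "\<dots> \<le> K1 * l\<^sup>2 * (exp 2 * real k ^ 4 / (4 ^ k) powr \<beta>)"
      using combinatorial_factor_le[OF k(1)] K1 unfolding \<beta>_def by (intro mult_left_mono) auto
    also have "\<dots> \<le> K1 * l\<^sup>2 * (exp 2 * L ^ 4 / (l / (16 * A * L)) powr \<beta>)"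
      using K1 kL kp low lpos A1 L1 \<beta>0
      by (intro mult_left_mono frac_le power_mono powr_mono2) auto
    also have "(l / (16 * A * L)) powr \<beta> = l powr \<beta> / ((16 * A) powr \<beta> * L powr \<beta>)"
      using lpos A1 L1 by (simp add: powr_divide powr_mult)
    also have "K1 * l\<^sup>2 * (exp 2 * L ^ 4 / \<dots>) = K * (l\<^sup>2 / l powr \<beta>) * (L ^ 4 * L powr \<beta>)"
      by (simp add: K_def)
    also have "l\<^sup>2 / l powr \<beta> = l powr erdos_exponent"
      using lpos by (simp add: \<beta>_def powr_diff powr_numeral)
    also have "L ^ 4 * L powr \<beta> \<le> L ^ 4 * L powr 2"
      using L1 erdos_exponent_bounds by (intro mult_left_mono powr_mono) (auto simp: \<beta>_def)
    also have "L ^ 4 * L powr 2 = L ^ 6" using L1 by (simp add: powr_numeral power_add [symmetric])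
    finally show ?thesis using Kpos by (simp add: l_def L_def mult.assoc mult_left_mono)
  qed
  show ?thesis
  proof (intro exI conjI allI impI)
    show "K > 0" by (rule Kpos)
    fix N assume N: "N \<ge> nat \<lceil>exp l0\<rceil>"
    have "exp l0 \<le> real N" using N by linarith
    then have "l0 \<le> ln (real N)" by (metis exp_gt_zero ln_exp ln_le_cancel_iff less_le_trans)
    then show "min_energy N \<le> K * (ln (real N) powr erdos_exponent * (ln (ln (real N))) ^ 6)"
      by (rule bound)
  qed
qed

lemma min_energy_greatest:
  assumes N: "N \<ge> 1"
    and le: "\<And>c. c \<in> {1..N} \<rightarrow> {0..} \<Longrightarrow> (\<Sum>n=1..N. c n) = 1 \<Longrightarrow> B \<le> (real N)\<^sup>2 * mult_energy N c"
  shows "B \<le> min_energy N"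
  unfolding min_energy_def
proof (rule cINF_greatest)
  have "(\<Sum>n = 1..N. \<bar>if n = 1 then 1 else 0 :: real\<bar>) = (\<Sum>n = 1..N. if n = 1 then 1 else 0)"
    by (intro sum.cong) auto
  also have "\<dots> = 1" using N by simp
  finally have "(\<lambda>n. if n = 1 then 1 else 0) \<in> {c. c \<in> {1..N} \<rightarrow> {0::real..} \<and> (\<Sum>n = 1..N. \<bar>c n\<bar>) = 1}"
    by auto
  then show "{c. c \<in> {1..N} \<rightarrow> {0::real..} \<and> (\<Sum>n = 1..N. \<bar>c n\<bar>) = 1} \<noteq> {}" by blast
  fix c assume c: "c \<in> {c. c \<in> {1..N} \<rightarrow> {0::real..} \<and> (\<Sum>n = 1..N. \<bar>c n\<bar>) = 1}"
  then have "(\<Sum>n = 1..N. \<bar>c n\<bar>) = (\<Sum>n = 1..N. c n)"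
    by (intro sum.cong) (auto simp: Pi_iff)
  then show "B \<le> (real N)\<^sup>2 * mult_energy N c" using c by (intro le) auto
qed

text \<open>Cauchy-Schwarz: the representation function has total mass 1 on at most \<open>N\<^sup>2\<close>
  integers.\<close>

lemma min_energy_ge_1:
  assumes N: "N \<ge> 1"
  shows "min_energy N \<ge> 1"
proof (rule min_energy_greatest[OF N])
  fix c assume c: "c \<in> {1..N} \<rightarrow> {0::real..}" "(\<Sum>n=1..N. c n) = 1"
  define r where "r = (\<lambda>n. \<Sum>(d, t) \<in> {(d, t) \<in> {1..N} \<times> {1..N}. d * t = n}. c d * c t)"
  have "(\<Sum>n=1..N^2. r n) = (\<Sum>n=1..N^2. \<Sum>x | x \<in> {1..N} \<times> {1..N} \<and> fst x * snd x = n. c (fst x) * c (snd x))"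
    unfolding r_def by (intro sum.cong) (auto simp: case_prod_unfold)
  also have "\<dots> = (\<Sum>x\<in>{1..N} \<times> {1..N}. c (fst x) * c (snd x))"
    by (intro sum.group) (auto simp: power2_eq_square intro!: mult_le_mono)
  also have "\<dots> = (\<Sum>n=1..N. c n) * (\<Sum>n=1..N. c n)"
    by (simp add: sum_product sum.cartesian_product case_prod_unfold)
  also have "\<dots> = 1" using c by simp
  finally have "1 = (\<Sum>n=1..N^2. r n)\<^sup>2" by simp
  also have "\<dots> \<le> (\<Sum>n=1..N^2. (r n)\<^sup>2) * real (card {1..N^2})"
    by (rule sum_squared_le_sum_of_squares)
  also have "\<dots> = (real N)\<^sup>2 * mult_energy N c"
    by (simp add: mult_energy_def r_def)
  finally show "1 \<le> (real N)\<^sup>2 * mult_energy N c" .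
qed

lemma min_energy_upper:
  "\<exists>K>0. \<forall>N\<ge>3. min_energy N \<le> K * (ln (real N) powr erdos_exponent * (ln (ln (real N))) ^ 6)"
proof -
  obtain K N0 where K: "K > 0" "\<And>N. N \<ge> N0 \<Longrightarrow> min_energy N \<le> K * (ln (real N) powr erdos_exponent * (ln (ln (real N))) ^ 6)"
    using min_energy_upper_large by blast
  define G where "G = (\<lambda>N::nat. ln (real N) powr erdos_exponent * (ln (ln (real N))) ^ 6)"
  have G: "G N > 0" if "N \<ge> 3" for N
  proof -
    have "exp 1 < (3::real)" using e_less_272 by simp
    then have "exp 1 < real N" using that by linarith
    then have "1 < ln (real N)" by (metis exp_gt_zero ln_exp ln_less_cancel_iff less_trans)
    then show ?thesis by (simp add: G_def)
  qed
  \<comment> \<open>the finitely many \<open>N\<close> below \<open>N0\<close> are paid for by the constant\<close>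
  define K' where "K' = K + (\<Sum>N=3..N0. min_energy N / G N)"
  have terms: "min_energy N / G N \<ge> 0" if "N \<ge> 3" for N
    using G[OF that] min_energy_ge_1[of N] that by (intro divide_nonneg_pos) auto
  have s0: "(\<Sum>N=3..N0. min_energy N / G N) \<ge> 0" using terms by (intro sum_nonneg) auto
  have "min_energy N \<le> K' * G N" if N: "N \<ge> 3" for N
  proof (cases "N \<ge> N0")
    case True
    have "min_energy N \<le> K * G N" using K(2)[OF True] by (simp add: G_def)
    also have "\<dots> \<le> K' * G N" using s0 G[OF N] by (intro mult_right_mono) (auto simp: K'_def)
    finally show ?thesis .
  next
    case False
    have "min_energy N / G N \<le> (\<Sum>N=3..N0. min_energy N / G N)"
      using False N terms by (intro member_le_sum) auto
    then have "min_energy N / G N \<le> K'" using K(1) by (simp add: K'_def)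
    then show ?thesis using G[OF N] by (simp add: field_simps)
  qed
  moreover have "K' > 0" using K(1) s0 by (simp add: K'_def)
  ultimately show ?thesis unfolding G_def by blast
qed

lemma sqrt_energy_lower:
  "\<exists>K>0. \<forall>N::nat. 3 \<le> N \<longrightarrow>
      sqrt (real N / min_energy N)
        \<ge> K * (sqrt (real N) /
                (ln (real N) powr (erdos_exponent / 2) * (ln (ln (real N)))^3))"
proof -
  obtain K where K: "K > 0" "\<And>N. N \<ge> 3 \<Longrightarrow> min_energy N \<le> K * (ln (real N) powr erdos_exponent * (ln (ln (real N))) ^ 6)"
    using min_energy_upper by blast
  show ?thesis
  proof (intro exI[of _ "1 / sqrt K"] conjI allI impI)
    show "0 < 1 / sqrt K" using K by simp
    fix N :: nat assume N: "3 \<le> N"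
    define l where "l = ln (real N)"
    have "exp 1 < real N" using N e_less_272 by linarith
    then have "1 < l" unfolding l_def by (metis exp_gt_zero ln_exp ln_less_cancel_iff less_trans)
    then have L: "ln l > 0" "l > 0" by auto
    have E: "min_energy N > 0" using min_energy_ge_1[of N] N by simp
    have "sqrt (min_energy N) \<le> sqrt (K * (l powr erdos_exponent * (ln l) ^ 6))"
      using K(2)[OF N] by (simp add: l_def)
    also have "l powr erdos_exponent = (l powr (erdos_exponent / 2))\<^sup>2"
      using L by (simp add: powr_realpow [symmetric] powr_powr)
    also have "(ln l) ^ 6 = ((ln l) ^ 3)\<^sup>2" by (simp add: power_mult [symmetric])
    also have "sqrt (K * ((l powr (erdos_exponent / 2))\<^sup>2 * ((ln l) ^ 3)\<^sup>2)) = sqrt K * (l powr (erdos_exponent / 2) * (ln l) ^ 3)"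
      using L by (simp only: real_sqrt_mult real_sqrt_abs) simp
    finally have "sqrt (real N) / (sqrt K * (l powr (erdos_exponent / 2) * (ln l) ^ 3)) \<le> sqrt (real N) / sqrt (min_energy N)"
      using K(1) L E by (intro divide_left_mono) auto
    then show "1 / sqrt K * (sqrt (real N) / (ln (real N) powr (erdos_exponent / 2) * (ln (ln (real N)))^3)) \<le> sqrt (real N / min_energy N)"
      by (simp add: l_def real_sqrt_divide)
  qed
qed

section \<open>Moments of the zeta sum\<close>

text \<open>The Fourier transform at \<open>x\<close> of the triangular weight \<open>1 - |t|/T\<close> on
  \<open>[-T, T]\<close>.\<close>

definition fejer :: "real \<Rightarrow> real \<Rightarrow> real" where
  "fejer T x = (if x = 0 then T else 2 * (1 - cos (x * T)) / (T * x\<^sup>2))"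

lemma fejer_nonneg: "T > 0 \<Longrightarrow> fejer T x \<ge> 0"
  by (auto simp: fejer_def)

lemma fejer_le: "T > 0 \<Longrightarrow> x \<noteq> 0 \<Longrightarrow> fejer T x \<le> 4 / (T * x\<^sup>2)"
proof -
  assume T: "T > 0" and x: "x \<noteq> 0"
  have "2 * (1 - cos (x * T)) \<le> 2 * (1 - (- 1))"
    by (intro mult_left_mono diff_left_mono cos_ge_minus_one) auto
  then have "2 * (1 - cos (x * T)) \<le> 4" by simp
  then show ?thesis using T x by (auto simp: fejer_def intro!: divide_right_mono)
qed

lemma fejer_minus: "fejer T (- x) = fejer T x"
  by (simp add: fejer_def)

lemma even_has_integral_symmetric:
  fixes f :: "real \<Rightarrow> real"
  assumes "(f has_integral I) {0..T}" "T \<ge> 0" "\<And>t. f (- t) = f t"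
  shows "(f has_integral (2 * I)) {-T..T}"
proof -
  have "((\<lambda>t. f (- t)) has_integral I) {-T..-0}"
    using assms(1) by (subst has_integral_reflect_real)
  then have "(f has_integral I) {-T..0}" using assms(3) by simp
  from has_integral_combine[OF _ _ this assms(1)] assms(2) show ?thesis by simp
qed

lemma has_integral_fejer:
  assumes T: "T > 0"
  shows "((\<lambda>t. (1 - \<bar>t\<bar> / T) * cos (x * t)) has_integral fejer T x) {-T..T}"
proof -
  have "((\<lambda>t. (1 - \<bar>t\<bar> / T) * cos (x * t)) has_integral (fejer T x / 2)) {0..T}"
  proof (cases "x = 0")
    case True
    have "((\<lambda>t. 1 - t / T) has_integral ((T - T\<^sup>2 / (2 * T)) - (0 - 0\<^sup>2 / (2 * T)))) {0..T}"
      by (rule fundamental_theorem_of_calculus)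
        (use T in \<open>auto intro!: derivative_eq_intros simp: has_real_derivative_iff_has_vector_derivative [symmetric] field_simps\<close>)
    also have "(T - T\<^sup>2 / (2 * T)) - (0 - 0\<^sup>2 / (2 * T)) = fejer T x / 2"
      using T True by (simp add: fejer_def power2_eq_square)
    finally show ?thesis
      by (rule has_integral_eq[rotated]) (use True in auto)
  next
    case False
    define F where "F = (\<lambda>t. (1 - t / T) * sin (x * t) / x - cos (x * t) / (T * x\<^sup>2))"
    have "((\<lambda>t. (1 - t / T) * cos (x * t)) has_integral (F T - F 0)) {0..T}"
    proof (rule fundamental_theorem_of_calculus)
      fix t
      have "(F has_real_derivative (1 - t / T) * cos (x * t)) (at t within {0..T})"
        unfolding F_def using T False
        by (auto intro!: derivative_eq_intros simp: field_simps power2_eq_square)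
      then show "(F has_vector_derivative (1 - t / T) * cos (x * t)) (at t within {0..T})"
        by (simp add: has_real_derivative_iff_has_vector_derivative)
    qed (use T in auto)
    also have "F T - F 0 = fejer T x / 2"
      using T False by (simp add: F_def fejer_def field_simps)
    finally show ?thesis
      by (rule has_integral_eq[rotated]) auto
  qed
  from even_has_integral_symmetric[OF this] T show ?thesis by simp
qed

definition dpoly :: "nat \<Rightarrow> (nat \<Rightarrow> real) \<Rightarrow> real \<Rightarrow> complex" where
  "dpoly N a t = (\<Sum>n=1..N. of_real (a n) * cis (ln (real n) * t))"

lemma zeta_sum_eq_dpoly: "zeta_sum N t = dpoly N (\<lambda>_. 1) t"
proof -
  have "of_nat n powr (\<i> * of_real t) = cis (ln (real n) * t)" if "n \<in> {1..N}" for n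
  proof -
    have "Ln (of_nat n) = of_real (ln (real n))" using that Ln_of_real[of "real n"] by simp
    then show ?thesis using that by (simp add: powr_def cis_conv_exp mult_ac)
  qed
  then show ?thesis by (simp add: zeta_sum_def dpoly_def)
qed

lemma continuous_on_dpoly [continuous_intros]: "continuous_on S (dpoly N a)"
proof -
  have "dpoly N a = (\<lambda>t. \<Sum>n=1..N. of_real (a n) * cis (ln (real n) * t))"
    by (simp add: fun_eq_iff dpoly_def)
  then show ?thesis by (auto intro!: continuous_intros)
qed

lemma Re_dpoly_cnj:
  "Re (dpoly N a t * cnj (dpoly N b t)) =
     (\<Sum>m=1..N. \<Sum>n=1..N. a m * b n * cos ((ln (real m) - ln (real n)) * t))"
  by (simp add: dpoly_def sum_product cos_diff left_diff_distrib algebra_simps)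

lemma dpoly_minus: "dpoly N a (- t) = cnj (dpoly N a t)"
  by (simp add: dpoly_def cis_cnj)

lemma has_integral_weighted_product:
  assumes T: "T > 0"
  shows "((\<lambda>t. (1 - \<bar>t\<bar> / T) * Re (dpoly N a t * cnj (dpoly N b t))) has_integral
     (\<Sum>m=1..N. \<Sum>n=1..N. a m * b n * fejer T (ln (real m) - ln (real n)))) {-T..T}"
proof -
  have "((\<lambda>t. \<Sum>m=1..N. \<Sum>n=1..N. a m * b n * ((1 - \<bar>t\<bar> / T) * cos ((ln (real m) - ln (real n)) * t))) has_integral
     (\<Sum>m=1..N. \<Sum>n=1..N. a m * b n * fejer T (ln (real m) - ln (real n)))) {-T..T}"
    by (intro has_integral_sum has_integral_mult_right has_integral_fejer T) auto
  then show ?thesis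
  proof (rule has_integral_eq[rotated])
    fix t
    show "(\<Sum>m=1..N. \<Sum>n=1..N. a m * b n * ((1 - \<bar>t\<bar> / T) * cos ((ln (real m) - ln (real n)) * t))) =
      (1 - \<bar>t\<bar> / T) * Re (dpoly N a t * cnj (dpoly N b t))"
      unfolding Re_dpoly_cnj sum_distrib_left by (intro sum.cong refl) (simp only: mult_ac)
  qed
qed

lemma sum_inverse_squares_le: "(\<Sum>d=1..n. 1 / (real d)\<^sup>2) \<le> 2"
proof -
  have "(\<Sum>d=1..Suc n. 1 / (real d)\<^sup>2) \<le> 2 - 1 / real (Suc n)" for n
  proof (induction n)
    case (Suc n)
    define a where "a = real (Suc n)"
    have a: "a > 0" "real (Suc (Suc n)) = a + 1" by (auto simp: a_def)
    have "1 / (a + 1)\<^sup>2 \<le> 1 / (a * (a + 1))"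
      using a unfolding power2_eq_square by (intro divide_left_mono mult_right_mono) auto
    also have "\<dots> = 1 / a - 1 / (a + 1)" using a by (simp add: field_simps)
    finally have "1 / (real (Suc (Suc n)))\<^sup>2 \<le> 1 / real (Suc n) - 1 / real (Suc (Suc n))"
      unfolding a(2) by (simp only: a_def)
    then show ?case using Suc by simp
  qed auto
  note this[of n]
  moreover have "(\<Sum>d=1..n. 1 / (real d)\<^sup>2) \<le> (\<Sum>d=1..Suc n. 1 / (real d)\<^sup>2)"
    by simp
  moreover have "1 / real (Suc n) \<ge> 0" by simp
  ultimately show ?thesis by linarith
qed

lemma sum_inverse_square_distances_le:
  assumes m: "m \<in> {1..N}"
  shows "(\<Sum>n\<in>{1..N} - {m}. 1 / (real m - real n)\<^sup>2) \<le> 4"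
proof -
  have eq: "{1..N} - {m} = {1..<m} \<union> {Suc m..N}" using m by auto
  have "(\<Sum>n\<in>{1..N} - {m}. 1 / (real m - real n)\<^sup>2) =
     (\<Sum>n\<in>{1..<m}. 1 / (real m - real n)\<^sup>2) + (\<Sum>n\<in>{Suc m..N}. 1 / (real m - real n)\<^sup>2)"
    unfolding eq by (rule sum.union_disjoint) auto
  also have "(\<Sum>n\<in>{1..<m}. 1 / (real m - real n)\<^sup>2) = (\<Sum>d=1..m-1. 1 / (real d)\<^sup>2)"
    by (rule sum.reindex_bij_witness[of _ "\<lambda>d. m - d" "\<lambda>n. m - n"]) (auto simp: of_nat_diff)
  also have "(\<Sum>n\<in>{Suc m..N}. 1 / (real m - real n)\<^sup>2) = (\<Sum>d=1..N-m. 1 / (real d)\<^sup>2)"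
    by (rule sum.reindex_bij_witness[of _ "\<lambda>d. m + d" "\<lambda>n. n - m"]) (auto simp: of_nat_diff power2_commute)
  finally show ?thesis
    using sum_inverse_squares_le[of "m - 1"] sum_inverse_squares_le[of "N - m"] by linarith
qed

lemma ln_diff_ge:
  assumes "1 \<le> m" "m \<le> N" "1 \<le> n" "n \<le> N"
  shows "\<bar>real m - real n\<bar> / real N \<le> \<bar>ln (real m) - ln (real n)\<bar>"
proof -
  have *: "(real b - real a) / real N \<le> ln (real b) - ln (real a)"
    if "1 \<le> a" "a \<le> b" "b \<le> N" for a b :: nat
  proof -
    have "(real b - real a) / real N \<le> (real b - real a) / real b"
      using that by (intro divide_left_mono) auto
    also have "\<dots> = 1 - real a / real b" using that by (simp add: field_simps)
    also have "\<dots> \<le> - ln (real a / real b)"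
      using that ln_le_minus_one[of "real a / real b"] by simp
    also have "\<dots> = ln (real b) - ln (real a)" using that by (simp add: ln_div)
    finally show ?thesis .
  qed
  show ?thesis
  proof (cases "m \<le> n")
    case True
    then have "ln (real m) \<le> ln (real n)" using assms by simp
    then show ?thesis using *[of m n] True assms by simp
  next
    case False
    then have "ln (real n) \<le> ln (real m)" using assms by simp
    then show ?thesis using *[of n m] False assms by simp
  qed
qed

text \<open>Schur's test. The frequencies satisfy \<open>|ln m - ln n| \<ge> |m - n| / T\<close>, so the
  Fejer kernel is at most \<open>4 T / (m - n)\<^sup>2\<close> off the diagonal and each row sums
  to at most \<open>T + 4 T * 4\<close>.\<close>

lemma weighted_mean_square_le:
  assumes N: "1 \<le> N" "real N \<le> T"
  shows "integral {-T..T} (\<lambda>t. (1 - \<bar>t\<bar> / T) * (cmod (dpoly N a t))\<^sup>2) \<le> 17 * T * (\<Sum>n=1..N. (a n)\<^sup>2)"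
proof -
  have T: "T > 0" using N by linarith
  define g where "g = (\<lambda>m n. fejer T (ln (real m) - ln (real n)))"
  have g0: "g m n \<ge> 0" for m n using T by (simp add: g_def fejer_nonneg)
  have gsym: "g m n = g n m" for m n
    unfolding g_def using fejer_minus[of T "ln (real m) - ln (real n)"] by simp
  have row: "(\<Sum>n=1..N. g m n) \<le> 17 * T" if m: "m \<in> {1..N}" for m
  proof -
    have "(\<Sum>n=1..N. g m n) = g m m + (\<Sum>n\<in>{1..N} - {m}. g m n)"
      using m by (intro sum.remove) auto
    also have "g m m = T" by (simp add: g_def fejer_def)
    also have "(\<Sum>n\<in>{1..N} - {m}. g m n) \<le> (\<Sum>n\<in>{1..N} - {m}. 4 * T * (1 / (real m - real n)\<^sup>2))"
    proof (intro sum_mono)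
      fix n assume n: "n \<in> {1..N} - {m}"
      define x where "x = ln (real m) - ln (real n)"
      have "\<bar>real m - real n\<bar> / T \<le> \<bar>real m - real n\<bar> / real N"
        using N T by (intro divide_left_mono) auto
      also have "\<dots> \<le> \<bar>x\<bar>" unfolding x_def using n m by (intro ln_diff_ge) auto
      finally have x1: "\<bar>real m - real n\<bar> / T \<le> \<bar>x\<bar>" .
      have d: "0 < \<bar>real m - real n\<bar> / T" using n T by auto
      then have "x \<noteq> 0" using x1 by auto
      then have "g m n \<le> 4 / (T * x\<^sup>2)" unfolding g_def x_def using T by (intro fejer_le) auto
      also have "\<dots> \<le> 4 / (T * (\<bar>real m - real n\<bar> / T)\<^sup>2)"
      proof -
        have "(\<bar>real m - real n\<bar> / T)\<^sup>2 \<le> \<bar>x\<bar>\<^sup>2" using x1 d by (intro power_mono) auto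
        moreover have "0 < (\<bar>real m - real n\<bar> / T)\<^sup>2" using d by (rule zero_less_power)
        ultimately show ?thesis using T by (intro divide_left_mono mult_left_mono mult_pos_pos) auto
      qed
      also have "\<dots> = 4 * T * (1 / (real m - real n)\<^sup>2)"
        using T by (simp add: power_divide power2_eq_square)
      finally show "g m n \<le> 4 * T * (1 / (real m - real n)\<^sup>2)" .
    qed
    also have "\<dots> = 4 * T * (\<Sum>n\<in>{1..N} - {m}. 1 / (real m - real n)\<^sup>2)"
      by (rule sum_distrib_left [symmetric])
    also have "\<dots> \<le> 4 * T * 4"
      using sum_inverse_square_distances_le[OF m] T by (intro mult_left_mono) auto
    finally show ?thesis by simp
  qed
  have "(\<lambda>t. (1 - \<bar>t\<bar> / T) * (cmod (dpoly N a t))\<^sup>2) = (\<lambda>t. (1 - \<bar>t\<bar> / T) * Re (dpoly N a t * cnj (dpoly N a t)))"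
    by (simp add: fun_eq_iff complex_mult_cnj cmod_power2)
  then have "integral {-T..T} (\<lambda>t. (1 - \<bar>t\<bar> / T) * (cmod (dpoly N a t))\<^sup>2) = (\<Sum>m=1..N. \<Sum>n=1..N. a m * a n * g m n)"
    using integral_unique[OF has_integral_weighted_product[OF T, of N a a]] by (simp add: g_def)
  also have "\<dots> \<le> (\<Sum>m=1..N. \<Sum>n=1..N. (((a m)\<^sup>2 + (a n)\<^sup>2) / 2) * g m n)"
  proof (intro sum_mono mult_right_mono g0)
    fix m n
    have "0 \<le> (a m - a n)\<^sup>2" by simp
    then show "a m * a n \<le> ((a m)\<^sup>2 + (a n)\<^sup>2) / 2" by (simp add: power2_diff)
  qed
  also have "\<dots> = (\<Sum>m=1..N. \<Sum>n=1..N. (a m)\<^sup>2 / 2 * g m n) + (\<Sum>m=1..N. \<Sum>n=1..N. (a n)\<^sup>2 / 2 * g m n)"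
    by (simp add: sum.distrib [symmetric] add_divide_distrib ring_distribs)
  also have "(\<Sum>m=1..N. \<Sum>n=1..N. (a n)\<^sup>2 / 2 * g m n) = (\<Sum>n=1..N. \<Sum>m=1..N. (a n)\<^sup>2 / 2 * g n m)"
    by (subst sum.swap) (simp add: gsym)
  also have "(\<Sum>m=1..N. \<Sum>n=1..N. (a m)\<^sup>2 / 2 * g m n) + \<dots> = (\<Sum>m=1..N. (a m)\<^sup>2 * (\<Sum>n=1..N. g m n))"
    by (simp add: sum_distrib_left sum.distrib [symmetric] mult_ac)
  also have "\<dots> \<le> (\<Sum>m=1..N. (a m)\<^sup>2 * (17 * T))"
    using row by (intro sum_mono mult_left_mono) auto
  also have "\<dots> = 17 * T * (\<Sum>n=1..N. (a n)\<^sup>2)"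
    by (simp add: sum_distrib_right [symmetric] mult.commute)
  finally show ?thesis .
qed

definition conv_square :: "nat \<Rightarrow> (nat \<Rightarrow> real) \<Rightarrow> nat \<Rightarrow> real" where
  "conv_square N c n = (\<Sum>(d, t) \<in> {(d, t) \<in> {1..N} \<times> {1..N}. d * t = n}. c d * c t)"

lemma dpoly_square: "(dpoly N c t)\<^sup>2 = dpoly (N\<^sup>2) (conv_square N c) t"
proof -
  define h where "h = (\<lambda>x. of_real (c (fst x) * c (snd x)) * cis (ln (real (fst x * snd x)) * t))"
  have "(dpoly N c t)\<^sup>2 = (\<Sum>x\<in>{1..N} \<times> {1..N}. (of_real (c (fst x)) * cis (ln (real (fst x)) * t)) *
      (of_real (c (snd x)) * cis (ln (real (snd x)) * t)))"
    unfolding power2_eq_square dpoly_def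
    by (simp add: sum_product sum.cartesian_product case_prod_unfold)
  also have "\<dots> = (\<Sum>x\<in>{1..N} \<times> {1..N}. h x)"
  proof (intro sum.cong refl)
    fix x assume x: "x \<in> {1..N} \<times> {1..N}"
    then have "ln (real (fst x * snd x)) = ln (real (fst x)) + ln (real (snd x))"
      by (auto simp: ln_mult)
    then have "cis (ln (real (fst x * snd x)) * t) = cis (ln (real (fst x)) * t) * cis (ln (real (snd x)) * t)"
      by (simp only: cis_mult ring_distribs)
    then show "(of_real (c (fst x)) * cis (ln (real (fst x)) * t)) * (of_real (c (snd x)) * cis (ln (real (snd x)) * t)) = h x"
      by (simp add: h_def mult_ac)
  qed
  also have "\<dots> = (\<Sum>n=1..N\<^sup>2. \<Sum>x | x \<in> {1..N} \<times> {1..N} \<and> fst x * snd x = n. h x)"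
    by (rule sum.group [symmetric]) (auto simp: power2_eq_square intro!: mult_le_mono)
  also have "\<dots> = (\<Sum>n=1..N\<^sup>2. of_real (conv_square N c n) * cis (ln (real n) * t))"
  proof (intro sum.cong refl)
    fix n
    have "(\<Sum>x | x \<in> {1..N} \<times> {1..N} \<and> fst x * snd x = n. h x) =
       (\<Sum>x | x \<in> {1..N} \<times> {1..N} \<and> fst x * snd x = n. of_real (c (fst x) * c (snd x)) * cis (ln (real n) * t))"
      by (intro sum.cong refl) (auto simp: h_def)
    also have "\<dots> = of_real (conv_square N c n) * cis (ln (real n) * t)"
      unfolding conv_square_def of_real_sum sum_distrib_right
      by (intro sum.cong) (auto simp: case_prod_unfold)
    finally show "(\<Sum>x | x \<in> {1..N} \<times> {1..N} \<and> fst x * snd x = n. h x) = of_real (conv_square N c n) * cis (ln (real n) * t)" .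
  qed
  finally show ?thesis by (simp add: dpoly_def)
qed

lemma weighted_fourth_moment_le:
  assumes N: "1 \<le> N" "(real N)\<^sup>2 \<le> T"
  shows "integral {-T..T} (\<lambda>t. (1 - \<bar>t\<bar> / T) * (cmod (dpoly N c t)) ^ 4) \<le> 17 * T * mult_energy N c"
proof -
  have "(cmod (dpoly N c t)) ^ 4 = (cmod (dpoly (N\<^sup>2) (conv_square N c) t))\<^sup>2" for t
    unfolding dpoly_square [symmetric] norm_power by (simp add: power_mult [symmetric])
  then have "integral {-T..T} (\<lambda>t. (1 - \<bar>t\<bar> / T) * (cmod (dpoly N c t)) ^ 4) =
     integral {-T..T} (\<lambda>t. (1 - \<bar>t\<bar> / T) * (cmod (dpoly (N\<^sup>2) (conv_square N c) t))\<^sup>2)" by simp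
  also have "\<dots> \<le> 17 * T * (\<Sum>n=1..N\<^sup>2. (conv_square N c n)\<^sup>2)"
    using N by (intro weighted_mean_square_le) auto
  finally show ?thesis by (simp add: mult_energy_def conv_square_def)
qed

text \<open>The Fejer kernel is nonnegative, so all off-diagonal terms may be dropped.\<close>

lemma weighted_correlation_ge:
  assumes T: "T > 0" and c: "\<And>n. n \<in> {1..N} \<Longrightarrow> c n \<ge> 0" "(\<Sum>n=1..N. c n) = 1"
  shows "T \<le> integral {-T..T} (\<lambda>t. (1 - \<bar>t\<bar> / T) * (cmod (dpoly N (\<lambda>_. 1) t) * cmod (dpoly N c t)))"
proof -
  have "T = (\<Sum>m=1..N. c m * fejer T (ln (real m) - ln (real m)))"
    using c(2) by (simp add: fejer_def sum_distrib_right [symmetric])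
  also have "\<dots> \<le> (\<Sum>m=1..N. \<Sum>n=1..N. c n * fejer T (ln (real m) - ln (real n)))"
    using c(1) T by (intro sum_mono member_le_sum mult_nonneg_nonneg fejer_nonneg) auto
  also have "\<dots> = integral {-T..T} (\<lambda>t. (1 - \<bar>t\<bar> / T) * Re (dpoly N (\<lambda>_. 1) t * cnj (dpoly N c t)))"
    using integral_unique[OF has_integral_weighted_product[OF T, of N "\<lambda>_. 1" c]] by simp
  also have "\<dots> \<le> integral {-T..T} (\<lambda>t. (1 - \<bar>t\<bar> / T) * (cmod (dpoly N (\<lambda>_. 1) t) * cmod (dpoly N c t)))"
  proof (rule integral_le)
    show "(\<lambda>t. (1 - \<bar>t\<bar> / T) * Re (dpoly N (\<lambda>_. 1) t * cnj (dpoly N c t))) integrable_on {-T..T}"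
      using has_integral_weighted_product[OF T] by blast
    show "(\<lambda>t. (1 - \<bar>t\<bar> / T) * (cmod (dpoly N (\<lambda>_. 1) t) * cmod (dpoly N c t))) integrable_on {-T..T}"
      using T by (intro integrable_continuous_interval continuous_intros) auto
    fix t assume t: "t \<in> {-T..T}"
    then have "1 - \<bar>t\<bar> / T \<ge> 0" using T by (simp add: field_simps abs_le_iff)
    moreover have "Re (dpoly N (\<lambda>_. 1) t * cnj (dpoly N c t)) \<le> cmod (dpoly N (\<lambda>_. 1) t) * cmod (dpoly N c t)"
      using complex_Re_le_cmod[of "dpoly N (\<lambda>_. 1) t * cnj (dpoly N c t)"] by (simp add: norm_mult)
    ultimately show "(1 - \<bar>t\<bar> / T) * Re (dpoly N (\<lambda>_. 1) t * cnj (dpoly N c t)) \<le> (1 - \<bar>t\<bar> / T) * (cmod (dpoly N (\<lambda>_. 1) t) * cmod (dpoly N c t))"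
      by (rule mult_left_mono[rotated])
  qed
  finally show ?thesis .
qed

text \<open>Jensen's inequality for the logarithm, through \<open>ln y \<le> y - 1\<close> at the weighted
  mean.\<close>

lemma weighted_am_gm3:
  fixes u v w :: real
  assumes "u > 0" "v > 0" "w > 0" "\<alpha> \<ge> 0" "\<beta> \<ge> 0" "\<gamma> > 0" "\<alpha> + \<beta> + \<gamma> = 1"
  shows "u powr \<alpha> * v powr \<beta> * w powr \<gamma> \<le> \<alpha> * u + \<beta> * v + \<gamma> * w"
proof -
  define S where "S = \<alpha> * u + \<beta> * v + \<gamma> * w"
  have S: "S > 0" unfolding S_def using assms by (intro add_nonneg_pos add_nonneg_nonneg) auto
  have l: "ln x - ln S \<le> x / S - 1" if "x > 0" for x
    using ln_le_minus_one[of "x / S"] that S by (simp add: ln_div)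
  have "\<alpha> * (ln u - ln S) + \<beta> * (ln v - ln S) + \<gamma> * (ln w - ln S)
     \<le> \<alpha> * (u / S - 1) + \<beta> * (v / S - 1) + \<gamma> * (w / S - 1)"
    using assms by (intro add_mono mult_left_mono l) auto
  also have "\<dots> = (\<alpha> * u + \<beta> * v + \<gamma> * w) / S - (\<alpha> + \<beta> + \<gamma>)"
    by (simp add: add_divide_distrib algebra_simps)
  also have "\<dots> = 0" unfolding S_def [symmetric] using S assms by simp
  finally have "\<alpha> * ln u + \<beta> * ln v + \<gamma> * ln w \<le> (\<alpha> + \<beta> + \<gamma>) * ln S" by (simp add: algebra_simps)
  then have "exp (\<alpha> * ln u + \<beta> * ln v + \<gamma> * ln w) \<le> S" using S assms by (simp add: ln_ge_iff)
  then show ?thesis using assms by (simp add: powr_def exp_add S_def)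
qed

text \<open>Hoelder's inequality with exponents \<open>\<alpha>\<close>, \<open>\<beta>\<close> and
  \<open>1/4\<close>, subject to \<open>r \<alpha> + 2 \<beta> = 1\<close>, in the form of
  pointwise weighted AM-GM. The normaliser \<open>X\<close> of the \<open>r\<close>-th moment is
  chosen such that \<open>X powr \<alpha> * Y powr \<beta> * Z powr (1/4) = T\<close>; then the
  inequality says precisely that the moment is at least \<open>X\<close>.\<close>

lemma moment_lower_bound:
  fixes r T :: real
  assumes r: "0 < r" "r < 4/3" and N: "1 \<le> N" "(real N)\<^sup>2 \<le> T"
    and c: "c \<in> {1..N} \<rightarrow> {0..}" "(\<Sum>n=1..N. c n) = 1"
  shows "1 / T * integral {0..T} (\<lambda>t. norm (zeta_sum N t) powr r)
    \<ge> 17 powr (2 * r - 3) / 2 * (real N powr (r/2) / ((real N)\<^sup>2 * mult_energy N c) powr (1 - r/2))"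
proof -
  have "1 \<le> (real N)\<^sup>2" using N by simp
  then have T: "T > 0" using N by linarith
  have "real N * 1 \<le> (real N)\<^sup>2" using N unfolding power2_eq_square by (intro mult_left_mono) auto
  then have NT: "real N \<le> T" using N by linarith
  define M where "M = mult_energy N c"
  have "1 \<le> (real N)\<^sup>2 * M"
    unfolding M_def using min_energy_ge_1[of N] min_energy_le[OF c] N by linarith
  then have "0 < (real N)\<^sup>2 * M" by linarith
  then have M: "M > 0" using N by (simp add: zero_less_mult_iff)
  define d where "d = (\<lambda>t. cmod (dpoly N (\<lambda>_. 1) t))"
  define a where "a = (\<lambda>t. cmod (dpoly N c t))"
  have cd: "continuous_on S d" "continuous_on S a" for S
    unfolding d_def a_def by (intro continuous_intros)+
  define p where "p = (\<lambda>t. d t powr r)"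
  have cdr: "continuous_on S p" for S
    unfolding p_def using r by (intro continuous_on_powr' cd continuous_intros) (auto simp: d_def)
  define W where "W = (\<lambda>t. 1 - \<bar>t\<bar> / T)"
  have W: "0 \<le> W t" "W t \<le> 1" if "t \<in> {-T..T}" for t
    using that T by (auto simp: W_def field_simps abs_le_iff)
  have cW: "continuous_on S W" for S unfolding W_def using T by (intro continuous_intros) auto
  define I where "I = integral {-T..T} (\<lambda>t. W t * p t)"
  define \<alpha> \<beta> where "\<alpha> = 1 / (2 * (2 - r))" and "\<beta> = 3/4 - \<alpha>"
  have \<alpha>: "\<alpha> > 0" using r by (simp add: \<alpha>_def)
  have \<beta>: "\<beta> > 0" using r by (simp add: \<beta>_def \<alpha>_def field_simps)
  have sum1: "\<alpha> + \<beta> + 1/4 = 1" by (simp add: \<beta>_def)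
  have expo: "r * \<alpha> + 2 * \<beta> = 1"
  proof -
    have "(2 - r) * \<alpha> = 1/2" using r by (simp add: \<alpha>_def)
    then show ?thesis by (simp add: \<beta>_def algebra_simps)
  qed
  define Y Z where "Y = 17 * T * real N" and "Z = 17 * T * M"
  have YZ: "Y > 0" "Z > 0" using T N M by (auto simp: Y_def Z_def)
  \<comment> \<open>the value of the moment for which the weighted AM-GM inequality below becomes tight\<close>
  define X where "X = (T / (Y powr \<beta> * Z powr (1/4))) powr (1 / \<alpha>)"
  have X: "X > 0" using T YZ by (simp add: X_def)
  have XYZ: "X powr \<alpha> * Y powr \<beta> * Z powr (1/4) = T"
    using T YZ \<alpha> by (simp add: X_def powr_powr)
  have pt: "d t * a t \<le> T * (\<alpha> * (p t / X) + \<beta> * ((d t)\<^sup>2 / Y) + 1/4 * (a t ^ 4 / Z))" for t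
  proof (cases "d t = 0 \<or> a t = 0")
    case True
    have "0 \<le> T * (\<alpha> * (p t / X) + \<beta> * ((d t)\<^sup>2 / Y) + 1/4 * (a t ^ 4 / Z))"
      using T \<alpha> \<beta> X YZ by (intro mult_nonneg_nonneg add_nonneg_nonneg) (auto simp: p_def)
    then show ?thesis using True by auto
  next
    case False
    then have da: "d t > 0" "a t > 0" by (auto simp: d_def a_def)
    have "(d t powr r / X) powr \<alpha> * ((d t)\<^sup>2 / Y) powr \<beta> * (a t ^ 4 / Z) powr (1/4)
       \<le> \<alpha> * (d t powr r / X) + \<beta> * ((d t)\<^sup>2 / Y) + 1/4 * (a t ^ 4 / Z)"
      using da X YZ \<alpha> \<beta> sum1 by (intro weighted_am_gm3) auto
    also have "(d t powr r / X) powr \<alpha> * ((d t)\<^sup>2 / Y) powr \<beta> * (a t ^ 4 / Z) powr (1/4) =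
       (d t powr (r * \<alpha>) * d t powr (2 * \<beta>)) * a t powr (4 * (1/4)) / (X powr \<alpha> * Y powr \<beta> * Z powr (1/4))"
    proof -
      have "(d t)\<^sup>2 = d t powr 2" "a t ^ 4 = a t powr 4" using da by simp_all
      then show ?thesis using da X YZ by (simp only: powr_divide powr_powr) simp
    qed
    also have "d t powr (r * \<alpha>) * d t powr (2 * \<beta>) = d t"
      using da by (simp add: powr_add [symmetric] expo)
    finally show ?thesis using da T unfolding XYZ p_def by (simp add: field_simps)
  qed
  have int: "f integrable_on {-T..T}" if "continuous_on {-T..T} f" for f :: "real \<Rightarrow> real"
    using that by (rule integrable_continuous_interval)
  have "T \<le> integral {-T..T} (\<lambda>t. W t * (d t * a t))"
    unfolding W_def d_def a_def using c by (intro weighted_correlation_ge T) auto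
  also have "\<dots> \<le> integral {-T..T} (\<lambda>t. T * (\<alpha> / X * (W t * p t) + \<beta> / Y * (W t * (d t)\<^sup>2) + 1/4 / Z * (W t * a t ^ 4)))"
  proof (intro integral_le int continuous_intros cd cdr cW)
    fix t assume t: "t \<in> {-T..T}"
    have "W t * (d t * a t) \<le> W t * (T * (\<alpha> * (p t / X) + \<beta> * ((d t)\<^sup>2 / Y) + 1/4 * (a t ^ 4 / Z)))"
      using W(1)[OF t] pt by (intro mult_left_mono) auto
    also have "\<dots> = T * (\<alpha> / X * (W t * p t) + \<beta> / Y * (W t * (d t)\<^sup>2) + 1/4 / Z * (W t * a t ^ 4))"
      by (simp add: algebra_simps)
    finally show "W t * (d t * a t) \<le> T * (\<alpha> / X * (W t * p t) + \<beta> / Y * (W t * (d t)\<^sup>2) + 1/4 / Z * (W t * a t ^ 4))" .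
  qed
  also have "\<dots> = T * (\<alpha> / X * I + \<beta> / Y * integral {-T..T} (\<lambda>t. W t * (d t)\<^sup>2) + 1/4 / Z * integral {-T..T} (\<lambda>t. W t * a t ^ 4))"
    unfolding I_def
    by (subst integral_mult_right, subst integral_add, (intro int continuous_intros cd cdr cW)+,
        subst integral_add, (intro int continuous_intros cd cdr cW)+) simp
  also have "\<dots> \<le> T * (\<alpha> / X * I + \<beta> / Y * Y + 1/4 / Z * Z)"
  proof (intro mult_left_mono add_mono order_refl)
    show "integral {-T..T} (\<lambda>t. W t * (d t)\<^sup>2) \<le> Y"
      using weighted_mean_square_le[OF N(1) NT, of "\<lambda>_. 1"] by (simp add: W_def d_def Y_def)
    show "integral {-T..T} (\<lambda>t. W t * a t ^ 4) \<le> Z"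
      using weighted_fourth_moment_le[OF N, of c] by (simp add: W_def a_def Z_def M_def)
  qed (use T \<alpha> \<beta> X YZ in auto)
  also have "\<dots> = T * (\<alpha> / X * I + (1 - \<alpha>))"
    using YZ by (simp add: \<beta>_def)
  finally have "T * 1 \<le> T * (\<alpha> / X * I + (1 - \<alpha>))" by simp
  then have "1 \<le> \<alpha> / X * I + (1 - \<alpha>)" by (subst (asm) mult_le_cancel_left_pos[OF T])
  then have XI: "X \<le> I" using \<alpha> X by (simp add: field_simps)
  have "I \<le> integral {-T..T} p"
    unfolding I_def
  proof (intro integral_le int continuous_intros cd cdr cW)
    fix t assume "t \<in> {-T..T}"
    then show "W t * p t \<le> p t" using W[of t] by (simp add: mult_left_le_one_le p_def)
  qed
  also have "\<dots> = 2 * integral {0..T} p"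
  proof (intro integral_unique even_has_integral_symmetric integrable_integral integrable_continuous_interval cdr)
    show "p (- t) = p t" for t by (simp add: p_def d_def dpoly_minus)
  qed (use T in auto)
  finally have "X / (2 * T) \<le> 1 / T * integral {0..T} p"
    using XI T by (simp add: field_simps)
  also have "p = (\<lambda>t. norm (zeta_sum N t) powr r)"
    by (simp add: p_def d_def zeta_sum_eq_dpoly fun_eq_iff)
  finally have main: "X / (2 * T) \<le> 1 / T * integral {0..T} (\<lambda>t. norm (zeta_sum N t) powr r)" .
  define e where "e = 2 * (2 - r)"
  have e: "1 / \<alpha> = e" "e * \<beta> = 3/4 * e - 1"
  proof -
    show e1: "1 / \<alpha> = e" by (simp add: e_def \<alpha>_def)
    then have "e * \<alpha> = 1" using \<alpha> by (simp add: field_simps)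
    then show "e * \<beta> = 3/4 * e - 1" by (simp add: \<beta>_def algebra_simps)
  qed
  have e4: "e / 4 = 1 - r / 2" by (simp add: e_def)
  have N0: "real N > 0" using N by simp
  have "ln (X / T) = e * ln T - (e * \<beta>) * ln Y - e / 4 * ln Z - ln T"
    using X T YZ unfolding X_def e(1) by (simp add: ln_div ln_mult ln_powr algebra_simps)
  also have "\<dots> = ln (17 powr (2 * r - 3) * (real N powr (r/2) / ((real N)\<^sup>2 * M) powr (1 - r/2)))"
    unfolding e(2) e4 using T N0 M
    by (simp add: Y_def Z_def ln_mult ln_div ln_powr ln_realpow e_def algebra_simps)
  finally have "X / T = 17 powr (2 * r - 3) * (real N powr (r/2) / ((real N)\<^sup>2 * M) powr (1 - r/2))"
    using X T N0 M by (subst (asm) ln_inj_iff) auto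
  then have "X / (2 * T) = 17 powr (2 * r - 3) / 2 * (real N powr (r/2) / ((real N)\<^sup>2 * M) powr (1 - r/2))"
    by (simp add: field_simps)
  then show ?thesis using main by (simp only: M_def)
qed

text \<open>The bound for each \<open>c\<close> is solved for its energy, as the infimum can be taken only
  on that side.\<close>

lemma moment_lower_bound_min_energy:
  fixes r :: real
  assumes r: "0 < r" "r < 4/3"
  shows "\<exists>K>0. \<forall>(T::real) (N::nat). 1 \<le> T \<and> 1 \<le> N \<and> real N \<le> sqrt T \<longrightarrow>
         1 / T * integral {0..T} (\<lambda>t. norm (zeta_sum N t) powr r)
           \<ge> K * (real N powr (r/2) / min_energy N powr (1 - r/2))"
proof (intro exI[of _ "17 powr (2 * r - 3) / 2"] conjI allI impI)
  fix T :: real and N :: nat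
  assume TN: "1 \<le> T \<and> 1 \<le> N \<and> real N \<le> sqrt T"
  define K :: real where "K = 17 powr (2 * r - 3) / 2"
  have K: "K > 0" by (simp add: K_def)
  define s where "s = 1 - r / 2"
  have s: "s > 0" using r by (simp add: s_def)
  define J where "J = 1 / T * integral {0..T} (\<lambda>t. norm (zeta_sum N t) powr r)"
  have "(real N)\<^sup>2 \<le> (sqrt T)\<^sup>2" using TN by (intro power_mono) auto
  then have N: "1 \<le> N" "(real N)\<^sup>2 \<le> T" using TN by auto
  have E1: "min_energy N \<ge> 1" by (rule min_energy_ge_1[OF N(1)])
  define B where "B = K * real N powr (r/2)"
  have B: "B > 0" using K N by (simp add: B_def)
  have each: "B \<le> J * ((real N)\<^sup>2 * mult_energy N c) powr s" and Jpos: "J > 0"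
    if c: "c \<in> {1..N} \<rightarrow> {0..}" "(\<Sum>n=1..N. c n) = 1" for c
  proof -
    define x where "x = (real N)\<^sup>2 * mult_energy N c"
    have x: "x \<ge> 1" using E1 min_energy_le[OF c] by (simp add: x_def)
    then have xp: "x powr s > 0" by simp
    have "B / x powr s \<le> J"
      using moment_lower_bound[OF r N c] by (simp add: J_def B_def K_def x_def s_def)
    moreover have "0 < B / x powr s" using B xp by simp
    ultimately show "J > 0" by linarith
    show "B \<le> J * ((real N)\<^sup>2 * mult_energy N c) powr s"
      using \<open>B / x powr s \<le> J\<close> xp by (simp add: field_simps x_def)
  qed
  show "1 / T * integral {0..T} (\<lambda>t. norm (zeta_sum N t) powr r)
           \<ge> 17 powr (2 * r - 3) / 2 * (real N powr (r/2) / min_energy N powr (1 - r/2))"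
  proof (cases "J > 0")
    case False
    \<comment> \<open>impossible, since admissible \<open>c\<close> exist: otherwise any lower bound for the infimum would hold\<close>
    have "2 * min_energy N \<le> min_energy N"
    proof (rule min_energy_greatest[OF N(1)])
      fix c assume "c \<in> {1..N} \<rightarrow> {0::real..}" "(\<Sum>n=1..N. c n) = 1"
      then show "2 * min_energy N \<le> (real N)\<^sup>2 * mult_energy N c" using Jpos False by blast
    qed
    then show ?thesis using E1 by linarith
  next
    case True
    have "(B / J) powr (1 / s) \<le> min_energy N"
    proof (rule min_energy_greatest[OF N(1)])
      fix c assume c: "c \<in> {1..N} \<rightarrow> {0::real..}" "(\<Sum>n=1..N. c n) = 1"
      define x where "x = (real N)\<^sup>2 * mult_energy N c"
      have x: "x \<ge> 1" using E1 min_energy_le[OF c] by (simp add: x_def)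
      have "B / J \<le> x powr s" using each[OF c] True by (simp add: x_def field_simps)
      then have "(B / J) powr (1 / s) \<le> (x powr s) powr (1 / s)"
        using B True s by (intro powr_mono2) auto
      also have "\<dots> = x" using s x by (simp add: powr_powr)
      finally show "(B / J) powr (1 / s) \<le> (real N)\<^sup>2 * mult_energy N c" by (simp add: x_def)
    qed
    then have "((B / J) powr (1 / s)) powr s \<le> min_energy N powr s"
      using s by (intro powr_mono2) auto
    then have "B / J \<le> min_energy N powr s" using s B True by (simp add: powr_powr)
    then have "B / min_energy N powr s \<le> J" using True E1 by (simp add: field_simps)
    then show ?thesis by (simp add: B_def J_def K_def s_def)
  qed
qed auto

section \<open>Existence of the mean value\<close>

text \<open>Real trigonometric polynomials with arbitrary real frequencies; phases are included so that
  products stay inside.\<close>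

inductive_set trig_sums :: "(real \<Rightarrow> real) set" where
  wave: "(\<lambda>t. a * cos (x * t + b)) \<in> trig_sums"
| add: "f \<in> trig_sums \<Longrightarrow> g \<in> trig_sums \<Longrightarrow> (\<lambda>t. f t + g t) \<in> trig_sums"

lemma trig_sums_const: "(\<lambda>t. a) \<in> trig_sums"
  using trig_sums.wave[of a 0 0] by simp

lemma trig_sums_sum:
  "finite S \<Longrightarrow> (\<And>s. s \<in> S \<Longrightarrow> f s \<in> trig_sums) \<Longrightarrow> (\<lambda>t. \<Sum>s\<in>S. f s t) \<in> trig_sums"
  by (induction S rule: finite_induct) (auto intro: trig_sums_const trig_sums.add)

lemma trig_sums_mult:
  assumes "f \<in> trig_sums" "g \<in> trig_sums"
  shows "(\<lambda>t. f t * g t) \<in> trig_sums"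
  using assms(1)
proof induction
  case (wave a x b)
  show ?case using assms(2)
  proof induction
    case (wave a' x' b')
    have "(\<lambda>t. a * cos (x * t + b) * (a' * cos (x' * t + b'))) =
      (\<lambda>t. a * a' / 2 * cos ((x - x') * t + (b - b')) + a * a' / 2 * cos ((x + x') * t + (b + b')))"
    proof
      fix t
      have "cos ((x - x') * t + (b - b')) + cos ((x + x') * t + (b + b')) = 2 * (cos (x * t + b) * cos (x' * t + b'))"
        using cos_times_cos[of "x * t + b" "x' * t + b'"] by (simp add: algebra_simps)
      then show "a * cos (x * t + b) * (a' * cos (x' * t + b')) =
         a * a' / 2 * cos ((x - x') * t + (b - b')) + a * a' / 2 * cos ((x + x') * t + (b + b'))"
        by (simp only: distrib_left [symmetric]) simp
    qed
    then show ?case by (simp only:) (intro trig_sums.intros)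
  next
    case (add f g)
    then show ?case unfolding distrib_left by (intro trig_sums.add)
  qed
next
  case (add f1 f2)
  then show ?case unfolding distrib_right by (intro trig_sums.add)
qed

lemma trig_sums_continuous: "f \<in> trig_sums \<Longrightarrow> continuous_on S f"
  by (induction rule: trig_sums.induct) (auto intro!: continuous_intros)

definition has_mean :: "(real \<Rightarrow> real) \<Rightarrow> real \<Rightarrow> bool" where
  "has_mean f L \<longleftrightarrow> ((\<lambda>T. 1 / T * integral {0..T} f) \<longlongrightarrow> L) at_top"

lemma trig_sums_has_mean: "f \<in> trig_sums \<Longrightarrow> \<exists>L. has_mean f L"
proof (induction rule: trig_sums.induct)
  case (wave a x b)
  show ?case
  proof (cases "x = 0")
    case True
    have "eventually (\<lambda>T::real. 1 / T * integral {0..T} (\<lambda>t. a * cos (x * t + b)) = a * cos b) at_top"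
      using eventually_gt_at_top[of 0] by eventually_elim (simp add: True)
    then have "has_mean (\<lambda>t. a * cos (x * t + b)) (a * cos b)"
      unfolding has_mean_def by (rule tendsto_eventually)
    then show ?thesis by blast
  next
    case False
    have int: "integral {0..T} (\<lambda>t. a * cos (x * t + b)) = a / x * (sin (x * T + b) - sin b)" if "T > 0" for T
    proof -
      have "((\<lambda>t. a * cos (x * t + b)) has_integral (a / x * sin (x * T + b) - a / x * sin (x * 0 + b))) {0..T}"
        by (rule fundamental_theorem_of_calculus)
          (use that False in \<open>auto intro!: derivative_eq_intros simp: has_real_derivative_iff_has_vector_derivative [symmetric]\<close>)
      from integral_unique[OF this] show ?thesis
        by (simp only: mult_zero_right add_0 right_diff_distrib)
    qed
    have "((\<lambda>T. 1 / T * (a / x * (sin (x * T + b) - sin b))) \<longlongrightarrow> 0) at_top"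
    proof (rule Lim_null_comparison)
      show "\<forall>\<^sub>F T in at_top. norm (1 / T * (a / x * (sin (x * T + b) - sin b))) \<le> \<bar>a / x\<bar> * 2 * (1 / T)"
        using eventually_gt_at_top[of 0]
      proof eventually_elim
        case (elim T)
        have "\<bar>sin (x * T + b) - sin b\<bar> \<le> 1 + 1"
          by (rule order_trans[OF abs_triangle_ineq4 add_mono]) (rule abs_sin_le_one)+
        then have "\<bar>a / x\<bar> * \<bar>sin (x * T + b) - sin b\<bar> * (1 / T) \<le> \<bar>a / x\<bar> * 2 * (1 / T)"
          using elim by (intro mult_right_mono mult_left_mono) auto
        then show ?case using elim by (simp add: abs_mult mult_ac)
      qed
      have "((\<lambda>T::real. \<bar>a / x\<bar> * 2 * (1 / T)) \<longlongrightarrow> \<bar>a / x\<bar> * 2 * 0) at_top"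
        by (intro tendsto_mult tendsto_const) (simp add: tendsto_inverse_0_at_top filterlim_ident divide_inverse)
      then show "((\<lambda>T::real. \<bar>a / x\<bar> * 2 * (1 / T)) \<longlongrightarrow> 0) at_top" by simp
    qed
    then have "has_mean (\<lambda>t. a * cos (x * t + b)) 0"
      unfolding has_mean_def
      by (rule Lim_transform_eventually) (use eventually_gt_at_top[of 0] in \<open>eventually_elim, simp only: int\<close>)
    then show ?thesis by blast
  qed
next
  case (add f g)
  then obtain L M where LM: "has_mean f L" "has_mean g M" by blast
  have "1 / T * integral {0..T} (\<lambda>t. f t + g t) = 1 / T * integral {0..T} f + 1 / T * integral {0..T} g" for T
    using add.hyps trig_sums_continuous
    by (subst integral_add) (auto intro!: integrable_continuous_interval simp: distrib_left)
  then have "has_mean (\<lambda>t. f t + g t) (L + M)"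
    using tendsto_add[OF LM[unfolded has_mean_def]] unfolding has_mean_def by simp
  then show ?case by blast
qed

lemma mean_close:
  fixes f g :: "real \<Rightarrow> real"
  assumes "continuous_on {0..T} f" "continuous_on {0..T} g" "T > 0" "\<And>t. \<bar>f t - g t\<bar> \<le> e"
  shows "\<bar>1 / T * integral {0..T} f - 1 / T * integral {0..T} g\<bar> \<le> e"
proof -
  note int = integrable_continuous_interval[OF assms(1)] integrable_continuous_interval[OF assms(2)]
  have "norm (integral {0..T} (\<lambda>t. f t - g t)) \<le> integral {0..T} (\<lambda>t. e)"
    by (intro integral_norm_bound_integral integrable_diff int) (use assms in auto)
  also have "\<dots> = e * T" using assms by simp
  finally have "\<bar>integral {0..T} f - integral {0..T} g\<bar> \<le> e * T"
    using int by (simp add: integral_diff)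
  then have "\<bar>integral {0..T} f - integral {0..T} g\<bar> / T \<le> e" using assms by (simp add: field_simps)
  also have "\<bar>integral {0..T} f - integral {0..T} g\<bar> / T = \<bar>1 / T * integral {0..T} f - 1 / T * integral {0..T} g\<bar>"
    using assms by (simp add: diff_divide_distrib [symmetric])
  finally show ?thesis .
qed

text \<open>Means of uniformly close functions are close, so the averages satisfy the Cauchy criterion.\<close>

lemma uniform_limit_has_mean:
  assumes f: "continuous_on UNIV f"
    and approx: "\<And>e. e > 0 \<Longrightarrow> \<exists>g\<in>trig_sums. \<forall>t. \<bar>f t - g t\<bar> \<le> e"
  shows "\<exists>L. has_mean f L"
proof -
  define F where "F = (\<lambda>T. 1 / T * integral {0..T} f)"
  have cauchy: "\<exists>T0. \<forall>S\<ge>T0. \<forall>T\<ge>T0. \<bar>F S - F T\<bar> < e" if e: "e > 0" for e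
  proof -
    obtain g where g: "g \<in> trig_sums" "\<And>t. \<bar>f t - g t\<bar> \<le> e / 5" using approx[of "e / 5"] e by auto
    obtain L where L: "has_mean g L" using trig_sums_has_mean[OF g(1)] by blast
    have "eventually (\<lambda>T. dist (1 / T * integral {0..T} g) L < e / 5) at_top"
      using L e unfolding has_mean_def by (intro tendstoD) auto
    then obtain T1 where T1: "\<And>T. T \<ge> T1 \<Longrightarrow> \<bar>1 / T * integral {0..T} g - L\<bar> < e / 5"
      unfolding eventually_at_top_linorder dist_real_def by blast
    have near: "\<bar>F T - L\<bar> \<le> e / 5 + e / 5" if "T \<ge> max 1 T1" for T
    proof -
      have "\<bar>F T - 1 / T * integral {0..T} g\<bar> \<le> e / 5"
        unfolding F_def
        by (rule mean_close) (use f g that trig_sums_continuous in \<open>auto intro: continuous_on_subset\<close>)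
      moreover have "\<bar>1 / T * integral {0..T} g - L\<bar> < e / 5" using T1 that by auto
      ultimately show ?thesis by linarith
    qed
    have "\<bar>F S - F T\<bar> < e" if "S \<ge> max 1 T1" "T \<ge> max 1 T1" for S T
      using near[OF that(1)] near[OF that(2)] e by linarith
    then show ?thesis by blast
  qed
  have "Cauchy (\<lambda>n. F (real n))"
  proof (rule CauchyI)
    fix e :: real assume "e > 0"
    then obtain T0 where T0: "\<And>S T. S \<ge> T0 \<Longrightarrow> T \<ge> T0 \<Longrightarrow> \<bar>F S - F T\<bar> < e" using cauchy by blast
    obtain M :: nat where "real M \<ge> T0" using real_arch_simple by blast
    then show "\<exists>M. \<forall>m\<ge>M. \<forall>n\<ge>M. norm (F (real m) - F (real n)) < e"
      using T0 by (intro exI[of _ M]) (auto intro: order_trans)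
  qed
  then obtain L where L: "(\<lambda>n. F (real n)) \<longlonglongrightarrow> L" using Cauchy_convergent_iff convergent_def by metis
  have "(F \<longlongrightarrow> L) at_top"
  proof (rule tendstoI)
    fix e :: real assume e: "e > 0"
    then obtain T0 where T0: "\<And>S T. S \<ge> T0 \<Longrightarrow> T \<ge> T0 \<Longrightarrow> \<bar>F S - F T\<bar> < e / 2"
      using cauchy[of "e / 2"] by auto
    have "eventually (\<lambda>n. dist (F (real n)) L < e / 2) sequentially"
      using L e by (intro tendstoD) auto
    moreover have "eventually (\<lambda>n. real n \<ge> T0) sequentially"
      using filterlim_real_sequentially unfolding filterlim_at_top by blast
    ultimately have "eventually (\<lambda>n. dist (F (real n)) L < e / 2 \<and> real n \<ge> T0) sequentially"
      by (rule eventually_conj)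
    then obtain n where n: "dist (F (real n)) L < e / 2" "real n \<ge> T0"
      using eventually_happens sequentially_bot by blast
    have "dist (F T) L < e" if "T \<ge> T0" for T
      using T0[OF that n(2)] n(1) unfolding dist_real_def by linarith
    then show "eventually (\<lambda>T. dist (F T) L < e) at_top"
      unfolding eventually_at_top_linorder by blast
  qed
  then show ?thesis unfolding has_mean_def F_def by blast
qed

lemma polynomial_of_trig_sum:
  assumes "real_polynomial_function p" "f \<in> trig_sums"
  shows "(\<lambda>t. p (f t)) \<in> trig_sums"
  using assms(1)
proof (induction rule: real_polynomial_function.induct)
  case (linear h)
  have lin: "h x = h 1 * x" for x
    using linear linear_scale[OF bounded_linear.linear[OF linear], of x 1] by simp
  have "(\<lambda>t. h (f t)) = (\<lambda>t. h 1 * f t)" by (rule ext) (rule lin)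
  then show ?case using trig_sums_mult[OF trig_sums_const assms(2), of "h 1"] by simp
next
  case (const c)
  show ?case by (rule trig_sums_const)
next
  case (add f g)
  then show ?case by (intro trig_sums.add)
next
  case (mult f g)
  then show ?case by (intro trig_sums_mult)
qed

text \<open>\<open>|dpoly N a t|\<^sup>2\<close> is a bounded trigonometric sum. Approximate the square root
  uniformly on its range by polynomials.\<close>

lemma ex_mean_norm_dpoly: "\<exists>L. has_mean (\<lambda>t. cmod (dpoly N a t)) L"
proof (rule uniform_limit_has_mean)
  show "continuous_on UNIV (\<lambda>t. cmod (dpoly N a t))" by (intro continuous_intros)
next
  fix e :: real assume e: "e > 0"
  define f where "f = (\<lambda>t. (cmod (dpoly N a t))\<^sup>2)"
  have "f = (\<lambda>t. \<Sum>m=1..N. \<Sum>n=1..N. a m * a n * cos ((ln (real m) - ln (real n)) * t + 0))"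
    unfolding f_def using Re_dpoly_cnj[of N a _ a] by (simp add: fun_eq_iff complex_mult_cnj cmod_power2)
  then have f: "f \<in> trig_sums"
    by (simp only:) (intro trig_sums_sum finite_atLeastAtMost trig_sums.wave)
  define B where "B = (\<Sum>n=1..N. \<bar>a n\<bar>)\<^sup>2"
  have fB: "f t \<in> {0..B}" for t
  proof -
    have "cmod (dpoly N a t) \<le> (\<Sum>n=1..N. \<bar>a n\<bar>)"
      unfolding dpoly_def by (rule order_trans[OF norm_sum]) (simp add: norm_mult)
    then show ?thesis unfolding f_def B_def by (auto intro: power_mono)
  qed
  have "continuous_on {0..B} sqrt" by (intro continuous_intros)
  then obtain p where p: "real_polynomial_function p" "\<And>x. x \<in> {0..B} \<Longrightarrow> \<bar>sqrt x - p x\<bar> < e"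
    using Stone_Weierstrass_real_polynomial_function[of "{0..B}" sqrt e] e by blast
  have "\<bar>cmod (dpoly N a t) - p (f t)\<bar> \<le> e" for t
    using p(2)[OF fB[of t]] by (simp add: f_def)
  then show "\<exists>g\<in>trig_sums. \<forall>t. \<bar>cmod (dpoly N a t) - g t\<bar> \<le> e"
    by (intro bexI[OF _ polynomial_of_trig_sum[OF p(1) f]] allI)
qed

text \<open>The moment bound with \<open>r = 1\<close> holds for all \<open>T \<ge> N\<^sup>2\<close> and
  passes to the limit.\<close>

lemma mean_zeta_sum_lower:
  "\<exists>K>0. \<forall>N::nat. 1 \<le> N \<longrightarrow>
      (\<exists>L::real.
         ((\<lambda>T. 1 / T * integral {0..T} (\<lambda>t. norm (zeta_sum N t))) \<longlongrightarrow> L) at_top \<and>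
         L \<ge> K * sqrt (real N / min_energy N))"
proof -
  obtain K where K: "K > 0" "\<And>T N. 1 \<le> T \<Longrightarrow> 1 \<le> N \<Longrightarrow> real N \<le> sqrt T \<Longrightarrow>
         1 / T * integral {0..T} (\<lambda>t. norm (zeta_sum N t) powr 1)
           \<ge> K * (real N powr (1/2) / min_energy N powr (1 - 1/2))"
    using moment_lower_bound_min_energy[of 1] by auto
  show ?thesis
  proof (rule exI[of _ K], intro conjI K(1) allI impI)
    fix N :: nat assume N: "1 \<le> N"
    obtain L where L: "((\<lambda>T. 1 / T * integral {0..T} (\<lambda>t. norm (zeta_sum N t))) \<longlongrightarrow> L) at_top"
      using ex_mean_norm_dpoly[of N "\<lambda>_. 1"] unfolding has_mean_def zeta_sum_eq_dpoly by blast
    have "K * sqrt (real N / min_energy N) \<le> L"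
    proof (rule tendsto_lowerbound[OF L])
      show "\<forall>\<^sub>F T in at_top. K * sqrt (real N / min_energy N) \<le> 1 / T * integral {0..T} (\<lambda>t. norm (zeta_sum N t))"
        using eventually_ge_at_top[of "(real N)\<^sup>2"]
      proof eventually_elim
        case (elim T)
        have "1 \<le> (real N)\<^sup>2" using N by simp
        then have "1 \<le> T" using elim by linarith
        moreover have "real N \<le> sqrt T" using elim by (rule real_le_rsqrt)
        ultimately have "K * (real N powr (1/2) / min_energy N powr (1 - 1/2)) \<le>
           1 / T * integral {0..T} (\<lambda>t. norm (zeta_sum N t) powr 1)" using K(2) N by blast
        then show ?case using min_energy_ge_1[OF N]
          by (simp add: powr_half_sqrt real_sqrt_divide)
      qed
    qed simp
    with L show "\<exists>L. ((\<lambda>T. 1 / T * integral {0..T} (\<lambda>t. norm (zeta_sum N t))) \<longlongrightarrow> L) at_top \<and> K * sqrt (real N / min_energy N) \<le> L"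
      by blast
  qed
qed

theorem theorem1p6:
  "(\<forall>r::real. 0 < r \<and> r < 4/3 \<longrightarrow>
      (\<exists>K>0. \<forall>(T::real) (N::nat). 1 \<le> T \<and> 1 \<le> N \<and> real N \<le> sqrt T \<longrightarrow>
         1 / T * integral {0..T} (\<lambda>t. norm (zeta_sum N t) powr r)
           \<ge> K * (real N powr (r/2) / min_energy N powr (1 - r/2)))) \<and>
   (\<exists>K>0. \<forall>N::nat. 1 \<le> N \<longrightarrow>
      (\<exists>L::real.
         ((\<lambda>T. 1 / T * integral {0..T} (\<lambda>t. norm (zeta_sum N t))) \<longlongrightarrow> L) at_top \<and>
         L \<ge> K * sqrt (real N / min_energy N))) \<and>
   (\<exists>K>0. \<forall>N::nat. 3 \<le> N \<longrightarrow>
      sqrt (real N / min_energy N)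
        \<ge> K * (sqrt (real N) /
                (ln (real N) powr (erdos_exponent / 2) * (ln (ln (real N)))^3)))"
  using moment_lower_bound_min_energy mean_zeta_sum_lower sqrt_energy_lower by blast

end
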